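(* Let $d\ge 1$ be an integer, $0<\alpha<2$, $\beta>1$ and $\varphi(x)=|x|^\beta$ for $x\in\mathbb{R}$. Assume: (b) $h:[0,\infty)\to[0,\infty)$ is a continuous function with $h(x)>0$ if $x\neq 0$; (c) $k:[0,\infty)\to[0,\infty)$ is a continuous function; (d) $\sup_{t\in[0,T]}\int_0^t\left(\int_s^t k(r)\,dr\right)^{-1/\alpha}ds<\infty$ for every $T>0$; (e) $u_0\in C_b(\mathbb{R}^d)\cap L^1(\mathbb{R}^d)$. Suppose in addition $u_0\ge 0$ and $\|u_0\|_1>0$, and let $u$ be the solution in $C_b^{1,2}((0,\infty)\times\mathbb{R}^d)$ of $$\partial_t u(t,x)=k(t)\Delta_\alpha u(t,x)-h(t)\varphi(u(t,x)),\quad (t,x)\in(0,\infty)\times\mathbb{R}^d,\qquad u(0,x)=u_0(x),\quad x\in\mathbb{R}^d.$$ Let $K(t)=\int_0^t k(s)\,ds$ and $M(t)=\int_{\mathbb{R}^d}u(t,x)\,dx$. If $$\int_1^\infty h(s)K(s)^{-\frac{d}{\alpha}(\beta-1)}\,ds<\infty,$$ then there exists $M(\infty)\in(0,\infty)$ such that $\lim_{t\to\infty}M(t)=M(\infty)$.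
   Context: $C_b(\mathbb{R}^d)$ is the space of bounded continuous real functions on $\mathbb{R}^d$; $C_b^2(\mathbb{R}^d)$ is the space of $C^2$ functions that are bounded together with their derivatives up to order two. $\|\cdot\|_1$ is the $L^1(\mathbb{R}^d)$ norm. $\Delta_\alpha=-(-\Delta)^{\alpha/2}$ is the fractional Laplacian (Fourier symbol $-\|\xi\|^\alpha$), defined on $C_b^2(\mathbb{R}^d)$ by $$\Delta_\alpha f(x)=c\left(\int_{\|z\|<r}\frac{f(x+z)-f(x)-\nabla f(x)\cdot z}{\|z\|^{d+\alpha}}dz+\int_{\|z\|\ge r}\frac{f(x+z)-f(x)}{\|z\|^{d+\alpha}}dz\right),$$ where $c=c(\alpha,d)>0$ is the normalizing constant giving the symbol $-\|\xi\|^\alpha$, and the value does not depend on $r>0$. In the equation $\Delta_\alpha$ acts in the $x$ variable. A solution $u\in C_b^{1,2}((0,\infty)\times\mathbb{R}^d)$ is a classical one: $u$ is bounded, continuous on $[0,\infty)\times\mathbb{R}^d$ with $u(0,\cdot)=u_0$, continuously differentiable in $t$ on $(0,\infty)\times\mathbb{R}^d$, $u(t,\cdot)\in C_b^2(\mathbb{R}^d)$ for each $t>0$, and the equation holds pointwise for $t>0$. Under the hypotheses, for $u_0\ge0$ such a solution exists, is unique and is non-negative. *)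

theory Defs
  imports "HOL-Analysis.Analysis"
begin

definition Cb2 :: "(real^'n \<Rightarrow> real) set" where
  "Cb2 = {f. bounded (range f) \<and>
     (\<exists>(f' :: real^'n \<Rightarrow> (real^'n) \<Rightarrow>\<^sub>L real) (f'' :: real^'n \<Rightarrow> (real^'n) \<Rightarrow>\<^sub>L (real^'n) \<Rightarrow>\<^sub>L real).
        (\<forall>x. (f has_derivative blinfun_apply (f' x)) (at x)) \<and>
        (\<forall>x. (f' has_derivative blinfun_apply (f'' x)) (at x)) \<and>
        continuous_on UNIV f'' \<and> bounded (range f') \<and> bounded (range f''))}"

(* The operator f |-> \<integral> (f(x+z) - f(x) - ...) / |z|^(d+\<alpha>) dz multiplies x |-> exp(i \<xi>.x) by
   -\<integral> (1 - cos(\<xi>.z)) / |z|^(d+\<alpha>) dz, since the odd parts cancel.  The constant c makes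
   this symbol equal to -|\<xi>|^\<alpha>. *)
definition frac_const :: "'n::finite itself \<Rightarrow> real \<Rightarrow> real" where
  "frac_const (_ :: 'n itself) \<alpha> =
     (THE c. c > 0 \<and>
        (\<forall>\<xi> :: real^'n.
           c * (LINT z|lborel. (1 - cos (\<xi> \<bullet> z)) / norm z powr (real CARD('n) + \<alpha>))
             = norm \<xi> powr \<alpha>))"

(* On Cb2 the value does not depend on the cut-off radius r > 0.
   The Frechet derivative of f at x, applied to z, is the term \<nabla>f(x).z. *)
definition frac_laplacian :: "real \<Rightarrow> real \<Rightarrow> (real^'n \<Rightarrow> real) \<Rightarrow> real^'n \<Rightarrow> real" where
  "frac_laplacian r \<alpha> f x = frac_const TYPE('n) \<alpha> *
     ((LINT z:{z. norm z < r}|lborel.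
         (f (x + z) - f x - frechet_derivative f (at x) z) / norm z powr (real CARD('n) + \<alpha>))
      + (LINT z:{z. norm z \<ge> r}|lborel.
         (f (x + z) - f x) / norm z powr (real CARD('n) + \<alpha>)))"

(* Bounded classical solution of u_t = k(t) \<Delta>_\<alpha> u - h(t) \<phi>(u), u(0,.) = u0.
   Only the values u t x with t \<ge> 0 are relevant. *)
definition classical_solution ::
  "real \<Rightarrow> real \<Rightarrow> (real \<Rightarrow> real) \<Rightarrow> (real \<Rightarrow> real) \<Rightarrow> (real \<Rightarrow> real) \<Rightarrow> (real^'n \<Rightarrow> real)
    \<Rightarrow> (real \<Rightarrow> real^'n \<Rightarrow> real) \<Rightarrow> bool" where
  "classical_solution r \<alpha> k h \<phi> u0 u \<longleftrightarrow>
     bounded ((\<lambda>(t, x). u t x) ` ({0..} \<times> UNIV)) \<and>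
     continuous_on ({0..} \<times> UNIV) (\<lambda>(t, x). u t x) \<and>
     u 0 = u0 \<and>
     (\<forall>t>0. \<forall>x. (\<lambda>s. u s x) differentiable (at t)) \<and>
     continuous_on ({0<..} \<times> UNIV) (\<lambda>(t, x). deriv (\<lambda>s. u s x) t) \<and>
     (\<forall>t>0. u t \<in> Cb2) \<and>
     (\<forall>t>0. \<forall>x. deriv (\<lambda>s. u s x) t = k t * frac_laplacian r \<alpha> (u t) x - h t * \<phi> (u t x))"

(* x^(-p) as an element of [0,\<infinity>], for x \<ge> 0 and p > 0.  It is \<infinity> at x = 0, whereas the real
   power 0 powr (-p) is 0; this matters where k vanishes on an interval. *)
definition neg_powr :: "real \<Rightarrow> real \<Rightarrow> ennreal" where
  "neg_powr x p = inverse (ennreal (x powr p))"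

end

(* Testing the equation against a positive weight that decays like |x|^(-d-\<alpha>), rescaled by R,
   shows that the diffusion changes the weighted mass at a rate O(R^(-\<alpha>)).  Letting R tend to
   infinity gives first that the solution stays in L1 and then that the reaction term alone
   decreases the mass.  At a maximum point of height b of a function of mass at most m the
   fractional Laplacian is at most -\<gamma> b^(1+\<alpha>/d) with \<gamma> depending on m, so comparison with an
   ordinary differential equation gives sup u(t) <= const * K(t)^(-d/\<alpha>) without any use of the
   heat kernel.  Hence the mass satisfies M' >= -const * h K^(-(d/\<alpha>)(\<beta>-1)) M, with an integrable
   coefficient. *)
theory Submission
  imports Defs
begin

section \<open>Lebesgue integrals of power kernels\<close>

text \<open>The solution is only known to be bounded and to satisfy the equation pointwise: neither
  integrability of \<open>u t\<close> for t > 0 nor a bound on its time derivative is given.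
  Differentiating a weighted mass under the integral therefore calls for a compactly supported test
  function. But the fractional Laplacian of such a function has a tail of order |x|^(-d-\<alpha>),
  which the function itself does not dominate, so the estimate would not close. Hence the family
  \<open>cutoff q \<epsilon> (x /R)\<close>: a weight with exactly the tail of the jump kernel,
  truncated at radius about R / sqrt \<epsilon>, whose second differences are bounded by the
  untruncated weight uniformly in \<epsilon>. For \<epsilon> -> 0 the weighted mass is bounded in
  terms of itself, with a coefficient small enough to be absorbed. The operator is used as an
  integral of symmetric second differences, which converges absolutely, so that Fubini applies. The
  final inequality for the mass is integrated in steps over which the integral of the coefficient
  grows by 1/2; each step costs at most a factor 2.\<close>

lemma nn_integral_lborel_translate:
  fixes f :: "'a::euclidean_space \<Rightarrow> ennreal"
  assumes [measurable]: "f \<in> borel_measurable borel"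
  shows "(\<integral>\<^sup>+x. f (a + x) \<partial>lborel) = (\<integral>\<^sup>+x. f x \<partial>lborel)"
proof -
  have "(\<integral>\<^sup>+x. f x \<partial>lborel) = (\<integral>\<^sup>+x. f x \<partial>distr lborel borel ((+) a))"
    by (simp add: lborel_distr_plus)
  also have "\<dots> = (\<integral>\<^sup>+x. f (a + x) \<partial>lborel)"
    by (subst nn_integral_distr) auto
  finally show ?thesis ..
qed

lemma nn_integral_lborel_scaleR:
  fixes f :: "'a::euclidean_space \<Rightarrow> ennreal"
  assumes [measurable]: "f \<in> borel_measurable borel" and c: "c \<noteq> 0"
  shows "(\<integral>\<^sup>+x. f x \<partial>lborel) = ennreal (\<bar>c\<bar> ^ DIM('a)) * (\<integral>\<^sup>+x. f (c *\<^sub>R x) \<partial>lborel)"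
proof -
  have "(\<integral>\<^sup>+x. f x \<partial>lborel) =
      (\<integral>\<^sup>+x. f x \<partial>density (distr lborel borel (\<lambda>x. 0 + c *\<^sub>R x)) (\<lambda>_. ennreal (\<bar>c\<bar> ^ DIM('a))))"
    using lborel_affine[of c "0::'a"] c by simp
  also have "\<dots> = ennreal (\<bar>c\<bar> ^ DIM('a)) * (\<integral>\<^sup>+x. f (c *\<^sub>R x) \<partial>lborel)"
    by (simp add: nn_integral_density nn_integral_distr nn_integral_cmult)
  finally show ?thesis .
qed

lemma nn_integral_lborel_uminus:
  fixes f :: "'a::euclidean_space \<Rightarrow> ennreal"
  assumes "f \<in> borel_measurable borel"
  shows "(\<integral>\<^sup>+x. f (- x) \<partial>lborel) = (\<integral>\<^sup>+x. f x \<partial>lborel)"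
  using nn_integral_lborel_scaleR[OF assms, of "-1"] by simp

lemma nn_integral_lborel_diff:
  fixes f :: "'a::euclidean_space \<Rightarrow> ennreal"
  assumes [measurable]: "f \<in> borel_measurable borel"
  shows "(\<integral>\<^sup>+x. f (a - x) \<partial>lborel) = (\<integral>\<^sup>+x. f x \<partial>lborel)"
  using nn_integral_lborel_uminus[of "\<lambda>x. f (a + x)"] nn_integral_lborel_translate[of f a] by simp

text \<open>Translation invariance determines Lebesgue measure up to a factor: integrating
  \<open>f (T x) * g (y + T x)\<close> in both orders compares the integrals of \<open>f\<close> and \<open>g\<close> under the
  two measures, and the unit ball fixes the factor.\<close>

lemma nn_integral_lborel_orthogonal:
  fixes f :: "'a::euclidean_space \<Rightarrow> ennreal" and T :: "'a \<Rightarrow> 'a"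
  assumes T: "orthogonal_transformation T" and [measurable]: "f \<in> borel_measurable borel"
  shows "(\<integral>\<^sup>+x. f (T x) \<partial>lborel) = (\<integral>\<^sup>+x. f x \<partial>lborel)"
proof -
  have lin: "linear T" using T by (simp add: orthogonal_transformation_def)
  have [measurable]: "T \<in> borel_measurable borel"
    using lin linear_continuous_on[of T UNIV] linear_conv_bounded_linear
    by (auto intro: borel_measurable_continuous_onI)
  have norm_T: "norm (T x) = norm x" for x
    using T by (simp add: orthogonal_transformation)
  obtain S where S: "\<And>y. T (S y) = y"
    using orthogonal_transformation_surj[OF T] by (metis surjD)
  have inv: "(\<integral>\<^sup>+x. q (T x) \<partial>lborel) = (\<integral>\<^sup>+x. q (T x + y) \<partial>lborel)"
    if [measurable]: "q \<in> borel_measurable borel" for q :: "'a \<Rightarrow> ennreal" and y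
  proof -
    have "(\<integral>\<^sup>+x. q (T x) \<partial>lborel) = (\<integral>\<^sup>+x. q (T (S y + x)) \<partial>lborel)"
      by (rule nn_integral_lborel_translate[symmetric]) measurable
    also have "\<dots> = (\<integral>\<^sup>+x. q (T x + y) \<partial>lborel)"
      using lin S by (simp add: linear_add add.commute)
    finally show ?thesis .
  qed
  define g :: "'a \<Rightarrow> ennreal" where "g x = indicator (ball 0 1) x" for x
  have [measurable]: "g \<in> borel_measurable borel" by (simp add: g_def[abs_def] borel_measurable_indicator)
  have gT: "g (T x) = g x" for x by (simp add: g_def norm_T indicator_def)
  have "(\<integral>\<^sup>+x. f (T x) \<partial>lborel) * (\<integral>\<^sup>+y. g y \<partial>lborel)
      = (\<integral>\<^sup>+x. f (T x) * (\<integral>\<^sup>+y. g (T x + y) \<partial>lborel) \<partial>lborel)"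
    by (simp add: nn_integral_lborel_translate nn_integral_multc)
  also have "\<dots> = (\<integral>\<^sup>+x. (\<integral>\<^sup>+y. f (T x) * g (T x + y) \<partial>lborel) \<partial>lborel)"
    by (simp add: nn_integral_cmult)
  also have "\<dots> = (\<integral>\<^sup>+y. (\<integral>\<^sup>+x. f (T x) * g (T x + y) \<partial>lborel) \<partial>lborel)"
    by (rule lborel_pair.Fubini'[symmetric]) measurable
  also have "\<dots> = (\<integral>\<^sup>+y. (\<integral>\<^sup>+x. f (T x - y) * g (T x) \<partial>lborel) \<partial>lborel)"
  proof (rule nn_integral_cong)
    fix y
    show "(\<integral>\<^sup>+x. f (T x) * g (T x + y) \<partial>lborel) = (\<integral>\<^sup>+x. f (T x - y) * g (T x) \<partial>lborel)"
      using inv[of "\<lambda>x. f (x - y) * g x" y] by simp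
  qed
  also have "\<dots> = (\<integral>\<^sup>+x. (\<integral>\<^sup>+y. f (T x - y) * g (T x) \<partial>lborel) \<partial>lborel)"
    by (rule lborel_pair.Fubini') measurable
  also have "\<dots> = (\<integral>\<^sup>+x. (\<integral>\<^sup>+y. f y \<partial>lborel) * g (T x) \<partial>lborel)"
    by (simp add: nn_integral_multc nn_integral_lborel_diff)
  also have "\<dots> = (\<integral>\<^sup>+x. f x \<partial>lborel) * (\<integral>\<^sup>+y. g y \<partial>lborel)"
    by (simp add: gT nn_integral_cmult)
  finally have eq: "(\<integral>\<^sup>+x. f (T x) \<partial>lborel) * (\<integral>\<^sup>+y. g y \<partial>lborel)
     = (\<integral>\<^sup>+x. f x \<partial>lborel) * (\<integral>\<^sup>+y. g y \<partial>lborel)" .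
  have "(\<integral>\<^sup>+y. g y \<partial>lborel) = ennreal (unit_ball_vol DIM('a))"
    unfolding g_def using emeasure_ball[of 1 "0::'a"] by simp
  then show ?thesis
    using eq unit_ball_vol_pos[of "real DIM('a)"] by (metis mult_right_ennreal_cancel not_le of_nat_0_le_iff)
qed

text \<open>Comparison with the sum of \<open>a n\<close> times the indicator of the ball of radius
  \<open>b n\<close>, whose integral is at most a geometric series. With dyadic radii this settles
  the integrability of powers of the norm without polar coordinates.\<close>

lemma nn_integral_dominated_by_geometric:
  fixes f :: "'a::euclidean_space \<Rightarrow> ennreal"
  assumes C: "C \<ge> 0" and q: "0 \<le> q" "q < 1" and b: "\<And>n. b n \<ge> 0"
    and le: "\<And>n. a n * b n ^ DIM('a) \<le> C * q ^ n" and a: "\<And>n. a n \<ge> 0"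
    and cover: "\<And>z. f z \<noteq> 0 \<Longrightarrow> \<exists>n. norm z < b n \<and> f z \<le> ennreal (a n)"
  shows "(\<integral>\<^sup>+z. f z \<partial>lborel) < \<infinity>"
proof -
  have term_le: "F n \<le> suminf F" for F :: "nat \<Rightarrow> ennreal" and n
    using sum_le_suminf[of F "{n}"] by simp
  have "f z \<le> (\<Sum>n. ennreal (a n) * indicator (ball 0 (b n)) z)" for z
  proof (cases "f z = 0")
    case False
    then obtain n where n: "norm z < b n" "f z \<le> ennreal (a n)" using cover by blast
    have "f z \<le> ennreal (a n) * indicator (ball 0 (b n)) z" using n by simp
    also have "\<dots> \<le> (\<Sum>n. ennreal (a n) * indicator (ball 0 (b n)) z)"
      by (rule term_le)
    finally show ?thesis .
  qed simp
  then have "(\<integral>\<^sup>+z. f z \<partial>lborel) \<le> (\<integral>\<^sup>+z. (\<Sum>n. ennreal (a n) * indicator (ball 0 (b n)) (z::'a)) \<partial>lborel)"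
    by (auto intro!: nn_integral_mono)
  also have "\<dots> = (\<Sum>n. (\<integral>\<^sup>+z. ennreal (a n) * indicator (ball 0 (b n)) (z::'a) \<partial>lborel))"
    by (rule nn_integral_suminf) (auto intro!: borel_measurable_times_ennreal borel_measurable_indicator)
  also have "\<dots> = (\<Sum>n. ennreal (a n * (unit_ball_vol DIM('a) * b n ^ DIM('a))))"
    using a b by (simp add: nn_integral_cmult_indicator emeasure_ball ennreal_mult)
  also have "\<dots> \<le> (\<Sum>n. ennreal (unit_ball_vol DIM('a) * C * q ^ n))"
  proof (intro suminf_le ennreal_leI)
    fix n
    have "a n * (unit_ball_vol DIM('a) * b n ^ DIM('a)) = unit_ball_vol DIM('a) * (a n * b n ^ DIM('a))"
      by simp
    also have "\<dots> \<le> unit_ball_vol DIM('a) * (C * q ^ n)"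
      by (intro mult_left_mono le) simp
    finally show "a n * (unit_ball_vol DIM('a) * b n ^ DIM('a)) \<le> unit_ball_vol DIM('a) * C * q ^ n"
      by simp
  qed auto
  also have "\<dots> = ennreal (\<Sum>n. unit_ball_vol DIM('a) * C * q ^ n)"
    using C q by (intro suminf_ennreal2) (auto intro!: summable_mult)
  finally show ?thesis by (simp add: top.not_eq_extremum order_le_less_trans)
qed

lemma nn_integral_norm_powr_outside:
  assumes s: "s < - real DIM('a)" and \<rho>: "\<rho> > 0"
  shows "(\<integral>\<^sup>+z. ennreal (norm (z::'a::euclidean_space) powr s) * indicator {z. \<rho> \<le> norm z} z \<partial>lborel) < \<infinity>"
proof (rule nn_integral_dominated_by_geometric[where a = "\<lambda>n. (2 ^ n * \<rho>) powr s"
      and b = "\<lambda>n. 2 ^ Suc n * \<rho>" and q = "2 powr (s + DIM('a))" and C = "(2::real) ^ DIM('a) * \<rho> powr (s + DIM('a))"])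
  show "2 powr (s + real DIM('a)) < 1" using s by (simp add: powr_less_one)
  fix n
  have "(2 ^ n * \<rho>) powr s * (2 ^ Suc n * \<rho>) ^ DIM('a) = 2 ^ DIM('a) * ((2 ^ n * \<rho>) powr s * (2 ^ n * \<rho>) powr real DIM('a))"
    using \<rho> by (simp add: powr_realpow power_mult_distrib)
  also have "\<dots> = 2 ^ DIM('a) * (2 ^ n * \<rho>) powr (s + DIM('a))"
    by (simp add: powr_add)
  also have "\<dots> = 2 ^ DIM('a) * \<rho> powr (s + DIM('a)) * (2 powr (s + DIM('a))) ^ n"
    using \<rho> by (simp add: powr_mult powr_realpow[symmetric] powr_powr mult.commute)
  finally show "(2 ^ n * \<rho>) powr s * (2 ^ Suc n * \<rho>) ^ DIM('a) \<le> 2 ^ DIM('a) * \<rho> powr (s + DIM('a)) * (2 powr (s + DIM('a))) ^ n"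
    by simp
next
  fix z :: 'a
  assume "ennreal (norm z powr s) * indicator {z. \<rho> \<le> norm z} z \<noteq> 0"
  then have z: "\<rho> \<le> norm z" by (auto simp: indicator_def split: if_splits)
  obtain n where n: "norm z / \<rho> < 2 ^ n" using real_arch_pow[of 2 "norm z / \<rho>"] by auto
  \<comment> \<open>Minimality puts z in a dyadic shell: with \<open>m = Suc j\<close>, the norm
    lies between \<open>2^j * \<rho>\<close> and twice that.\<close>
  define m where "m = (LEAST m. norm z / \<rho> < 2 ^ m)"
  have m: "norm z / \<rho> < 2 ^ m" unfolding m_def by (rule LeastI) (rule n)
  have "m \<noteq> 0" using m z \<rho> by (intro notI) (simp add: field_simps)
  then obtain j where j: "m = Suc j" by (cases m) auto
  have "\<not> norm z / \<rho> < 2 ^ j" using not_less_Least[of j "\<lambda>m. norm z / \<rho> < 2 ^ m"] j by (simp add: m_def)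
  then have "2 ^ j * \<rho> \<le> norm z" using \<rho> by (simp add: field_simps)
  then have "norm z powr s \<le> (2 ^ j * \<rho>) powr s" using \<rho> s by (intro powr_mono2') auto
  moreover have "norm z < 2 ^ Suc j * \<rho>" using m \<rho> unfolding j by (simp add: field_simps)
  ultimately show "\<exists>n. norm z < 2 ^ Suc n * \<rho> \<and>
      ennreal (norm z powr s) * indicator {z. \<rho> \<le> norm z} z \<le> ennreal ((2 ^ n * \<rho>) powr s)"
    using z by (intro exI[of _ j]) (auto intro!: ennreal_leI)
qed (use \<rho> in auto)

lemma nn_integral_norm_powr_inside:
  assumes s: "s > - real DIM('a)"
  shows "(\<integral>\<^sup>+z. ennreal (norm (z::'a::euclidean_space) powr s) * indicator {z. norm z < 1} z \<partial>lborel) < \<infinity>"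
proof -
  \<comment> \<open>A nonpositive power is largest at the inner radius of a shell, which gives one
    bound per shell. Lowering the exponent only increases powers of numbers below 1.\<close>
  define p where "p = min s 0"
  have p: "p \<le> 0" "p > - real DIM('a)" "p \<le> s" using s by (auto simp: p_def)
  show ?thesis
  proof (rule nn_integral_dominated_by_geometric[where a = "\<lambda>n. (1 / 2 ^ Suc n) powr p"
      and b = "\<lambda>n. 2 / 2 ^ n" and q = "(1/2) powr (p + DIM('a))" and C = "(1/2) powr p * 2 ^ DIM('a)"])
    show "(1/2) powr (p + real DIM('a)) < 1" using p powr01_less_one[of "1/2::real" "p + real DIM('a)"] by simp
    fix n
    have "(1 / 2 ^ Suc n) powr p * (2 / 2 ^ n) ^ DIM('a)
        = (1/2) powr p * 2 ^ DIM('a) * ((1 / 2 ^ n) powr p * (1 / 2 ^ n) powr real DIM('a))"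
      by (simp add: powr_realpow powr_mult[symmetric] power_divide)
    also have "\<dots> = (1/2) powr p * 2 ^ DIM('a) * (1 / 2 ^ n) powr (p + DIM('a))"
      by (simp add: powr_add)
    also have "\<dots> = (1/2) powr p * 2 ^ DIM('a) * ((1/2) powr (p + DIM('a))) ^ n"
    proof -
      have "1 / 2 ^ n = (1/2::real) powr real n" by (simp add: powr_realpow power_one_over)
      moreover have "((1/2::real) powr (p + DIM('a))) ^ n = ((1/2) powr (p + DIM('a))) powr real n"
        by (simp add: powr_realpow)
      ultimately show ?thesis by (simp only: powr_powr) (simp add: mult.commute)
    qed
    finally show "(1 / 2 ^ Suc n) powr p * (2 / 2 ^ n) ^ DIM('a) \<le> (1/2) powr p * 2 ^ DIM('a) * ((1/2) powr (p + DIM('a))) ^ n"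
      by simp
  next
    fix z :: 'a
    assume "ennreal (norm z powr s) * indicator {z. norm z < 1} z \<noteq> 0"
    then have z: "0 < norm z" "norm z < 1" by (auto simp: indicator_def split: if_splits)
    obtain n where n: "1 / norm z < 2 ^ n" using real_arch_pow[of 2 "1 / norm z"] by auto
    define m where "m = (LEAST m. 1 / norm z < 2 ^ m)"
    have m: "1 / norm z < 2 ^ m" unfolding m_def by (rule LeastI) (rule n)
    have "m \<noteq> 0" using m z by (intro notI) (simp add: field_simps)
    then obtain j where j: "m = Suc j" by (cases m) auto
    have "\<not> 1 / norm z < 2 ^ j" using not_less_Least[of j "\<lambda>m. 1 / norm z < 2 ^ m"] j by (simp add: m_def)
    then have le: "norm z \<le> 1 / 2 ^ j" using z by (simp add: field_simps)
    have le2: "norm z \<ge> 1 / 2 ^ Suc j" using m z unfolding j by (simp add: field_simps)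
    have "norm z powr s \<le> norm z powr p" using z p by (intro powr_mono') auto
    also have "\<dots> \<le> (1 / 2 ^ Suc j) powr p" using le2 p by (intro powr_mono2') auto
    finally have "norm z powr s \<le> (1 / 2 ^ Suc j) powr p" .
    \<comment> \<open>The shell gives a non-strict bound by \<open>1 / 2^j\<close>; doubling the
      radius of the ball makes it strict, as the covering demands.\<close>
    moreover have "norm z < 2 / 2 ^ j" using le by (rule order_le_less_trans) (simp add: divide_strict_right_mono)
    ultimately show "\<exists>n. norm z < 2 / 2 ^ n \<and>
      ennreal (norm z powr s) * indicator {z. norm z < 1} z \<le> ennreal ((1 / 2 ^ Suc n) powr p)"
      using z by (intro exI[of _ j]) (auto intro!: ennreal_leI)
  qed auto
qed

definition kernel_majorant :: "real \<Rightarrow> real \<Rightarrow> real \<Rightarrow> 'a::euclidean_space \<Rightarrow> real" where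
  "kernel_majorant \<alpha> \<rho> \<sigma> z =
     (if norm z < \<rho> then (norm z)\<^sup>2 else norm z powr \<sigma>) / norm z powr (real DIM('a) + \<alpha>)"

lemma kernel_majorant_nonneg: "kernel_majorant \<alpha> \<rho> \<sigma> z \<ge> 0"
  by (simp add: kernel_majorant_def)

lemma borel_measurable_kernel_majorant [measurable]: "kernel_majorant \<alpha> \<rho> \<sigma> \<in> borel_measurable borel"
  unfolding kernel_majorant_def by measurable

lemma integrable_kernel_majorant:
  assumes \<alpha>: "0 < \<alpha>" "\<alpha> < 2" and \<sigma>: "\<sigma> < \<alpha>" and \<rho>: "\<rho> > 0"
  shows "integrable lborel (kernel_majorant \<alpha> \<rho> \<sigma> :: 'a::euclidean_space \<Rightarrow> real)"
proof (rule integrableI_nonneg)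
  let ?d = "real DIM('a)"
  let ?A = "\<lambda>z::'a. ennreal (norm z powr (2 - ?d - \<alpha>)) * indicator {z. norm z < 1} z"
  let ?B = "\<lambda>z::'a. ennreal (norm z powr (- ?d - \<alpha>)) * indicator {z. 1 \<le> norm z} z"
  let ?C = "\<lambda>z::'a. ennreal (norm z powr (\<sigma> - ?d - \<alpha>)) * indicator {z. \<rho> \<le> norm z} z"
  have le: "ennreal (kernel_majorant \<alpha> \<rho> \<sigma> z) \<le> ?A z + ennreal (\<rho>\<^sup>2) * ?B z + ?C z" for z :: 'a
  proof (cases "z = 0")
    case False
    then have z: "norm z > 0" by simp
    \<comment> \<open>The middle case is nonempty only for \<rho> > 1; \<open>?B\<close> takes care
      of it.\<close>
    consider "norm z < \<rho>" "norm z < 1" | "norm z < \<rho>" "1 \<le> norm z" | "\<rho> \<le> norm z" by linarith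
    then show ?thesis
    proof cases
      case 1
      then have "kernel_majorant \<alpha> \<rho> \<sigma> z = norm z powr (2 - ?d - \<alpha>)"
        using z by (simp add: kernel_majorant_def powr_diff powr_add)
      then show ?thesis using 1 by simp
    next
      case 2
      then have "kernel_majorant \<alpha> \<rho> \<sigma> z = (norm z)\<^sup>2 * norm z powr (- ?d - \<alpha>)"
        using z by (simp add: kernel_majorant_def powr_diff powr_add powr_minus field_simps)
      also have "\<dots> \<le> \<rho>\<^sup>2 * norm z powr (- ?d - \<alpha>)"
        using 2 by (intro mult_right_mono power_mono) auto
      finally show ?thesis using 2 by (simp add: ennreal_mult[symmetric] ennreal_leI)
    next
      case 3
      then have "kernel_majorant \<alpha> \<rho> \<sigma> z = norm z powr (\<sigma> - ?d - \<alpha>)"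
        using z by (simp add: kernel_majorant_def powr_diff powr_add)
      then show ?thesis using 3 by simp
    qed
  qed (use \<rho> in \<open>simp add: kernel_majorant_def\<close>)
  have A: "(\<integral>\<^sup>+z. ?A z \<partial>lborel) < \<infinity>" using \<alpha> by (intro nn_integral_norm_powr_inside) auto
  have B: "(\<integral>\<^sup>+z. ?B z \<partial>lborel) < \<infinity>" using \<alpha> by (intro nn_integral_norm_powr_outside) auto
  have C: "(\<integral>\<^sup>+z. ?C z \<partial>lborel) < \<infinity>" using \<alpha> \<sigma> \<rho> by (intro nn_integral_norm_powr_outside) auto
  have "(\<integral>\<^sup>+z. ennreal (kernel_majorant \<alpha> \<rho> \<sigma> (z::'a)) \<partial>lborel) \<le> (\<integral>\<^sup>+z. ?A z + ennreal (\<rho>\<^sup>2) * ?B z + ?C z \<partial>lborel)"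
    by (intro nn_integral_mono le)
  also have "\<dots> = (\<integral>\<^sup>+z. ?A z \<partial>lborel) + ennreal (\<rho>\<^sup>2) * (\<integral>\<^sup>+z. ?B z \<partial>lborel) + (\<integral>\<^sup>+z. ?C z \<partial>lborel)"
    by (simp add: nn_integral_add nn_integral_cmult)
  also have "\<dots> < \<infinity>" using A B C by (simp add: ennreal_mult_less_top ennreal_add_eq_top less_top)
  finally show "(\<integral>\<^sup>+z. ennreal (kernel_majorant \<alpha> \<rho> \<sigma> (z::'a)) \<partial>lborel) < \<infinity>" .
qed (auto simp: kernel_majorant_nonneg)

lemma integrable_kernel_bound:
  fixes D :: "'a::euclidean_space \<Rightarrow> real"
  assumes \<alpha>: "0 < \<alpha>" "\<alpha> < 2" and [measurable]: "D \<in> borel_measurable borel"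
    and A: "\<And>z. norm z < 1 \<Longrightarrow> \<bar>D z\<bar> \<le> A * (norm z)\<^sup>2" and B: "\<And>z. \<bar>D z\<bar> \<le> B"
  shows "integrable lborel (\<lambda>z. D z / norm z powr (real DIM('a) + \<alpha>))"
    and "\<bar>D z / norm z powr (real DIM('a) + \<alpha>)\<bar> \<le> max A B * kernel_majorant \<alpha> 1 0 z"
proof -
  show le: "\<bar>D z / norm z powr (real DIM('a) + \<alpha>)\<bar> \<le> max A B * kernel_majorant \<alpha> 1 0 z" for z
  proof -
    have "\<bar>D z\<bar> \<le> max A B * (if norm z < 1 then (norm z)\<^sup>2 else norm z powr 0)"
      using A[of z] B[of z] by (auto intro: order.trans mult_right_mono)
    then show ?thesis by (auto simp: kernel_majorant_def abs_div_pos divide_right_mono intro!: divide_right_mono)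
  qed
  show "integrable lborel (\<lambda>z. D z / norm z powr (real DIM('a) + \<alpha>))"
    by (rule Bochner_Integration.integrable_bound[where f = "\<lambda>z. max A B * kernel_majorant \<alpha> 1 0 z"])
      (use \<alpha> le in \<open>auto intro!: integrable_mult_right integrable_kernel_majorant AE_I2 intro: order.trans[OF le abs_ge_self] simp del: abs_divide\<close>)
qed

section \<open>The symbol of the fractional Laplacian and second differences\<close>

lemma one_minus_cos_le: "1 - cos (x::real) \<le> x\<^sup>2 / 2"
proof -
  have "1 - cos x = 2 * (sin (x/2))\<^sup>2"
    using cos_double_sin[of "x/2"] by simp
  also have "\<dots> \<le> 2 * (x/2)\<^sup>2"
    using abs_sin_x_le_abs_x[of "x/2"] by (intro mult_left_mono) (simp_all add: power2_le_iff_abs_le abs_le_square_iff[symmetric])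
  finally show ?thesis by (simp add: power2_eq_square)
qed

text \<open>The constant is a definite description, so nothing is known about it before existence
  and uniqueness are shown. The symbol integral \<open>?J\<close> is rotation invariant, and the
  substitution z / s makes it homogeneous of degree \<alpha>; hence \<open>?J \<xi>\<close> is
  |\<xi>|^\<alpha> times \<open>?J a\<close> for a unit vector a, and the constant is
  \<open>1 / ?J a\<close>. The changes of variables are done for \<open>?N\<close>, where
  integrability plays no part.\<close>

lemma frac_const_pos:
  assumes \<alpha>: "0 < \<alpha>" "\<alpha> < 2"
  shows "frac_const TYPE('n::finite) \<alpha> > 0"
proof -
  let ?q = "real CARD('n) + \<alpha>"
  let ?f = "\<lambda>\<xi> z :: real^'n. (1 - cos (\<xi> \<bullet> z)) / norm z powr ?q"
  let ?J = "\<lambda>\<xi> :: real^'n. LINT z|lborel. ?f \<xi> z"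
  let ?N = "\<lambda>\<xi> :: real^'n. \<integral>\<^sup>+z. ennreal (?f \<xi> z) \<partial>lborel"
  have nonneg: "?f \<xi> z \<ge> 0" for \<xi> z by simp
  have int: "integrable lborel (?f \<xi>)" for \<xi>
  proof -
    have "integrable lborel (\<lambda>z. (1 - cos (\<xi> \<bullet> z)) / norm z powr (real DIM(real^'n) + \<alpha>))"
    proof (rule integrable_kernel_bound(1)[OF \<alpha>, where A = "(norm \<xi>)\<^sup>2" and B = 2])
      fix z :: "real^'n"
      have "1 - cos (\<xi> \<bullet> z) \<le> (\<xi> \<bullet> z)\<^sup>2 / 2" by (rule one_minus_cos_le)
      also have "\<dots> \<le> (\<bar>\<xi> \<bullet> z\<bar>)\<^sup>2" by simp
      also have "\<dots> \<le> (norm \<xi> * norm z)\<^sup>2" by (intro power_mono Cauchy_Schwarz_ineq2) auto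
      finally show "\<bar>1 - cos (\<xi> \<bullet> z)\<bar> \<le> (norm \<xi>)\<^sup>2 * (norm z)\<^sup>2"
        by (simp add: power_mult_distrib)
      show "\<bar>1 - cos (\<xi> \<bullet> z)\<bar> \<le> 2"
        using cos_ge_minus_one[of "\<xi> \<bullet> z"] cos_le_one[of "\<xi> \<bullet> z"] by linarith
    qed measurable
    then show ?thesis by simp
  qed
  have N: "?N \<xi> = ennreal (?J \<xi>)" for \<xi>
    by (rule nn_integral_eq_integral) (auto simp: int)
  obtain a :: "real^'n" where a: "norm a = 1"
    using vector_choose_size[of 1] by auto
  have rot: "?N \<xi> = ?N (norm \<xi> *\<^sub>R a)" for \<xi>
  proof -
    obtain T where T: "orthogonal_transformation T" "T (norm \<xi> *\<^sub>R a) = \<xi>"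
      using orthogonal_transformation_exists[of "norm \<xi> *\<^sub>R a" \<xi>] a by auto
    have eq: "?f \<xi> (T z) = ?f (norm \<xi> *\<^sub>R a) z" for z
    proof -
      have "\<xi> \<bullet> T z = T (norm \<xi> *\<^sub>R a) \<bullet> T z" by (simp only: T)
      also have "\<dots> = (norm \<xi> *\<^sub>R a) \<bullet> z" using T(1) by (simp only: orthogonal_transformation_def)
      finally show ?thesis using T(1) by (simp add: orthogonal_transformation)
    qed
    have "?N \<xi> = (\<integral>\<^sup>+z. ennreal (?f \<xi> (T z)) \<partial>lborel)"
      by (rule nn_integral_lborel_orthogonal[OF T(1), symmetric]) measurable
    then show ?thesis by (simp only: eq)
  qed
  have scale: "?N (s *\<^sub>R a) = ennreal (s powr \<alpha>) * ?N a" if s: "s > 0" for s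
  proof -
    have eq: "?f (s *\<^sub>R a) ((1/s) *\<^sub>R z) = s powr ?q * ?f a z" for z
      using s by (simp add: powr_divide)
    have "?N (s *\<^sub>R a) = ennreal (\<bar>1/s\<bar> ^ DIM(real^'n)) * (\<integral>\<^sup>+z. ennreal (?f (s *\<^sub>R a) ((1/s) *\<^sub>R z)) \<partial>lborel)"
      using s by (intro nn_integral_lborel_scaleR) auto
    also have "(\<integral>\<^sup>+z. ennreal (?f (s *\<^sub>R a) ((1/s) *\<^sub>R z)) \<partial>lborel) = (\<integral>\<^sup>+z. ennreal (s powr ?q * ?f a z) \<partial>lborel)"
      by (simp only: eq)
    also have "(\<integral>\<^sup>+z. ennreal (s powr ?q * ?f a z) \<partial>lborel) = ennreal (s powr ?q) * ?N a"
      by (simp add: ennreal_mult nn_integral_cmult del: times_divide_eq_right)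
    also have "ennreal (\<bar>1/s\<bar> ^ DIM(real^'n)) * (ennreal (s powr ?q) * ?N a)
        = ennreal ((1/s) ^ CARD('n) * s powr ?q) * ?N a"
      using s by (simp add: ennreal_mult mult.assoc)
    also have "(1/s) ^ CARD('n) * s powr ?q = s powr \<alpha>"
      using s by (simp add: powr_add powr_realpow power_divide)
    finally show ?thesis .
  qed
  have Jnn: "?J \<xi> \<ge> 0" for \<xi> by (intro integral_nonneg_AE AE_I2 nonneg)
  have Ja: "?J a > 0"
  proof (rule ccontr)
    assume "\<not> ?J a > 0"
    then have "?N a = 0" using N[of a] by (simp add: ennreal_eq_0_iff)
    then have "AE z in lborel. ennreal (?f a z) = 0"
      by (subst (asm) nn_integral_0_iff_AE) auto
    \<comment> \<open>On this ball a \<bullet> z lies strictly between 0 and 2 < pi, so the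
      integrand is positive there; a vanishing integral would make the ball a null set.\<close>
    then have "AE z in lborel. z \<notin> ball a 1"
    proof eventually_elim
      case (elim z)
      show ?case
      proof
        assume z: "z \<in> ball a 1"
        then have z0: "z \<noteq> 0" using a by auto
        then have "cos (a \<bullet> z) = 1" using elim cos_le_one[of "a \<bullet> z"] by (simp add: ennreal_eq_0_iff divide_le_0_iff)
        moreover have "a \<bullet> z > 0"
        proof -
          have "a \<bullet> z = a \<bullet> a - a \<bullet> (a - z)" by (simp add: inner_diff_right)
          moreover have "a \<bullet> (a - z) \<le> norm a * norm (a - z)" by (rule norm_cauchy_schwarz)
          moreover have "norm (a - z) < 1" using z by (simp add: dist_norm)
          ultimately show ?thesis using a by (simp add: dot_square_norm)
        qed
        moreover have "a \<bullet> z < 2"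
        proof -
          have "a \<bullet> z \<le> norm a * norm z" by (rule norm_cauchy_schwarz)
          moreover have "norm z \<le> norm a + norm (a - z)" using norm_triangle_sub[of z a] by (simp add: norm_minus_commute)
          moreover have "norm (a - z) < 1" using z by (simp add: dist_norm)
          ultimately show ?thesis using a by simp
        qed
        ultimately show False
          using cos_monotone_0_pi[of 0 "a \<bullet> z"] pi_gt3 by simp
      qed
    qed
    then have "emeasure lborel (ball a 1) = 0"
      by (subst (asm) AE_iff_measurable[where N = "ball a 1"]) auto
    moreover have "emeasure lborel (ball a 1) = ennreal (unit_ball_vol (real CARD('n)))"
      using emeasure_ball[of 1 a] by simp
    moreover have "ennreal (unit_ball_vol (real CARD('n))) > 0"
      unfolding ennreal_less_zero_iff by simp
    ultimately show False by (metis less_irrefl)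
  qed
  have J: "?J \<xi> = norm \<xi> powr \<alpha> * ?J a" for \<xi>
  proof (cases "\<xi> = 0")
    case False
    have "ennreal (?J \<xi>) = ?N (norm \<xi> *\<^sub>R a)" by (simp only: rot[of \<xi>] N[symmetric])
    also have "\<dots> = ennreal (norm \<xi> powr \<alpha>) * ennreal (?J a)"
      unfolding N[of a, symmetric] using False by (intro scale) simp
    also have "\<dots> = ennreal (norm \<xi> powr \<alpha> * ?J a)"
      by (intro ennreal_mult[symmetric] Jnn) simp
    finally have "enn2real (ennreal (?J \<xi>)) = enn2real (ennreal (norm \<xi> powr \<alpha> * ?J a))" by (rule arg_cong)
    moreover have "norm \<xi> powr \<alpha> * ?J a \<ge> 0" by (intro mult_nonneg_nonneg Jnn) simp
    ultimately show ?thesis by (simp only: enn2real_ennreal Jnn)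
  qed simp
  let ?P = "\<lambda>c. c > 0 \<and> (\<forall>\<xi>. c * ?J \<xi> = norm \<xi> powr \<alpha>)"
  have Ja0: "?J a \<noteq> 0" using Ja by (rule less_imp_neq[symmetric])
  have ex: "?P (1 / ?J a)"
  proof (intro conjI allI)
    show "0 < 1 / ?J a" using Ja by (rule divide_pos_pos[OF zero_less_one])
    show "1 / ?J a * ?J \<xi> = norm \<xi> powr \<alpha>" for \<xi>
    proof -
      have "1 / j * (p * j) = p" if "j \<noteq> 0" for j p :: real using that by simp
      from this[OF Ja0] show ?thesis by (subst J[of \<xi>])
    qed
  qed
  have uniq: "c = 1 / ?J a" if "?P c" for c
  proof -
    have "c * ?J a = norm a powr \<alpha>" using that by blast
    moreover have "c = 1 / j" if "c * j = 1" "j \<noteq> 0" for j :: real using that by (simp add: field_simps)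
    ultimately show ?thesis using Ja0 a by simp
  qed
  have "(THE c. ?P c) = 1 / ?J a" by (rule the_equality[of ?P, OF ex uniq])
  then show ?thesis unfolding frac_const_def using ex by (simp only:)
qed

text \<open>Averaging over z and -z cancels the gradient term, so the operator can be written
  without derivative and without cut-off radius.\<close>

definition second_diff :: "('a::real_vector \<Rightarrow> real) \<Rightarrow> 'a \<Rightarrow> 'a \<Rightarrow> real" where
  "second_diff f x z = f (x + z) + f (x - z) - 2 * f x"

text \<open>The mean value inequality is applied twice: to \<open>f'\<close>, whose Lipschitz
  constant is sup |\<open>f''\<close>|, and to f minus its linearization at x, whose derivative on
  the ball of radius |z| is then at most C |z|.\<close>

lemma Cb2_Taylor:
  fixes f :: "real^'n \<Rightarrow> real"
  assumes "f \<in> Cb2"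
  obtains C where "C \<ge> 0"
    and "\<And>x z. \<bar>f (x + z) - f x - frechet_derivative f (at x) z\<bar> \<le> C * (norm z)\<^sup>2"
    and "\<And>x. linear (frechet_derivative f (at x))"
proof -
  from assms obtain f' :: "real^'n \<Rightarrow> (real^'n) \<Rightarrow>\<^sub>L real"
    and f'' :: "real^'n \<Rightarrow> (real^'n) \<Rightarrow>\<^sub>L (real^'n) \<Rightarrow>\<^sub>L real"
    where f': "\<And>x. (f has_derivative blinfun_apply (f' x)) (at x)"
      and f'': "\<And>x. (f' has_derivative blinfun_apply (f'' x)) (at x)"
      and b: "bounded (range f'')"
    unfolding Cb2_def by auto
  obtain C where C: "\<And>x. norm (f'' x) \<le> C" using b unfolding bounded_iff by auto
  have C0: "C \<ge> 0" using C[of 0] norm_ge_zero order.trans by blast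
  have lip: "norm (f' y - f' x) \<le> C * norm (y - x)" for x y
  proof (rule differentiable_bound[of UNIV f' "\<lambda>x. blinfun_apply (f'' x)"])
    show "onorm (blinfun_apply (f'' x)) \<le> C" for x using C[of x] by (simp add: norm_blinfun.rep_eq)
  qed (auto simp: f'')
  have fd: "frechet_derivative f (at x) = blinfun_apply (f' x)" for x
    using f'[of x] frechet_derivative_at by metis
  have "\<bar>f (x + z) - f x - blinfun_apply (f' x) z\<bar> \<le> C * (norm z)\<^sup>2" for x z
  proof -
    let ?g = "\<lambda>y. f y - blinfun_apply (f' x) y"
    have "norm (?g (x + z) - ?g x) \<le> C * norm z * norm (x + z - x)"
    proof (rule differentiable_bound[of "cball x (norm z)" ?g "\<lambda>y. blinfun_apply (f' y - f' x)"])
      show "(?g has_derivative blinfun_apply (f' y - f' x)) (at y within cball x (norm z))" for y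
        by (auto intro!: derivative_eq_intros f'[THEN has_derivative_at_withinI] simp: blinfun.diff_left)
      show "onorm (blinfun_apply (f' y - f' x)) \<le> C * norm z" if "y \<in> cball x (norm z)" for y
      proof -
        have "norm (f' y - f' x) \<le> C * norm (y - x)" by (rule lip)
        also have "\<dots> \<le> C * norm z"
          using that C0 by (intro mult_left_mono) (auto simp: dist_norm norm_minus_commute)
        finally show ?thesis by (simp add: norm_blinfun.rep_eq)
      qed
    qed (auto simp: dist_norm)
    then show ?thesis by (simp add: blinfun.add_right power2_eq_square algebra_simps)
  qed
  then show ?thesis
    using C0 by (intro that[of C]) (auto simp: fd blinfun.bounded_linear_right bounded_linear.linear)
qed

lemma Cb2_continuous: "f \<in> Cb2 \<Longrightarrow> continuous_on UNIV f"
  unfolding Cb2_def using has_derivative_continuous by (blast intro: continuous_at_imp_continuous_on)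

lemma Cb2_second_diff_bound:
  fixes f :: "real^'n \<Rightarrow> real"
  assumes "f \<in> Cb2"
  obtains C where "C \<ge> 0" "\<And>x z. \<bar>second_diff f x z\<bar> \<le> C * (norm z)\<^sup>2" "\<And>x z. \<bar>second_diff f x z\<bar> \<le> C"
proof -
  obtain C where C: "C \<ge> 0"
    "\<And>x z. \<bar>f (x + z) - f x - frechet_derivative f (at x) z\<bar> \<le> C * (norm z)\<^sup>2"
    "\<And>x. linear (frechet_derivative f (at x))"
    using Cb2_Taylor[OF assms] by blast
  obtain U where U: "\<And>x. \<bar>f x\<bar> \<le> U" using assms unfolding Cb2_def bounded_iff by auto
  have "\<bar>second_diff f x z\<bar> \<le> 2 * C * (norm z)\<^sup>2" for x z
    using C(2)[of x z] C(2)[of x "-z"]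
    by (simp add: second_diff_def linear_neg[OF C(3)])
  moreover have "\<bar>second_diff f x z\<bar> \<le> 4 * U" for x z
    using U[of "x + z"] U[of "x - z"] U[of x] by (simp add: second_diff_def)
  ultimately have bounds: "\<bar>second_diff f x z\<bar> \<le> 2 * C * (norm z)\<^sup>2" "\<bar>second_diff f x z\<bar> \<le> 4 * U" for x z
    by blast+
  show ?thesis
  proof (intro that[of "max (2 * C) (4 * U)"])
    show "max (2 * C) (4 * U) \<ge> 0" using C(1) by simp
    show "\<bar>second_diff f x z\<bar> \<le> max (2 * C) (4 * U) * (norm z)\<^sup>2" for x z
      by (rule order.trans[OF bounds(1) mult_right_mono]) auto
    show "\<bar>second_diff f x z\<bar> \<le> max (2 * C) (4 * U)" for x z
      using bounds(2)[of x z] by linarith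
  qed
qed

lemma lborel_distr_uminus_euclidean: "distr lborel borel uminus = (lborel :: 'a::euclidean_space measure)"
  using lborel_affine[of "-1" "0::'a"] by (simp add: density_1)

lemma integral_lborel_uminus:
  fixes f :: "'a::euclidean_space \<Rightarrow> real"
  assumes [measurable]: "f \<in> borel_measurable borel"
  shows "(LINT x|lborel. f (- x)) = (LINT x|lborel. f x)"
    and "integrable lborel (\<lambda>x. f (- x)) \<longleftrightarrow> integrable lborel f"
proof -
  show "(LINT x|lborel. f (- x)) = (LINT x|lborel. f x)"
    using integral_distr[of uminus lborel borel f] by (simp add: lborel_distr_uminus_euclidean)
  show "integrable lborel (\<lambda>x. f (- x)) \<longleftrightarrow> integrable lborel f"
    using integrable_distr_eq[of uminus lborel borel f] by (simp add: lborel_distr_uminus_euclidean)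
qed

lemma integral_lborel_translate:
  fixes f :: "'a::euclidean_space \<Rightarrow> real"
  assumes [measurable]: "f \<in> borel_measurable borel"
  shows "(LINT x|lborel. f (a + x)) = (LINT x|lborel. f x)"
    and "integrable lborel (\<lambda>x. f (a + x)) \<longleftrightarrow> integrable lborel f"
proof -
  show "(LINT x|lborel. f (a + x)) = (LINT x|lborel. f x)"
    using integral_distr[of "(+) a" lborel borel f] by (simp add: lborel_distr_plus)
  show "integrable lborel (\<lambda>x. f (a + x)) \<longleftrightarrow> integrable lborel f"
    using integrable_distr_eq[of "(+) a" lborel borel f] by (simp add: lborel_distr_plus)
qed

lemma Cb2_integrable_second_diff:
  fixes f :: "real^'n \<Rightarrow> real"
  assumes \<alpha>: "0 < \<alpha>" "\<alpha> < 2" and f: "f \<in> Cb2"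
  shows "integrable lborel (\<lambda>z. second_diff f x z / norm z powr (real CARD('n) + \<alpha>))"
proof -
  obtain C where C: "C \<ge> 0" "\<And>x z. \<bar>second_diff f x z\<bar> \<le> C * (norm z)\<^sup>2" "\<And>x z. \<bar>second_diff f x z\<bar> \<le> C"
    using Cb2_second_diff_bound[OF f] by blast
  have [measurable]: "f \<in> borel_measurable borel"
    using Cb2_continuous[OF f] by (rule borel_measurable_continuous_onI)
  have "integrable lborel (\<lambda>z. second_diff f x z / norm z powr (real DIM(real^'n) + \<alpha>))"
    by (rule integrable_kernel_bound(1)[OF \<alpha>, where A = C and B = C]) (use C in \<open>auto simp: second_diff_def[abs_def]\<close>)
  then show ?thesis by simp
qed

text \<open>\<open>?P z + ?P (- z)\<close> is the second difference over the kernel, because the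
  linear term is odd and both regions are symmetric. Reflection invariance of Lebesgue measure makes
  the two integrals equal, which is the origin of the factor 1/2.\<close>

lemma frac_laplacian_eq_second_diff:
  fixes f :: "real^'n \<Rightarrow> real"
  assumes \<alpha>: "0 < \<alpha>" "\<alpha> < 2" and r: "r > 0" and f: "f \<in> Cb2"
  shows "frac_laplacian r \<alpha> f x = frac_const TYPE('n) \<alpha> / 2 *
     (LINT z|lborel. second_diff f x z / norm z powr (real CARD('n) + \<alpha>))"
proof -
  let ?q = "real CARD('n) + \<alpha>"
  let ?D = "frechet_derivative f (at x)"
  let ?E = "\<lambda>z. if norm z < r then f (x + z) - f x - ?D z else f (x + z) - f x"
  let ?P = "\<lambda>z. ?E z / norm z powr ?q"
  obtain C where C: "C \<ge> 0"
    "\<And>x z. \<bar>f (x + z) - f x - frechet_derivative f (at x) z\<bar> \<le> C * (norm z)\<^sup>2"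
    "\<And>x. linear (frechet_derivative f (at x))"
    using Cb2_Taylor[OF f] by blast
  have lin: "linear ?D" by (rule C)
  obtain U where U: "\<And>x. \<bar>f x\<bar> \<le> U" using f unfolding Cb2_def bounded_iff by auto
  have U0: "U \<ge> 0" using U[of 0] by linarith
  have [measurable]: "f \<in> borel_measurable borel"
    using Cb2_continuous[OF f] by (rule borel_measurable_continuous_onI)
  have [measurable]: "?D \<in> borel_measurable borel"
    using lin linear_continuous_on[of ?D UNIV] linear_conv_bounded_linear
    by (auto intro: borel_measurable_continuous_onI)
  have int: "integrable lborel ?P"
  proof -
    \<comment> \<open>The integrability criterion splits at radius 1, \<open>?E\<close> at radius r.
      The two constants make the quadratic and the uniform bound valid for every z: beyond r,
      \<open>2 * U\<close> is at most \<open>2 * U / r\<^sup>2\<close> times |z|^2, and within r the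
      quadratic bound is at most \<open>C * r\<^sup>2\<close>.\<close>
    have "integrable lborel (\<lambda>z. ?E z / norm z powr (real DIM(real^'n) + \<alpha>))"
    proof (rule integrable_kernel_bound(1)[OF \<alpha>, where A = "max C (2 * U / r\<^sup>2)" and B = "max (C * r\<^sup>2) (2 * U)"])
      fix z :: "real^'n"
      have far: "\<bar>f (x + z) - f x\<bar> \<le> 2 * U" using U[of "x + z"] U[of x] by linarith
      show "\<bar>?E z\<bar> \<le> max C (2 * U / r\<^sup>2) * (norm z)\<^sup>2"
      proof (cases "norm z < r")
        case True
        have "\<bar>?E z\<bar> \<le> C * (norm z)\<^sup>2" using True C(2)[of x z] by simp
        also have "\<dots> \<le> max C (2 * U / r\<^sup>2) * (norm z)\<^sup>2" by (intro mult_right_mono) auto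
        finally show ?thesis .
      next
        case False
        have "\<bar>?E z\<bar> \<le> 2 * U / r\<^sup>2 * r\<^sup>2" using False far r by simp
        also have "\<dots> \<le> 2 * U / r\<^sup>2 * (norm z)\<^sup>2" using False r U0 by (intro mult_left_mono power_mono) auto
        also have "\<dots> \<le> max C (2 * U / r\<^sup>2) * (norm z)\<^sup>2" by (intro mult_right_mono) auto
        finally show ?thesis .
      qed
      show "\<bar>?E z\<bar> \<le> max (C * r\<^sup>2) (2 * U)"
      proof (cases "norm z < r")
        case True
        have "\<bar>?E z\<bar> \<le> C * (norm z)\<^sup>2" using True C(2)[of x z] by simp
        also have "\<dots> \<le> C * r\<^sup>2" using True C(1) by (intro mult_left_mono power_mono) auto
        finally show ?thesis by simp
      qed (use far in auto)
    qed measurable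
    then show ?thesis by simp
  qed
  have 1: "(LINT z:{z. norm z < r}|lborel. (f (x + z) - f x - ?D z) / norm z powr ?q)
      = (LINT z|lborel. indicator {z. norm z < r} z *\<^sub>R ?P z)"
    unfolding set_lebesgue_integral_def by (intro Bochner_Integration.integral_cong) (auto simp: indicator_def)
  have 2: "(LINT z:{z. norm z \<ge> r}|lborel. (f (x + z) - f x) / norm z powr ?q)
      = (LINT z|lborel. indicator {z. norm z \<ge> r} z *\<^sub>R ?P z)"
    unfolding set_lebesgue_integral_def by (intro Bochner_Integration.integral_cong) (auto simp: indicator_def)
  have "(LINT z|lborel. indicator {z. norm z < r} z *\<^sub>R ?P z) + (LINT z|lborel. indicator {z. norm z \<ge> r} z *\<^sub>R ?P z)
      = (LINT z|lborel. indicator {z. norm z < r} z *\<^sub>R ?P z + indicator {z. norm z \<ge> r} z *\<^sub>R ?P z)"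
    by (rule Bochner_Integration.integral_add[symmetric]; rule integrable_mult_indicator[OF _ int]) measurable
  also have "\<dots> = (LINT z|lborel. ?P z)"
    by (intro Bochner_Integration.integral_cong) (auto simp: indicator_def)
  finally have 3: "frac_laplacian r \<alpha> f x = frac_const TYPE('n) \<alpha> * (LINT z|lborel. ?P z)"
    unfolding frac_laplacian_def 1 2 by simp
  have P_meas: "?P \<in> borel_measurable borel" by measurable
  have int': "integrable lborel (\<lambda>z. ?P (- z))"
    using int by (simp only: integral_lborel_uminus(2)[OF P_meas])
  have "(LINT z|lborel. second_diff f x z / norm z powr ?q) = (LINT z|lborel. ?P z + ?P (- z))"
    by (intro Bochner_Integration.integral_cong)
      (auto simp: second_diff_def linear_neg[OF lin] add_divide_distrib[symmetric])
  also have "\<dots> = (LINT z|lborel. ?P z) + (LINT z|lborel. ?P (- z))"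
    using int int' by (rule Bochner_Integration.integral_add)
  also have "\<dots> = 2 * (LINT z|lborel. ?P z)"
    by (simp only: integral_lborel_uminus(1)[OF P_meas] mult_2)
  finally show ?thesis using 3 by simp
qed

section \<open>Estimates at penalized maxima\<close>

text \<open>Subtracting a small multiple of this function forces a bounded function to attain its maximum.
  Its increments are subpolynomial in the increment of the argument, uniformly in the base
  point, so that it changes the fractional Laplacian by a bounded amount only.\<close>

definition barrier :: "'a::real_normed_vector \<Rightarrow> real" where
  "barrier x = ln (1 + (norm x)\<^sup>2)"

lemma continuous_on_barrier [continuous_intros]:
  assumes "continuous_on S f"
  shows "continuous_on S (\<lambda>x. barrier (f x))"
proof -
  have "1 + (norm (f x))\<^sup>2 \<noteq> 0" for x by (smt (verit) zero_le_power2)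
  then show ?thesis unfolding barrier_def using assms by (intro continuous_intros) auto
qed

lemma barrier_nonneg: "barrier x \<ge> 0"
  by (simp add: barrier_def)

lemma norm_add_sq_le: "(norm (x + y))\<^sup>2 \<le> 2 * (norm x)\<^sup>2 + 2 * (norm y)\<^sup>2"
proof -
  have "(norm (x + y))\<^sup>2 \<le> (norm x + norm y)\<^sup>2"
    by (intro power_mono norm_triangle_ineq) auto
  also have "\<dots> \<le> 2 * (norm x)\<^sup>2 + 2 * (norm y)\<^sup>2"
    using zero_le_power2[of "norm x - norm y"] by (simp add: power2_eq_square algebra_simps)
  finally show ?thesis .
qed

text \<open>1 + |x+z|^2 is at most 2 (1 + |z|^2)(1 + |x|^2). Taking logarithms, the dependence on x
  disappears and the growth in z is slower than any power.\<close>

lemma barrier_diff_le: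
  fixes x z :: "'a::real_normed_vector"
  shows "barrier (x + z) - barrier x \<le> ln (2 * (1 + (norm z)\<^sup>2))"
proof -
  have pos: "1 + (norm y)\<^sup>2 > 0" "2 * (1 + (norm y)\<^sup>2) > 0" for y :: 'a by (smt (verit) zero_le_power2)+
  have "(norm (x + z))\<^sup>2 \<le> 2 * (norm x)\<^sup>2 + 2 * (norm z)\<^sup>2" by (rule norm_add_sq_le)
  moreover have "(2 * (1 + (norm z)\<^sup>2)) * (1 + (norm x)\<^sup>2)
      = 2 + 2 * (norm x)\<^sup>2 + 2 * (norm z)\<^sup>2 + 2 * ((norm x)\<^sup>2 * (norm z)\<^sup>2)"
    by (simp add: algebra_simps)
  moreover have "(norm x)\<^sup>2 * (norm z)\<^sup>2 \<ge> 0" by simp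
  ultimately have "1 + (norm (x + z))\<^sup>2 \<le> (2 * (1 + (norm z)\<^sup>2)) * (1 + (norm x)\<^sup>2)"
    by linarith
  then have "barrier (x + z) \<le> ln ((2 * (1 + (norm z)\<^sup>2)) * (1 + (norm x)\<^sup>2))"
    unfolding barrier_def using pos by (subst ln_le_cancel_iff) (auto intro: mult_pos_pos)
  also have "\<dots> = ln (2 * (1 + (norm z)\<^sup>2)) + barrier x"
    unfolding barrier_def by (rule ln_mult_pos[OF pos(2) pos(1)])
  finally show ?thesis by simp
qed

text \<open>The logarithm lies below its tangent at 1 + |x|^2, and by the parallelogram identity the
  second difference of |x|^2 is 2 |z|^2. An upper bound is what a maximum principle asks
  for.\<close>

lemma second_diff_barrier_le:
  fixes x z :: "'a::real_inner"
  shows "second_diff barrier x z \<le> 2 * (norm z)\<^sup>2"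
proof -
  have pos: "1 + (norm y)\<^sup>2 > 0" for y :: 'a by (smt (verit) zero_le_power2)
  have *: "barrier y - barrier x \<le> ((norm y)\<^sup>2 - (norm x)\<^sup>2) / (1 + (norm x)\<^sup>2)" for y :: 'a
    using ln_diff_le[OF pos[of y] pos[of x]] by (simp add: barrier_def)
  have "second_diff barrier x z \<le> ((norm (x + z))\<^sup>2 + (norm (x - z))\<^sup>2 - 2 * (norm x)\<^sup>2) / (1 + (norm x)\<^sup>2)"
    using *[of "x + z"] *[of "x - z"] by (simp add: second_diff_def add_divide_distrib diff_divide_distrib)
  also have "\<dots> = 2 * (norm z)\<^sup>2 / (1 + (norm x)\<^sup>2)"
    by (simp add: power2_norm_eq_inner inner_diff inner_add inner_commute)
  also have "\<dots> \<le> 2 * (norm z)\<^sup>2 / 1"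
    using pos[of x] by (intro divide_left_mono) auto
  finally show ?thesis by simp
qed

text \<open>This is ln y <= y^a / a with a = \<alpha>/4; the square in the argument doubles the
  exponent to \<alpha>/2, which is below \<alpha> and hence integrable against the kernel at
  infinity.\<close>

lemma ln_le_powr_outside:
  fixes \<alpha> \<rho> :: real
  assumes \<alpha>: "\<alpha> > 0" and \<rho>: "\<rho> > 0"
  obtains B where "B \<ge> 0" "\<And>s. s \<ge> \<rho> \<Longrightarrow> ln (2 * (1 + s\<^sup>2)) \<le> B * s powr (\<alpha>/2)"
proof -
  define c where "c = 2 * (1 + 1 / \<rho>\<^sup>2)"
  have "c > 0" unfolding c_def using \<rho> by (simp add: add_pos_pos)
  have "ln (2 * (1 + s\<^sup>2)) \<le> (c powr (\<alpha>/4) / (\<alpha>/4)) * s powr (\<alpha>/2)" if s: "s \<ge> \<rho>" for s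
  proof -
    have s0: "s > 0" using s \<rho> by simp
    have "\<rho>\<^sup>2 \<le> s\<^sup>2" using s \<rho> by (intro power_mono) auto
    then have le: "2 * (1 + s\<^sup>2) \<le> c * s\<^sup>2" unfolding c_def using \<rho> by (simp add: field_simps)
    have "ln (2 * (1 + s\<^sup>2)) \<le> (2 * (1 + s\<^sup>2)) powr (\<alpha>/4) / (\<alpha>/4)"
      using \<alpha> by (intro ln_powr_bound) (auto simp: add_increasing2)
    also have "\<dots> \<le> (c * s\<^sup>2) powr (\<alpha>/4) / (\<alpha>/4)"
      using le \<alpha> by (intro divide_right_mono powr_mono2) auto
    also have "(c * s\<^sup>2) powr (\<alpha>/4) = c powr (\<alpha>/4) * (s powr 2) powr (\<alpha>/4)"
      using s0 \<open>c > 0\<close> by (simp add: powr_mult)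
    also have "\<dots> = c powr (\<alpha>/4) * s powr (\<alpha>/2)" by (simp add: powr_powr)
    finally show ?thesis by (simp add: mult_ac)
  qed
  then show ?thesis using \<alpha> by (intro that[of "c powr (\<alpha>/4) / (\<alpha>/4)"]) auto
qed

text \<open>At a maximum of f minus \<epsilon> times the barrier, increments of f are at most
  \<epsilon> times those of the barrier, so the integral is O(\<epsilon>). A set A of displacements
  along which f drops by a contributes an additional negative term. The constant depends neither on
  f nor on the maximum point; this uniformity allows \<epsilon> to be chosen afterwards.\<close>

lemma second_diff_integral_at_max:
  assumes \<alpha>: "0 < \<alpha>" "\<alpha> < 2" and \<rho>: "\<rho> > 0"
  obtains C where "C \<ge> 0" and
    "\<And>(f :: real^'n \<Rightarrow> real) x0 \<epsilon> A a. f \<in> Cb2 \<Longrightarrow> \<epsilon> \<ge> 0 \<Longrightarrow>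
       (\<And>x. f x - \<epsilon> * barrier x \<le> f x0 - \<epsilon> * barrier x0) \<Longrightarrow>
       A \<in> sets borel \<Longrightarrow> (\<And>z. z \<in> A \<Longrightarrow> \<rho> \<le> norm z \<and> f (x0 + z) \<le> f x0 - a) \<Longrightarrow> a \<ge> 0 \<Longrightarrow>
       (LINT z|lborel. second_diff f x0 z / norm z powr (real CARD('n) + \<alpha>))
         \<le> \<epsilon> * C - a * (LINT z|lborel. indicator A z / norm z powr (real CARD('n) + \<alpha>)) \<and>
       integrable lborel (\<lambda>z. indicator A z / norm z powr (real CARD('n) + \<alpha>))"
proof -
  obtain B where B: "B \<ge> 0" "\<And>s. s \<ge> \<rho> \<Longrightarrow> ln (2 * (1 + s\<^sup>2)) \<le> B * s powr (\<alpha>/2)"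
    using ln_le_powr_outside[OF \<alpha>(1) \<rho>] by blast
  define C0 where "C0 = max 2 (2 * B)"
  let ?G = "kernel_majorant \<alpha> \<rho> (\<alpha>/2) :: real^'n \<Rightarrow> real"
  let ?q = "real CARD('n) + \<alpha>"
  have G: "integrable lborel ?G" using \<alpha> \<rho> by (intro integrable_kernel_majorant) auto
  define C where "C = C0 * (LINT z|lborel. ?G z)"
  have C: "C \<ge> 0" unfolding C_def C0_def
    by (intro mult_nonneg_nonneg integral_nonneg_AE) (auto simp: kernel_majorant_nonneg)
  show ?thesis
  proof (rule that[OF C])
    fix f :: "real^'n \<Rightarrow> real" and x0 \<epsilon> A a
    assume f: "f \<in> Cb2" and \<epsilon>: "\<epsilon> \<ge> 0" and mx: "\<And>x. f x - \<epsilon> * barrier x \<le> f x0 - \<epsilon> * barrier x0"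
      and A[measurable]: "A \<in> sets borel" and Az: "\<And>z. z \<in> A \<Longrightarrow> \<rho> \<le> norm z \<and> f (x0 + z) \<le> f x0 - a" and a: "a \<ge> 0"
    have intA: "integrable lborel (\<lambda>z. indicator A z / norm z powr ?q)"
    proof (rule Bochner_Integration.integrable_bound)
      show "integrable lborel (kernel_majorant \<alpha> \<rho> 0 :: real^'n \<Rightarrow> real)"
        using \<alpha> \<rho> by (intro integrable_kernel_majorant) auto
      show "AE z in lborel. norm (indicator A z / norm z powr ?q) \<le> norm (kernel_majorant \<alpha> \<rho> 0 z)"
        using Az \<rho> by (intro AE_I2) (fastforce simp: indicator_def kernel_majorant_def divide_simps)
    qed measurable
    have pt: "second_diff f x0 z / norm z powr ?q \<le> \<epsilon> * C0 * ?G z - a * (indicator A z / norm z powr ?q)" for z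
    proof -
      have b: "f (x0 + y) - f x0 \<le> \<epsilon> * (barrier (x0 + y) - barrier x0)" for y
        using mx[of "x0 + y"] by (simp add: algebra_simps)
      have "second_diff f x0 z \<le> \<epsilon> * C0 * (if norm z < \<rho> then (norm z)\<^sup>2 else norm z powr (\<alpha>/2)) - a * indicator A z"
      proof (cases "norm z < \<rho>")
        case True
        then have "z \<notin> A" using Az by force
        \<comment> \<open>Near the origin both increments are combined: each alone is of first order
          in z, which the kernel does not integrate when \<alpha> >= 1.\<close>
        have "second_diff f x0 z \<le> \<epsilon> * second_diff barrier x0 z"
          using b[of z] b[of "-z"] by (simp add: second_diff_def algebra_simps)
        also have "\<dots> \<le> \<epsilon> * (2 * (norm z)\<^sup>2)"
          by (intro mult_left_mono second_diff_barrier_le \<epsilon>)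
        also have "\<dots> \<le> \<epsilon> * (C0 * (norm z)\<^sup>2)"
          unfolding C0_def by (intro mult_left_mono mult_right_mono \<epsilon>) auto
        finally show ?thesis using True \<open>z \<notin> A\<close> by (simp add: mult.assoc)
      next
        case False
        have bb: "f (x0 + y) - f x0 \<le> \<epsilon> * (B * norm z powr (\<alpha>/2))" if "norm y = norm z" for y
        proof -
          have "barrier (x0 + y) - barrier x0 \<le> B * norm z powr (\<alpha>/2)"
            using barrier_diff_le[of x0 y] B(2)[of "norm z"] False that by simp
          then show ?thesis using b[of y] mult_left_mono[OF _ \<epsilon>] order.trans by blast
        qed
        have nn: "\<epsilon> * (B * norm z powr (\<alpha>/2)) \<ge> 0" using \<epsilon> B by simp
        \<comment> \<open>On A the increment towards z is replaced by -a, while the one towards -z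
          is still bounded by the barrier.\<close>
        have "second_diff f x0 z \<le> 2 * (\<epsilon> * (B * norm z powr (\<alpha>/2))) - a * indicator A z"
          using bb[of z] bb[of "-z"] Az[of z] nn by (cases "z \<in> A") (auto simp: second_diff_def)
        also have "\<dots> \<le> \<epsilon> * (C0 * norm z powr (\<alpha>/2)) - a * indicator A z"
          using mult_left_mono[OF mult_right_mono[of "2 * B" C0 "norm z powr (\<alpha>/2)"] \<epsilon>]
          by (simp add: C0_def mult.assoc mult.left_commute)
        finally show ?thesis using False by (simp add: mult.assoc)
      qed
      from divide_right_mono[OF this, of "norm z powr ?q"] show ?thesis
        by (simp add: kernel_majorant_def diff_divide_distrib)
    qed
    have "(LINT z|lborel. second_diff f x0 z / norm z powr ?q)
        \<le> (LINT z|lborel. \<epsilon> * C0 * ?G z - a * (indicator A z / norm z powr ?q))"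
      by (intro integral_mono Cb2_integrable_second_diff[OF \<alpha> f] Bochner_Integration.integrable_diff
          integrable_mult_right G intA pt)
    also have "\<dots> = (LINT z|lborel. \<epsilon> * C0 * ?G z) - (LINT z|lborel. a * (indicator A z / norm z powr ?q))"
      by (intro Bochner_Integration.integral_diff integrable_mult_right G intA)
    also have "\<dots> = \<epsilon> * C - a * (LINT z|lborel. indicator A z / norm z powr ?q)"
      unfolding C_def by (simp only: integral_mult_right_zero mult.assoc)
    finally show "(LINT z|lborel. second_diff f x0 z / norm z powr ?q)
         \<le> \<epsilon> * C - a * (LINT z|lborel. indicator A z / norm z powr ?q) \<and>
       integrable lborel (\<lambda>z. indicator A z / norm z powr ?q)" using intA by simp
  qed
qed

text \<open>If \<open>f\<close> has mass at most \<open>m\<close> and a maximum of height \<open>b\<close>, Chebyshev's inequality leaves a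
  set of measure at least \<open>m / b\<close>, inside the ball of volume \<open>4 * m / b\<close>, on which \<open>f\<close> has
  dropped to half of its maximum.\<close>

lemma second_diff_integral_at_max_mass:
  fixes m U :: real
  assumes \<alpha>: "0 < \<alpha>" "\<alpha> < 2" and m: "m > 0" and U: "U > 0"
  obtains C \<gamma> where "C \<ge> 0" "\<gamma> > 0" and
    "\<And>(f :: real^'n \<Rightarrow> real) x0 \<epsilon>. f \<in> Cb2 \<Longrightarrow> \<epsilon> \<ge> 0 \<Longrightarrow>
       (\<And>x. f x - \<epsilon> * barrier x \<le> f x0 - \<epsilon> * barrier x0) \<Longrightarrow>
       (\<And>x. 0 \<le> f x) \<Longrightarrow> integrable lborel f \<Longrightarrow> (LINT x|lborel. f x) \<le> m \<Longrightarrow> 0 < f x0 \<Longrightarrow> f x0 \<le> U \<Longrightarrow>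
       (LINT z|lborel. second_diff f x0 z / norm z powr (real CARD('n) + \<alpha>))
         \<le> \<epsilon> * C - \<gamma> * f x0 powr (1 + \<alpha> / real CARD('n))"
proof -
  let ?d = "real CARD('n)"
  let ?q = "?d + \<alpha>"
  define V where "V = unit_ball_vol ?d"
  have V: "V > 0" by (simp add: V_def)
  have d: "?d > 0" by simp
  \<comment> \<open>The inner radius s below depends on the height b. Since b <= U, this \<rho> is a
    lower bound for all of them, so that a single constant C serves all admissible f.\<close>
  define \<rho> where "\<rho> = (m / (U * V)) powr (1 / ?d)"
  have \<rho>: "\<rho> > 0" using m U V by (simp add: \<rho>_def)
  obtain C where C: "C \<ge> 0" and
    Cmax: "\<And>(f :: real^'n \<Rightarrow> real) x0 \<epsilon> A a. f \<in> Cb2 \<Longrightarrow> \<epsilon> \<ge> 0 \<Longrightarrow>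
       (\<And>x. f x - \<epsilon> * barrier x \<le> f x0 - \<epsilon> * barrier x0) \<Longrightarrow>
       A \<in> sets borel \<Longrightarrow> (\<And>z. z \<in> A \<Longrightarrow> \<rho> \<le> norm z \<and> f (x0 + z) \<le> f x0 - a) \<Longrightarrow> a \<ge> 0 \<Longrightarrow>
       (LINT z|lborel. second_diff f x0 z / norm z powr ?q)
         \<le> \<epsilon> * C - a * (LINT z|lborel. indicator A z / norm z powr ?q) \<and>
       integrable lborel (\<lambda>z. indicator A z / norm z powr ?q)"
    using second_diff_integral_at_max[OF \<alpha> \<rho>, where 'n='n] by blast
  \<comment> \<open>This is the coefficient in (b/2) (m/b) R^(-d-\<alpha>) when R^d = 4m/(bV): drop
    in height, volume of A, and smallest kernel value on A.\<close>
  define \<gamma> where "\<gamma> = m / 2 * (4 * m / V) powr (- ?q / ?d)"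
  have \<gamma>: "\<gamma> > 0" using m V by (simp add: \<gamma>_def)
  show ?thesis
  proof (rule that[OF C \<gamma>])
    fix f :: "real^'n \<Rightarrow> real" and x0 \<epsilon>
    assume f: "f \<in> Cb2" and \<epsilon>: "\<epsilon> \<ge> 0" and mx: "\<And>x. f x - \<epsilon> * barrier x \<le> f x0 - \<epsilon> * barrier x0"
      and f0: "\<And>x. 0 \<le> f x" and fint: "integrable lborel f" and fm: "(LINT x|lborel. f x) \<le> m"
      and b0: "0 < f x0" and bU: "f x0 \<le> U"
    have [measurable]: "f \<in> borel_measurable borel"
      using Cb2_continuous[OF f] by (rule borel_measurable_continuous_onI)
    define b where "b = f x0"
    have b: "b > 0" "b \<le> U" using b0 bU by (auto simp: b_def)
    define s where "s = (m / (b * V)) powr (1 / ?d)"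
    define R where "R = (4 * m / (b * V)) powr (1 / ?d)"
    have R0: "R > 0" using m b V by (simp add: R_def)
    have s0: "s > 0" using m b V by (simp add: s_def)
    have \<rho>s: "\<rho> \<le> s" unfolding \<rho>_def s_def using m b V U
      by (intro powr_mono2 divide_left_mono mult_right_mono mult_pos_pos) auto
    have Rd: "R ^ CARD('n) = 4 * m / (b * V)"
      using m b V by (simp add: R_def powr_realpow[symmetric] powr_powr)
    have sd: "s ^ CARD('n) = m / (b * V)"
      using m b V by (simp add: s_def powr_realpow[symmetric] powr_powr)
    \<comment> \<open>Volume count: the ball of radius R has volume 4m/b, the ball of radius s has
      m/b, and the set H where f stays above b/2 has at most 2m/b. What remains for A is at least
      m/b.\<close>
    define A where "A = {z. s \<le> norm z \<and> norm z < R \<and> f (x0 + z) \<le> b - b/2}"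
    define H where "H = {z. f (x0 + z) \<ge> b/2}"
    have A_meas[measurable]: "A \<in> sets borel" unfolding A_def by measurable
    have H_meas[measurable]: "H \<in> sets borel" unfolding H_def by measurable
    have cont_ball: "measure lborel (ball (0::real^'n) t) = V * t ^ CARD('n)" if "t > 0" for t
      using that by (simp add: content_ball V_def)
    have fin: "emeasure lborel (ball (0::real^'n) t) < \<infinity>" for t
      by (rule emeasure_bounded_finite) simp
    have Hfin: "emeasure lborel H < \<infinity>" and H: "measure lborel H \<le> 2 * m / b"
    proof -
      have i: "integrable lborel (\<lambda>z. f (x0 + z))" "(LINT z|lborel. f (x0 + z)) \<le> m"
        using fint fm integral_lborel_translate[of f x0] by auto
      have "emeasure lborel {z\<in>space lborel. f (x0 + z) \<ge> b/2} \<le> (1/(b/2)) * (LINT z|lborel. f (x0 + z))"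
        using b f0 by (intro integral_Markov_inequality[OF i(1)]) auto
      then show "emeasure lborel H < \<infinity>" unfolding H_def by (simp add: order_le_less_trans)
      have "measure lborel {z\<in>space lborel. f (x0 + z) \<ge> b/2} \<le> (LINT z|lborel. f (x0 + z)) / (b/2)"
        using b f0 by (intro integral_Markov_inequality_measure[OF i(1), where A = "{}"]) auto
      also have "\<dots> \<le> m / (b/2)" using i b by (intro divide_right_mono) auto
      finally show "measure lborel H \<le> 2 * m / b" unfolding H_def by (simp add: mult.commute)
    qed
    have Afin: "emeasure lborel A < \<infinity>"
    proof -
      have "emeasure lborel A \<le> emeasure lborel (ball (0::real^'n) R)"
        by (intro emeasure_mono) (auto simp: A_def)
      then show ?thesis using fin[of R] by (rule order_le_less_trans)
    qed
    have "measure lborel (ball (0::real^'n) R) \<le> measure lborel (A \<union> (ball 0 s \<union> H))"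
    proof (rule measure_mono_fmeasurable)
      show "ball 0 R \<subseteq> A \<union> (ball 0 s \<union> H)" by (auto simp: A_def H_def)
      have "A \<in> fmeasurable lborel" "ball (0::real^'n) s \<in> fmeasurable lborel" "H \<in> fmeasurable lborel"
        using Afin fin[of s] Hfin by (auto intro!: fmeasurableI)
      then show "A \<union> (ball 0 s \<union> H) \<in> fmeasurable lborel" by (intro fmeasurable.Un)
    qed simp
    also have "\<dots> \<le> measure lborel A + measure lborel (ball (0::real^'n) s \<union> H)"
      by (intro measure_Un_le) auto
    also have "measure lborel (ball (0::real^'n) s \<union> H) \<le> measure lborel (ball (0::real^'n) s) + measure lborel H"
      by (intro measure_Un_le) auto
    finally have "V * R ^ CARD('n) \<le> measure lborel A + (V * s ^ CARD('n) + 2 * m / b)"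
      using H cont_ball[OF R0] cont_ball[OF s0] by linarith
    then have Am: "m / b \<le> measure lborel A"
    proof -
      have "V * (4 * m / (b * V)) = 4 * (m / b)" "V * (m / (b * V)) = m / b" using V by simp_all
      then show ?thesis
        using \<open>V * R ^ CARD('n) \<le> measure lborel A + (V * s ^ CARD('n) + 2 * m / b)\<close>
        unfolding Rd sd by simp
    qed
    have est: "(LINT z|lborel. second_diff f x0 z / norm z powr ?q)
         \<le> \<epsilon> * C - b/2 * (LINT z|lborel. indicator A z / norm z powr ?q) \<and>
       integrable lborel (\<lambda>z. indicator A z / norm z powr ?q)"
      by (rule Cmax[OF f \<epsilon> mx A_meas]) (use \<rho>s b in \<open>auto simp: A_def b_def\<close>)
    have "R powr (- ?q) * (m / b) \<le> R powr (- ?q) * measure lborel A"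
      using Am by (intro mult_left_mono) auto
    also have "\<dots> = (LINT z|lborel. R powr (- ?q) * indicator A z)"
      using Afin by simp
    also have "\<dots> \<le> (LINT z|lborel. indicator A z / norm z powr ?q)"
    proof (intro integral_mono conjunct2[OF est] integrable_mult_right integrable_real_indicator)
      fix z :: "real^'n"
      show "R powr (- ?q) * indicator A z \<le> indicator A z / norm z powr ?q"
      proof (cases "z \<in> A")
        case True
        then have z: "0 < norm z" "norm z \<le> R" using s0 by (auto simp: A_def)
        have "R powr (- ?q) \<le> norm z powr (- ?q)" using z \<alpha> by (intro powr_mono2') auto
        then have "R powr (- ?q) \<le> 1 / norm z powr ?q" by (simp only: powr_minus_divide)
        then show ?thesis using True by simp
      qed simp
    qed (use Afin in auto)
    finally have "b/2 * (R powr (- ?q) * (m / b)) \<le> b/2 * (LINT z|lborel. indicator A z / norm z powr ?q)"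
      using b by (intro mult_left_mono) auto
    moreover have "b/2 * (R powr (- ?q) * (m / b)) = \<gamma> * b powr (1 + \<alpha> / ?d)"
    proof -
      have "R powr (- ?q) = (4 * m / V / b) powr (- ?q / ?d)"
        by (simp add: R_def powr_powr mult.commute)
      also have "\<dots> = (4 * m / V) powr (- ?q / ?d) * b powr (?q / ?d)"
      proof -
        have "(c / b) powr - e = c powr - e * b powr e" if "c > 0" for c e :: real
          using that b by (simp add: powr_divide powr_minus divide_simps)
        from this[of "4 * m / V" "?q / ?d"] show ?thesis using m V by (simp only: minus_divide_left) simp
      qed
      also have "?q / ?d = 1 + \<alpha> / ?d" by (simp add: add_divide_distrib)
      finally show ?thesis using b by (simp add: \<gamma>_def)
    qed
    ultimately show "(LINT z|lborel. second_diff f x0 z / norm z powr ?q)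
         \<le> \<epsilon> * C - \<gamma> * f x0 powr (1 + \<alpha> / ?d)"
      using conjunct1[OF est] by (simp add: b_def)
  qed
qed

text \<open>On the whole space a positive supremum may not be attained, so \<epsilon> (barrier x + c
  t) is subtracted. The same \<epsilon> multiplies both penalties: the barrier disturbs the
  fractional Laplacian by O(\<epsilon>), and the time slope \<epsilon> c, with c chosen by the
  caller, outweighs that error.\<close>

lemma penalized_maximum:
  fixes v :: "real \<Rightarrow> real^'n \<Rightarrow> real"
  assumes cont: "continuous_on ({0..T} \<times> UNIV) (\<lambda>(t, x). v t x)"
    and bound: "\<And>t x. t \<in> {0..T} \<Longrightarrow> v t x \<le> B"
    and init: "\<And>x. v 0 x \<le> 0" and pos: "t1 \<in> {0..T}" "v t1 x1 > 0" and c: "c \<ge> 0"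
  obtains \<epsilon> t0 x0 where "\<epsilon> > 0" "0 < t0" "t0 \<le> T" "v t0 x0 > 0"
    "\<And>x. v t0 x - \<epsilon> * barrier x \<le> v t0 x0 - \<epsilon> * barrier x0"
    "\<And>D. ((\<lambda>t. v t x0) has_real_derivative D) (at t0) \<Longrightarrow> D \<ge> \<epsilon> * c"
proof -
  \<comment> \<open>Chosen so that the penalty at (t1, x1) takes away less than half of the positive
    value there.\<close>
  define \<epsilon> where "\<epsilon> = v t1 x1 / (2 * (1 + barrier x1 + c * t1))"
  have den: "1 + barrier x1 + c * t1 > 0" using pos c by (simp add: add_pos_nonneg barrier_nonneg)
  have \<epsilon>: "\<epsilon> > 0" unfolding \<epsilon>_def using pos den by simp
  let ?g = "\<lambda>t x. v t x - \<epsilon> * barrier x - \<epsilon> * c * t"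
  have g1: "?g t1 x1 > 0"
  proof -
    have "\<epsilon> * (barrier x1 + c * t1) \<le> \<epsilon> * (1 + barrier x1 + c * t1)" using \<epsilon> by (intro mult_left_mono) auto
    also have "\<dots> = v t1 x1 / 2" using den by (simp add: \<epsilon>_def field_simps)
    finally show ?thesis using pos by (simp add: algebra_simps)
  qed
  \<comment> \<open>Beyond this radius the barrier exceeds ln (R^2) = 2 |B| / \<epsilon>, so the
    penalized function is negative and the maximum over the compact cylinder is global.\<close>
  define R where "R = exp (\<bar>B\<bar> / \<epsilon>)"
  have far: "?g t x < 0" if "t \<in> {0..T}" "norm x > R" for t x
  proof -
    have "\<bar>B\<bar> / \<epsilon> \<le> ln (R\<^sup>2)" using \<epsilon> by (simp add: R_def ln_realpow divide_right_mono)
    also have "\<dots> < barrier x"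
    proof -
      have "R\<^sup>2 < (norm x)\<^sup>2" using that by (intro power_strict_mono) (auto simp: R_def)
      moreover have "R\<^sup>2 > 0" by (simp add: R_def)
      ultimately show ?thesis unfolding barrier_def by (subst ln_less_cancel_iff) linarith+
    qed
    finally have "\<bar>B\<bar> < \<epsilon> * barrier x" using \<epsilon> by (simp add: field_simps)
    moreover have "v t x \<le> \<bar>B\<bar>" using bound[OF that(1), of x] by linarith
    moreover have "\<epsilon> * c * t \<ge> 0" using \<epsilon> c that by simp
    ultimately show ?thesis by linarith
  qed
  have x1: "x1 \<in> cball 0 R" using far[OF pos(1), of x1] g1 by force
  have "\<exists>p\<in>{0..T} \<times> cball 0 R. \<forall>y\<in>{0..T} \<times> cball 0 R. (case y of (t, x) \<Rightarrow> ?g t x) \<le> (case p of (t, x) \<Rightarrow> ?g t x)"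
  proof (rule continuous_attains_sup)
    show "compact ({0..T} \<times> cball (0::real^'n) R)" by (intro compact_Times) auto
    show "{0..T} \<times> cball (0::real^'n) R \<noteq> {}"
      using pos(1) exp_gt_zero[of "\<bar>B\<bar> / \<epsilon>"] by (auto simp: R_def not_less less_imp_le)
    have "continuous_on ({0..T} \<times> cball 0 R) (\<lambda>(t, x). v t x)"
      by (rule continuous_on_subset[OF cont]) auto
    then show "continuous_on ({0..T} \<times> cball 0 R) (\<lambda>y. case y of (t, x) \<Rightarrow> ?g t x)"
      unfolding split_beta by (intro continuous_intros)
  qed
  then obtain t0 x0 where t0: "t0 \<in> {0..T}" and x0: "x0 \<in> cball 0 R"
    and mx0: "\<And>t x. t \<in> {0..T} \<Longrightarrow> x \<in> cball 0 R \<Longrightarrow> ?g t x \<le> ?g t0 x0" by fastforce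
  have gpos: "?g t0 x0 > 0" using mx0[OF pos(1) x1] g1 by linarith
  have mx: "?g t x \<le> ?g t0 x0" if "t \<in> {0..T}" for t x
    using mx0[OF that, of x] far[OF that, of x] gpos by (cases "norm x \<le> R") force+
  have "\<epsilon> * c * t0 \<ge> 0" "\<epsilon> * barrier x0 \<ge> 0" using \<epsilon> c t0 by (auto simp: barrier_nonneg)
  then have vpos: "v t0 x0 > 0" using gpos by linarith
  then have "t0 \<noteq> 0" using init[of x0] by force
  then have t0': "t0 > 0" using t0 by simp
  show ?thesis
  proof (rule that[OF \<epsilon> t0' _ vpos])
    show "t0 \<le> T" using t0 by simp
    show "v t0 x - \<epsilon> * barrier x \<le> v t0 x0 - \<epsilon> * barrier x0" for x
      using mx[OF t0, of x] by simp
    show "D \<ge> \<epsilon> * c" if D: "((\<lambda>t. v t x0) has_real_derivative D) (at t0)" for D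
    proof (rule ccontr)
      assume "\<not> D \<ge> \<epsilon> * c"
      then have neg: "D - \<epsilon> * c < 0" by simp
      have "((\<lambda>t. v t x0 - \<epsilon> * c * t) has_real_derivative (D - \<epsilon> * c)) (at t0)"
        by (auto intro!: derivative_eq_intros D)
      \<comment> \<open>The comparison uses earlier times, since t0 may be the endpoint T.\<close>
      from DERIV_neg_dec_left[OF this neg] obtain e where e: "e > 0"
        "\<And>h. 0 < h \<Longrightarrow> h < e \<Longrightarrow> v t0 x0 - \<epsilon> * c * t0 < v (t0 - h) x0 - \<epsilon> * c * (t0 - h)" by blast
      define h where "h = min (e/2) (t0/2)"
      have h: "0 < h" "h < e" "t0 - h \<in> {0..T}" using e(1) t0 t0' by (auto simp: h_def min_def)
      show False using e(2)[OF h(1,2)] mx[OF h(3), of x0] by simp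
    qed
  qed
qed

section \<open>Weights with slowly decaying tails\<close>

text \<open>The Japanese bracket to the power -q. It will be used with q = d + \<alpha>, the decay
  of the jump kernel.\<close>

definition weight :: "real \<Rightarrow> 'a::real_normed_vector \<Rightarrow> real" where
  "weight q x = (1 + (norm x)\<^sup>2) powr (- q / 2)"

lemma one_plus_norm_sq_ge [simp]: "1 + (norm x)\<^sup>2 \<ge> 1" "1 + (norm x)\<^sup>2 > 0" "1 + (norm x)\<^sup>2 \<noteq> 0"
  by (simp, smt (verit) zero_le_power2, smt (verit) zero_le_power2)

lemma weight_pos: "weight q x > 0"
  unfolding weight_def by (simp add: less_le)

lemma weight_le_one: "q \<ge> 0 \<Longrightarrow> weight q x \<le> 1"
  unfolding weight_def using powr_mono[of "- q / 2" 0 "1 + (norm x)\<^sup>2"] by simp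

lemma weight_minus [simp]: "weight q (- x) = weight q x"
  by (simp add: weight_def)

lemma continuous_on_weight: "continuous_on UNIV (weight q)"
  unfolding weight_def by (intro continuous_intros) simp

lemma borel_measurable_weight [measurable]: "(weight q :: 'a::euclidean_space \<Rightarrow> real) \<in> borel_measurable borel"
  by (intro borel_measurable_continuous_onI continuous_on_weight)

lemma weight_mono:
  assumes "q \<ge> 0" "c > 0" "1 + (norm x)\<^sup>2 \<le> c * (1 + (norm y)\<^sup>2)"
  shows "weight q y \<le> c powr (q/2) * weight q x"
proof -
  have "c powr (- q/2) * weight q y = (c * (1 + (norm y)\<^sup>2)) powr (- q/2)"
    unfolding weight_def using assms by (simp add: powr_mult)
  also have "\<dots> \<le> weight q x"
    unfolding weight_def using assms by (intro powr_mono2') auto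
  finally have "c powr (q/2) * (c powr (- q/2) * weight q y) \<le> c powr (q/2) * weight q x"
    by (intro mult_left_mono) auto
  moreover have "c powr (q/2) * c powr (- q/2) = 1"
    using assms by (simp add: powr_add[symmetric])
  ultimately show ?thesis by (simp add: mult.assoc[symmetric])
qed

lemma weight_shift_le:
  assumes "q \<ge> 0" "norm z \<le> 1"
  shows "weight q (x + z) \<le> 3 powr (q/2) * weight q x"
proof (rule weight_mono[OF assms(1)])
  have arith: "a \<le> 1 \<Longrightarrow> b \<le> 2 * c + 2 * a \<Longrightarrow> 0 \<le> c \<Longrightarrow> 1 + b \<le> 3 * (1 + c)" for a b c :: real
    by simp
  have "(norm z)\<^sup>2 \<le> 1" using assms(2) by (simp add: power_le_one)
  moreover have "(norm x)\<^sup>2 \<le> 2 * (norm (x + z))\<^sup>2 + 2 * (norm z)\<^sup>2"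
    using norm_add_sq_le[of "x + z" "- z"] by simp
  ultimately show "1 + (norm x)\<^sup>2 \<le> 3 * (1 + (norm (x + z))\<^sup>2)"
    using arith[of "(norm z)\<^sup>2" "(norm x)\<^sup>2" "(norm (x + z))\<^sup>2"] by simp
qed simp

text \<open>The longer of a and b has at least half the length of a + b, so its weight is bounded by
  a multiple of the weight at a + b, and the other factor is kept. Integrated, this says that the
  convolution of the weight with itself is bounded by a multiple of the weight.\<close>

lemma weight_mult_le:
  assumes "q \<ge> 0"
  shows "weight q a * weight q b \<le> 4 powr (q/2) * weight q (a + b) * (weight q a + weight q b)"
proof -
  have *: "weight q x * weight q y \<le> 4 powr (q/2) * weight q (x + y) * (weight q x + weight q y)"
    if "norm x \<le> norm y" for x y :: 'a
  proof -
    have "(norm x)\<^sup>2 \<le> (norm y)\<^sup>2" using that by (intro power_mono) auto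
    moreover have arith: "a \<le> b \<Longrightarrow> c \<le> 2 * a + 2 * b \<Longrightarrow> 0 \<le> b \<Longrightarrow> 1 + c \<le> 4 * (1 + b)" for a b c :: real
      by simp
    ultimately have "1 + (norm (x + y))\<^sup>2 \<le> 4 * (1 + (norm y)\<^sup>2)"
      using norm_add_sq_le[of x y] arith[of "(norm x)\<^sup>2" "(norm y)\<^sup>2" "(norm (x + y))\<^sup>2"] by simp
    then have "weight q y \<le> 4 powr (q/2) * weight q (x + y)"
      by (intro weight_mono assms) auto
    then have "weight q x * weight q y \<le> weight q x * (4 powr (q/2) * weight q (x + y))"
      by (intro mult_left_mono less_imp_le[OF weight_pos])
    also have "\<dots> = 4 powr (q/2) * weight q (x + y) * weight q x" by simp
    also have "\<dots> \<le> 4 powr (q/2) * weight q (x + y) * (weight q x + weight q y)"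
      by (intro mult_left_mono mult_nonneg_nonneg less_imp_le[OF weight_pos]) (simp_all add: less_imp_le[OF weight_pos])
    finally show ?thesis .
  qed
  show ?thesis
  proof (cases "norm a \<le> norm b")
    case False
    then show ?thesis using *[of b a] by (simp add: add.commute mult.commute)
  qed (rule *)
qed

lemma inverse_norm_powr_le_weight:
  assumes "q \<ge> 0" "norm z \<ge> 1"
  shows "1 / norm z powr q \<le> 2 powr (q/2) * weight q z"
proof -
  have "1 \<le> (norm z)\<^sup>2" using assms(2) by (simp add: one_le_power)
  have "1 / norm z powr q = ((norm z)\<^sup>2) powr (- q/2)"
    using assms(2) powr_powr[of "norm z" 2 "- q/2"] by (simp add: powr_minus_divide)
  also have "\<dots> = 2 powr (q/2) * (2 * (norm z)\<^sup>2) powr (- q/2)"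
    by (simp add: powr_mult powr_minus)
  also have "\<dots> \<le> 2 powr (q/2) * weight q z"
    unfolding weight_def using assms \<open>1 \<le> (norm z)\<^sup>2\<close> by (intro mult_left_mono powr_mono2') auto
  finally show ?thesis .
qed

lemma integrable_weight:
  assumes "q > real DIM('a)"
  shows "integrable lborel (weight q :: 'a::euclidean_space \<Rightarrow> real)"
proof (rule integrableI_nonneg)
  let ?B = "\<lambda>z::'a. ennreal (norm z powr (- q)) * indicator {z. 1 \<le> norm z} z"
  have q: "q \<ge> 0" using assms by (meson less_imp_le of_nat_0_le_iff order.trans)
  have "ennreal (weight q z) \<le> indicator (ball 0 1) z + ?B z" for z :: 'a
  proof (cases "norm z < 1")
    case True
    then show ?thesis using weight_le_one[OF q, of z] by (simp add: ennreal_le_1)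
  next
    case False
    then have z: "norm z \<ge> 1" by simp
    have "weight q z \<le> ((norm z)\<^sup>2) powr (- q/2)"
      unfolding weight_def using z q by (intro powr_mono2') auto
    also have "\<dots> = norm z powr (- q)"
      using z powr_powr[of "norm z" 2 "- q/2"] by simp
    finally show ?thesis using z by (simp add: ennreal_leI)
  qed
  then have "(\<integral>\<^sup>+z. ennreal (weight q (z::'a)) \<partial>lborel) \<le> (\<integral>\<^sup>+z. indicator (ball 0 1) z + ?B z \<partial>lborel)"
    by (intro nn_integral_mono)
  also have "\<dots> = (\<integral>\<^sup>+z. indicator (ball (0::'a) 1) z \<partial>lborel) + (\<integral>\<^sup>+z. ?B z \<partial>lborel)"
    by (intro nn_integral_add) (auto intro!: borel_measurable_indicator)
  also have "\<dots> < \<infinity>"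
    using nn_integral_norm_powr_outside[of "- q" 1, where 'a='a] assms emeasure_lborel_ball_finite[of "0::'a" 1]
    by (simp add: less_top)
  finally show "(\<integral>\<^sup>+z. ennreal (weight q (z::'a)) \<partial>lborel) < \<infinity>" .
qed (auto simp: less_imp_le[OF weight_pos])

section \<open>Twice differentiable truncation of the weight\<close>

lemma has_real_derivative_pos_part_power:
  "((\<lambda>t. (max 0 t) ^ Suc (Suc n)) has_real_derivative (real n + 2) * (max 0 t) ^ Suc n) (at t)"
proof -
  consider "t > 0" | "t < 0" | "t = 0" by linarith
  then show ?thesis
  proof cases
    case 1
    have "((\<lambda>t. t ^ Suc (Suc n)) has_real_derivative (real n + 2) * (max 0 t) ^ Suc n) (at t)"
      using 1 DERIV_pow[of "Suc (Suc n)" t] by (simp add: add.commute)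
    then show ?thesis
      using 1 by (elim has_field_derivative_transform_within_open[where S = "{0<..}"]) auto
  next
    case 2
    have "((\<lambda>t. 0) has_real_derivative (real n + 2) * (max 0 t) ^ Suc n) (at t)"
      using 2 by (auto intro!: derivative_eq_intros)
    then show ?thesis
      using 2 by (elim has_field_derivative_transform_within_open[where S = "{..<0}"]) auto
  next
    \<comment> \<open>The exponent is at least 2, so the difference quotient at the corner is at
      most |h|^(n+1) and tends to 0.\<close>
    case 3
    have "((\<lambda>h. ((max 0 (0 + h)) ^ Suc (Suc n) - (max 0 0) ^ Suc (Suc n)) / h) \<longlongrightarrow> (0::real)) (at 0)"
    proof (rule Lim_null_comparison)
      show "\<forall>\<^sub>F h in at 0. norm (((max 0 (0 + h)) ^ Suc (Suc n) - (max 0 0) ^ Suc (Suc n)) / h) \<le> \<bar>h::real\<bar> ^ Suc n"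
        by (intro always_eventually allI) (auto simp: max_def abs_mult power_abs intro!: mult_nonpos_nonneg)
      show "((\<lambda>h. \<bar>h::real\<bar> ^ Suc n) \<longlongrightarrow> 0) (at 0)"
        by (auto intro!: tendsto_eq_intros)
    qed
    then show ?thesis unfolding 3 DERIV_def by simp
  qed
qed

text \<open>The third power makes the compactly supported truncation of the weight a \<open>C\<^sup>2\<close> function.\<close>

definition cutoff :: "real \<Rightarrow> real \<Rightarrow> 'a::real_normed_vector \<Rightarrow> real" where
  "cutoff q \<epsilon> x = weight q x * (max 0 (1 - \<epsilon> * (1 + (norm x)\<^sup>2))) ^ 3"

lemma continuous_on_cutoff: "continuous_on UNIV (cutoff q \<epsilon>)"
  unfolding cutoff_def weight_def by (intro continuous_intros) simp

lemma borel_measurable_cutoff [measurable]: "(cutoff q \<epsilon> :: 'a::euclidean_space \<Rightarrow> real) \<in> borel_measurable borel"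
  by (intro borel_measurable_continuous_onI continuous_on_cutoff)

lemma cutoff_nonneg: "cutoff q \<epsilon> x \<ge> 0"
  unfolding cutoff_def by (simp add: less_imp_le[OF weight_pos])

lemma cutoff_le_weight: "\<epsilon> \<ge> 0 \<Longrightarrow> cutoff q \<epsilon> x \<le> weight q x"
proof -
  assume "\<epsilon> \<ge> 0"
  then have "(max 0 (1 - \<epsilon> * (1 + (norm x)\<^sup>2))) ^ 3 \<le> 1"
    by (intro power_le_one) auto
  then show ?thesis
    unfolding cutoff_def using mult_left_mono[OF _ less_imp_le[OF weight_pos]] by fastforce
qed

text \<open>The constant is independent of \<epsilon>. The cutoff is a function G of 1 + |x|^2;
  along a line this argument is a quadratic polynomial Q with Q'^2 <= 4 Q |z|^2, so it suffices to
  bound G' and y G'' by multiples of y^(-q/2). Moving the weight back from the line to x costs the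
  factor 3^(q/2).\<close>

lemma cutoff_second_diff_le:
  fixes x z :: "'a::real_inner"
  assumes q: "q \<ge> 0" and \<epsilon>: "0 < \<epsilon>" "\<epsilon> \<le> 1" and z: "norm z \<le> 1"
  shows "\<bar>second_diff (cutoff q \<epsilon>) x z\<bar> \<le> 2 * (2 * q\<^sup>2 + 20 * q + 40) * 3 powr (q/2) * (norm z)\<^sup>2 * weight q x"
proof -
  define p where "p = q/2"
  have p: "p \<ge> 0" using q by (simp add: p_def)
  define m where "m y = max 0 (1 - \<epsilon> * y)" for y :: real
  define G where "G y = y powr (-p) * m y ^ 3" for y
  define G1 where "G1 y = - p * y powr (-p - 1) * m y ^ 3 - 3 * \<epsilon> * y powr (-p) * m y ^ 2" for y
  define G2 where "G2 y = p * (p + 1) * y powr (-p - 2) * m y ^ 3 + 6 * \<epsilon> * p * y powr (-p - 1) * m y ^ 2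
      + 6 * \<epsilon>\<^sup>2 * y powr (-p) * m y" for y
  have mn: "((\<lambda>y. m y ^ Suc (Suc n)) has_real_derivative (real n + 2) * m y ^ Suc n * (- \<epsilon>)) (at y)" for y n
    unfolding m_def
    by (rule DERIV_chain2[OF has_real_derivative_pos_part_power]) (auto intro!: derivative_eq_intros)
  have m3: "((\<lambda>y. m y ^ 3) has_real_derivative - 3 * \<epsilon> * m y ^ 2) (at y)" for y
    using mn[of 1 y] by (simp add: numeral_eq_Suc mult_ac)
  have m2: "((\<lambda>y. m y ^ 2) has_real_derivative - 2 * \<epsilon> * m y) (at y)" for y
    using mn[of 0 y] by (simp add: numeral_eq_Suc mult_ac)
  have dp: "((\<lambda>y. y powr a) has_real_derivative a * y powr (a - 1)) (at y)" if "y > 0" for a y :: real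
    using that by (rule has_real_derivative_powr)
  have dG: "(G has_real_derivative G1 y) (at y)" if "y > 0" for y
    unfolding G_def[abs_def] G1_def
    by (rule DERIV_cong[OF DERIV_mult[OF dp[OF that] m3]]) (simp add: algebra_simps)
  have dG1: "(G1 has_real_derivative G2 y) (at y)" if "y > 0" for y
  proof -
    have "-p - 1 - 1 = -p - 2" by simp
    note d = dp[OF that, of "-p - 1", unfolded this]
    show ?thesis
      unfolding G1_def[abs_def] G2_def
      by (intro DERIV_cong[OF DERIV_diff[OF DERIV_mult[OF DERIV_cmult[OF d, of "- p"] m3]
            DERIV_mult[OF DERIV_cmult[OF dp[OF that], of "3 * \<epsilon>"] m2]]])
         (simp_all add: algebra_simps power2_eq_square)
  qed
  have m0: "0 \<le> m y" for y by (simp add: m_def)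
  have m1: "m y \<le> 1" if "y \<ge> 1" for y using that \<epsilon> by (simp add: m_def)
  \<comment> \<open>The source of uniformity in \<epsilon>: the truncation factor vanishes as soon
    as \<epsilon> y >= 1, so the large factor y in y G'' is always paired with an
    \<epsilon>.\<close>
  have em: "\<epsilon> * y * m y \<le> 1" if "y \<ge> 1" for y
  proof (cases "m y = 0")
    case False
    then have "\<epsilon> * y \<le> 1" by (simp add: m_def split: if_splits)
    then show ?thesis using m0[of y] m1[OF that] mult_mono[of "\<epsilon> * y" 1 "m y" 1] by simp
  qed simp
  have bG1: "\<bar>G1 y\<bar> \<le> (p + 3) * y powr (-p)" if y: "y \<ge> 1" for y
  proof -
    have "p * y powr (-p - 1) * m y ^ 3 \<le> p * y powr (-p) * 1"
      using y p m0 m1[OF y] by (intro mult_mono powr_mono power_le_one mult_left_mono) auto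
    moreover have "3 * \<epsilon> * y powr (-p) * m y ^ 2 \<le> 3 * 1 * y powr (-p) * 1"
      using y \<epsilon> m0 m1[OF y] by (intro mult_mono power_le_one mult_nonneg_nonneg) auto
    moreover have "0 \<le> p * y powr (-p - 1) * m y ^ 3" "0 \<le> 3 * \<epsilon> * y powr (-p) * m y ^ 2"
      using p \<epsilon> m0[of y] by auto
    ultimately show ?thesis unfolding G1_def by (simp add: algebra_simps abs_le_iff)
  qed
  have bG2: "y * \<bar>G2 y\<bar> \<le> (p * (p + 1) + 6 * p + 6) * y powr (-p)" if y: "y \<ge> 1" for y
  proof -
    have yp: "y * y powr (-p - 2) = y powr (-p - 1)" "y * y powr (-p - 1) = y powr (-p)"
    proof -
      have *: "y * y powr a = y powr (a + 1)" for a using y by (simp add: powr_add)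
      show "y * y powr (-p - 2) = y powr (-p - 1)" "y * y powr (-p - 1) = y powr (-p)"
        unfolding * by (rule arg_cong[of _ _ "(powr) y"], simp)+
    qed
    have nn: "0 \<le> p * (p + 1) * y powr (-p - 2) * m y ^ 3" "0 \<le> 6 * \<epsilon> * p * y powr (-p - 1) * m y ^ 2"
      "0 \<le> 6 * \<epsilon>\<^sup>2 * y powr (-p) * m y" using p \<epsilon> m0[of y] by auto
    have "y * \<bar>G2 y\<bar> = p * (p + 1) * (y * y powr (-p - 2)) * m y ^ 3 + 6 * \<epsilon> * p * (y * y powr (-p - 1)) * m y ^ 2
      + 6 * \<epsilon> * (\<epsilon> * y * m y) * y powr (-p)"
      using nn unfolding G2_def by (simp add: algebra_simps power2_eq_square)
    also have "\<dots> = p * (p + 1) * y powr (-p - 1) * m y ^ 3 + 6 * \<epsilon> * p * y powr (-p) * m y ^ 2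
      + 6 * \<epsilon> * (\<epsilon> * y * m y) * y powr (-p)"
      by (simp only: yp)
    also have "\<dots> \<le> p * (p + 1) * y powr (-p) * 1 + 6 * 1 * p * y powr (-p) * 1 + 6 * 1 * 1 * y powr (-p)"
      using y p \<epsilon> m0[of y] m1[OF y] em[OF y]
      by (intro add_mono mult_mono powr_mono power_le_one mult_left_mono mult_nonneg_nonneg) auto
    finally show ?thesis by (simp add: algebra_simps)
  qed
  define Q where "Q s = 1 + (norm (x + s *\<^sub>R z))\<^sup>2" for s :: real
  define Q1 where "Q1 s = 2 * ((x + s *\<^sub>R z) \<bullet> z)" for s :: real
  have Q_ge: "Q s \<ge> 1" for s by (simp add: Q_def)
  have dQ: "(Q has_real_derivative Q1 s) (at s)" for s
  proof -
    have "Q = (\<lambda>s. 1 + (x \<bullet> x + 2 * s * (x \<bullet> z) + s\<^sup>2 * (z \<bullet> z)))"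
      unfolding Q_def power2_norm_eq_inner
      by (intro ext) (simp add: inner_add inner_commute power2_eq_square algebra_simps)
    then show ?thesis unfolding Q1_def
      by (auto intro!: derivative_eq_intros simp: inner_add algebra_simps)
  qed
  have dQ1: "(Q1 has_real_derivative 2 * (norm z)\<^sup>2) (at s)" for s
  proof -
    have "Q1 = (\<lambda>s. 2 * (x \<bullet> z) + 2 * s * (z \<bullet> z))"
      unfolding Q1_def by (intro ext) (simp add: inner_add algebra_simps)
    then show ?thesis by (auto intro!: derivative_eq_intros simp: power2_norm_eq_inner)
  qed
  have Q1_le: "(Q1 s)\<^sup>2 \<le> 4 * Q s * (norm z)\<^sup>2" for s
  proof -
    have "((x + s *\<^sub>R z) \<bullet> z)\<^sup>2 \<le> ((x + s *\<^sub>R z) \<bullet> (x + s *\<^sub>R z)) * (z \<bullet> z)"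
      by (rule Cauchy_Schwarz_ineq)
    also have "\<dots> \<le> Q s * (norm z)\<^sup>2"
      unfolding Q_def power2_norm_eq_inner by (intro mult_right_mono) auto
    finally show ?thesis by (simp add: Q1_def power_mult_distrib)
  qed
  define \<phi>1 where "\<phi>1 s = G1 (Q s) * Q1 s" for s
  define \<phi>2 where "\<phi>2 s = G2 (Q s) * Q1 s * Q1 s + 2 * (norm z)\<^sup>2 * G1 (Q s)" for s
  have Qpos: "Q s > 0" for s using Q_ge[of s] by linarith
  have d1: "((\<lambda>s. G (Q s)) has_real_derivative \<phi>1 s) (at s)" for s
    unfolding \<phi>1_def by (rule DERIV_chain2[OF dG[OF Qpos] dQ])
  have d2: "(\<phi>1 has_real_derivative \<phi>2 s) (at s)" for s
    unfolding \<phi>1_def[abs_def] \<phi>2_def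
    by (rule DERIV_cong[OF DERIV_mult[OF DERIV_chain2[OF dG1[OF Qpos] dQ] dQ1]]) simp
  \<comment> \<open>The computation below yields 4p^2 + 30p + 30 with p = q/2, that is q^2 + 15q +
    30, here rounded up.\<close>
  define K where "K = (2 * q\<^sup>2 + 20 * q + 40) * 3 powr (q/2) * (norm z)\<^sup>2 * weight q x"
  have b2: "\<bar>\<phi>2 s\<bar> \<le> K" if s: "\<bar>s\<bar> \<le> 1" for s
  proof -
    have w: "Q s powr (-p) = weight q (x + s *\<^sub>R z)" by (simp add: Q_def weight_def p_def)
    have wle: "weight q (x + s *\<^sub>R z) \<le> 3 powr (q/2) * weight q x"
      using s z by (intro weight_shift_le q) (simp add: mult_le_one)
    have "\<bar>\<phi>2 s\<bar> \<le> \<bar>G2 (Q s)\<bar> * (Q1 s)\<^sup>2 + 2 * (norm z)\<^sup>2 * \<bar>G1 (Q s)\<bar>"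
      unfolding \<phi>2_def by (rule order.trans[OF abs_triangle_ineq]) (simp add: abs_mult power2_eq_square)
    also have "\<dots> \<le> \<bar>G2 (Q s)\<bar> * (4 * Q s * (norm z)\<^sup>2) + 2 * (norm z)\<^sup>2 * \<bar>G1 (Q s)\<bar>"
      by (intro add_right_mono mult_left_mono Q1_le) auto
    also have "\<dots> = (norm z)\<^sup>2 * (4 * (Q s * \<bar>G2 (Q s)\<bar>) + 2 * \<bar>G1 (Q s)\<bar>)"
      by (simp add: algebra_simps)
    also have "\<dots> \<le> (norm z)\<^sup>2 * (4 * ((p * (p + 1) + 6 * p + 6) * Q s powr (-p)) + 2 * ((p + 3) * Q s powr (-p)))"
      by (intro mult_left_mono add_mono bG2 bG1 Q_ge) auto
    also have "\<dots> = (4 * p\<^sup>2 + 30 * p + 30) * (norm z)\<^sup>2 * weight q (x + s *\<^sub>R z)"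
      unfolding w by (simp add: algebra_simps power2_eq_square)
    also have "\<dots> \<le> (2 * q\<^sup>2 + 20 * q + 40) * (norm z)\<^sup>2 * (3 powr (q/2) * weight q x)"
      using q wle less_imp_le[OF weight_pos[of q "x + s *\<^sub>R z"]]
      by (intro mult_mono) (auto simp: p_def power2_eq_square)
    finally show ?thesis by (simp add: K_def mult_ac)
  qed
  have lip: "\<bar>\<phi>1 s - \<phi>1 t\<bar> \<le> K * \<bar>s - t\<bar>" if "s \<in> {-1..1}" "t \<in> {-1..1}" for s t
    using field_differentiable_bound[of "{-1..1}" \<phi>1 \<phi>2 K s t] that b2 d2
    by (auto simp: has_field_derivative_at_within abs_le_iff)
  \<comment> \<open>One mean value point on each side of 0 turns the second difference into a
    difference of first derivatives at points at most 2 apart.\<close>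
  have mv: "\<exists>s\<in>{a..b}. G (Q b) - G (Q a) = (b - a) * \<phi>1 s" if "a < b" for a b
    using MVT2[OF that, of "\<lambda>s. G (Q s)" \<phi>1] d1 by (meson atLeastAtMost_iff less_imp_le)
  obtain s where s: "s \<in> {0..1}" "G (Q 1) - G (Q 0) = (1 - 0) * \<phi>1 s" using mv[of 0 1] by auto
  obtain t where t: "t \<in> {-1..0}" "G (Q 0) - G (Q (-1)) = (0 - (-1)) * \<phi>1 t" using mv[of "-1" 0] by auto
  have K0: "K \<ge> 0" using b2[of 0] by (smt (verit) abs_zero)
  have Gc: "G (Q s) = cutoff q \<epsilon> (x + s *\<^sub>R z)" for s
    by (simp add: G_def Q_def cutoff_def weight_def p_def m_def)
  have "second_diff (cutoff q \<epsilon>) x z = \<phi>1 s - \<phi>1 t"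
    using s(2) t(2) unfolding Gc by (simp add: second_diff_def)
  also have "\<bar>\<dots>\<bar> \<le> K * \<bar>s - t\<bar>" using s t by (intro lip) auto
  also have "\<dots> \<le> K * 2" using s t K0 by (intro mult_left_mono) auto
  finally show ?thesis by (simp only: K_def mult_ac)
qed

text \<open>This is what makes the weighted estimate close: the nonlocal operator maps the weight
  into multiples of itself. Small jumps are controlled by the second-order bound; for large jumps
  the kernel is itself bounded by the weight of z, and the product of two weights is handled by
  \<open>weight_mult_le\<close>.\<close>

lemma nn_integral_second_diff_le:
  assumes \<alpha>: "0 < \<alpha>" "\<alpha> < 2" and A: "A \<ge> 0"
  defines "q \<equiv> real DIM('a::euclidean_space) + \<alpha>"
  obtains C where "C \<ge> 0" and
    "\<And>(f :: 'a \<Rightarrow> real) x. f \<in> borel_measurable borel \<Longrightarrow> (\<And>x. 0 \<le> f x) \<Longrightarrow> (\<And>x. f x \<le> weight q x) \<Longrightarrow>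
       (\<And>x z. norm z \<le> 1 \<Longrightarrow> \<bar>second_diff f x z\<bar> \<le> A * (norm z)\<^sup>2 * weight q x) \<Longrightarrow>
       (\<integral>\<^sup>+z. ennreal (\<bar>second_diff f x z\<bar> / norm z powr q) \<partial>lborel) \<le> ennreal (C * weight q x)"
proof -
  let ?G = "kernel_majorant \<alpha> 1 0 :: 'a \<Rightarrow> real"
  have q: "q > real DIM('a)" "q \<ge> 0" using \<alpha> by (auto simp: q_def)
  have iG: "integrable lborel ?G" using \<alpha> by (intro integrable_kernel_majorant) auto
  have iw: "integrable lborel (weight q :: 'a \<Rightarrow> real)" using q by (intro integrable_weight)
  have w0: "weight q y \<ge> 0" for y :: 'a by (rule less_imp_le[OF weight_pos])
  define c where "c = 2 powr (q/2) * 4 powr (q/2)"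
  have c: "c \<ge> 0" by (simp add: c_def)
  define C where "C = (A + 2) * (LINT z|lborel. ?G z) + 4 * c * (LINT z|lborel. weight q (z::'a))"
  have C: "C \<ge> 0" unfolding C_def using A c
    by (intro add_nonneg_nonneg mult_nonneg_nonneg integral_nonneg_AE) (auto simp: kernel_majorant_nonneg w0)
  show ?thesis
  proof (rule that[OF C])
    fix f :: "'a \<Rightarrow> real" and x
    assume [measurable]: "f \<in> borel_measurable borel" and f0: "\<And>x. 0 \<le> f x" and fw: "\<And>x. f x \<le> weight q x"
      and sd: "\<And>x z. norm z \<le> 1 \<Longrightarrow> \<bar>second_diff f x z\<bar> \<le> A * (norm z)\<^sup>2 * weight q x"
    let ?H = "\<lambda>z. weight q x * ((A + 2) * ?G z + c * (weight q (x + z) + weight q (x - z) + 2 * weight q z))"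
    have le: "\<bar>second_diff f x z\<bar> / norm z powr q \<le> ?H z" for z
    proof (cases "norm z < 1")
      case True
      have "\<bar>second_diff f x z\<bar> / norm z powr q \<le> A * (norm z)\<^sup>2 * weight q x / norm z powr q"
        using True by (intro divide_right_mono sd) auto
      also have "\<dots> = weight q x * (A * ?G z)" using True by (simp add: kernel_majorant_def q_def mult_ac)
      also have "\<dots> \<le> ?H z"
        using A c w0 kernel_majorant_nonneg[of \<alpha> 1 0 z]
        by (intro mult_left_mono add_increasing2 mult_right_mono mult_nonneg_nonneg add_nonneg_nonneg) auto
      finally show ?thesis .
    next
      case False
      then have z: "norm z \<ge> 1" by simp
      let ?k = "1 / norm z powr q"
      have k: "?k \<le> 2 powr (q/2) * weight q z" by (rule inverse_norm_powr_le_weight[OF q(2) z])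
      \<comment> \<open>The product inequality is applied to x + y and -y, whose sum is x.\<close>
      have conv: "weight q (x + y) * ?k \<le> c * weight q x * (weight q (x + y) + weight q z)"
        if "y = z \<or> y = - z" for y
      proof -
        have wy: "weight q (- y) = weight q z" using that by auto
        have "weight q (x + y) * ?k \<le> weight q (x + y) * (2 powr (q/2) * weight q (- y))"
          unfolding wy by (intro mult_left_mono k w0)
        also have "\<dots> = 2 powr (q/2) * (weight q (x + y) * weight q (- y))" by simp
        also have "\<dots> \<le> 2 powr (q/2) * (4 powr (q/2) * weight q (x + y + - y) * (weight q (x + y) + weight q (- y)))"
          by (intro mult_left_mono weight_mult_le q) simp
        also have "\<dots> = c * weight q x * (weight q (x + y) + weight q z)"
          unfolding wy by (simp add: c_def mult_ac)
        finally show ?thesis .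
      qed
      have "\<bar>second_diff f x z\<bar> \<le> weight q (x + z) + weight q (x - z) + 2 * weight q x"
        using f0[of "x + z"] f0[of "x - z"] f0[of x] fw[of "x + z"] fw[of "x - z"] fw[of x]
        by (simp add: second_diff_def abs_le_iff)
      then have "\<bar>second_diff f x z\<bar> / norm z powr q \<le> (weight q (x + z) + weight q (x - z) + 2 * weight q x) / norm z powr q"
        by (rule divide_right_mono) simp
      also have "\<dots> = weight q (x + z) * ?k + weight q (x - z) * ?k + 2 * weight q x * ?k"
        by (simp add: add_divide_distrib)
      also have "\<dots> \<le> c * weight q x * (weight q (x + z) + weight q z) + c * weight q x * (weight q (x - z) + weight q z) + 2 * weight q x * ?k"
        using conv[of z] conv[of "- z"] by simp
      also have "2 * weight q x * ?k = weight q x * (2 * ?G z)"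
        using z False by (simp add: kernel_majorant_def q_def)
      also have "c * weight q x * (weight q (x + z) + weight q z) + c * weight q x * (weight q (x - z) + weight q z) + weight q x * (2 * ?G z)
          = weight q x * (2 * ?G z + c * (weight q (x + z) + weight q (x - z) + 2 * weight q z))"
        by (simp add: algebra_simps)
      also have "\<dots> \<le> ?H z"
        using A w0 kernel_majorant_nonneg[of \<alpha> 1 0 z]
        by (intro mult_left_mono add_right_mono mult_right_mono) auto
      finally show ?thesis .
    qed
    have i1: "integrable lborel (\<lambda>z. weight q (x + z))"
      using iw by (simp add: integral_lborel_translate(2)[of "weight q"])
    have "integrable lborel (\<lambda>z. weight q (x + - z))"
      using i1 integral_lborel_uminus(2)[of "\<lambda>z. weight q (x + z)"] by simp
    then have i2: "integrable lborel (\<lambda>z. weight q (x - z))" by simp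
    have e1: "(LINT z|lborel. weight q (x + z)) = (LINT z|lborel. weight q (z::'a))"
      by (simp add: integral_lborel_translate(1)[of "weight q"])
    have e2: "(LINT z|lborel. weight q (x - z)) = (LINT z|lborel. weight q (z::'a))"
      using integral_lborel_uminus(1)[of "\<lambda>z. weight q (x + z)"] e1 by simp
    have iH: "integrable lborel ?H"
      by (intro integrable_mult_right Bochner_Integration.integrable_add iG i1 i2 iw)
    have H0: "0 \<le> ?H z" for z using order.trans[OF _ le[of z]] by simp
    have "(\<integral>\<^sup>+z. ennreal (\<bar>second_diff f x z\<bar> / norm z powr q) \<partial>lborel) \<le> (\<integral>\<^sup>+z. ennreal (?H z) \<partial>lborel)"
      by (intro nn_integral_mono ennreal_leI le)
    also have "\<dots> = ennreal (LINT z|lborel. ?H z)"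
      by (rule nn_integral_eq_integral[OF iH]) (intro AE_I2 H0)
    also have "(LINT z|lborel. ?H z) = weight q x * ((A + 2) * (LINT z|lborel. ?G z)
        + c * ((LINT z|lborel. weight q (x + z)) + (LINT z|lborel. weight q (x - z)) + 2 * (LINT z|lborel. weight q (z::'a))))"
      using iG i1 i2 iw by simp
    also have "\<dots> = C * weight q x" unfolding e1 e2 C_def by (simp add: algebra_simps)
    finally show "(\<integral>\<^sup>+z. ennreal (\<bar>second_diff f x z\<bar> / norm z powr q) \<partial>lborel) \<le> ennreal (C * weight q x)" .
  qed
qed

section \<open>Scaling and symmetry of the nonlocal form\<close>

text \<open>Homogeneity of order \<alpha>: the substitution z = R z' gives R^d from the volume and
  R^(-d-\<alpha>) from the kernel. All smallness as R grows comes from here.\<close>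

lemma nn_integral_second_diff_rescale:
  fixes f :: "'a::euclidean_space \<Rightarrow> real"
  assumes [measurable]: "f \<in> borel_measurable borel" and R: "R > 0"
  shows "(\<integral>\<^sup>+z. ennreal (\<bar>second_diff (\<lambda>x. f (x /\<^sub>R R)) x z\<bar> / norm z powr (real DIM('a) + \<alpha>)) \<partial>lborel)
    = ennreal (R powr (- \<alpha>)) * (\<integral>\<^sup>+z. ennreal (\<bar>second_diff f (x /\<^sub>R R) z\<bar> / norm z powr (real DIM('a) + \<alpha>)) \<partial>lborel)"
proof -
  let ?q = "real DIM('a) + \<alpha>"
  let ?h = "\<lambda>z. ennreal (\<bar>second_diff (\<lambda>x. f (x /\<^sub>R R)) x z\<bar> / norm z powr ?q)"
  have eq: "?h (R *\<^sub>R z) = ennreal (R powr (- ?q)) * ennreal (\<bar>second_diff f (x /\<^sub>R R) z\<bar> / norm z powr ?q)" for z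
  proof -
    have "\<bar>second_diff (\<lambda>x. f (x /\<^sub>R R)) x (R *\<^sub>R z)\<bar> / norm (R *\<^sub>R z) powr ?q
        = R powr (- ?q) * (\<bar>second_diff f (x /\<^sub>R R) z\<bar> / norm z powr ?q)"
      unfolding powr_minus_divide
      using R by (simp add: second_diff_def scaleR_add_right scaleR_diff_right powr_mult)
    then show ?thesis by (simp only: ennreal_mult'[OF powr_ge_zero])
  qed
  have "(\<integral>\<^sup>+z. ?h z \<partial>lborel) = ennreal (\<bar>R\<bar> ^ DIM('a)) * (\<integral>\<^sup>+z. ?h (R *\<^sub>R z) \<partial>lborel)"
    using R by (intro nn_integral_lborel_scaleR) (auto simp: second_diff_def)
  also have "\<dots> = ennreal (\<bar>R\<bar> ^ DIM('a)) * (ennreal (R powr (- ?q)) * (\<integral>\<^sup>+z. ennreal (\<bar>second_diff f (x /\<^sub>R R) z\<bar> / norm z powr ?q) \<partial>lborel))"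
    unfolding eq by (subst nn_integral_cmult) (auto simp: second_diff_def)
  also have "\<dots> = ennreal (R ^ DIM('a) * R powr (- ?q)) * (\<integral>\<^sup>+z. ennreal (\<bar>second_diff f (x /\<^sub>R R) z\<bar> / norm z powr ?q) \<partial>lborel)"
    using R by (simp add: ennreal_mult mult.assoc)
  also have "R ^ DIM('a) * R powr (- ?q) = R powr (- \<alpha>)"
    using R by (simp add: powr_realpow[symmetric] powr_add[symmetric])
  finally show ?thesis .
qed

text \<open>For fixed z, translation invariance moves the second difference from f to \<eta>; two
  applications of Fubini then exchange the operator. Since f is merely bounded, the two double
  integrals converge for different reasons: F because \<eta> is integrable and f is smooth, H
  because the operator applied to \<eta> has the integrable majorant B.\<close>

lemma nonlocal_duality:
  fixes f \<eta> B :: "real^'n \<Rightarrow> real"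
  assumes \<alpha>: "0 < \<alpha>" "\<alpha> < 2" and f: "f \<in> Cb2" and \<eta>: "integrable lborel \<eta>" "\<eta> \<in> borel_measurable borel"
    and B: "integrable lborel B"
    and nn: "\<And>x. (\<integral>\<^sup>+z. ennreal (\<bar>second_diff \<eta> x z\<bar> / norm z powr (real CARD('n) + \<alpha>)) \<partial>lborel) \<le> ennreal (B x)"
    and B0: "\<And>x. 0 \<le> B x"
  shows "integrable lborel (\<lambda>x. \<eta> x * (LINT z|lborel. second_diff f x z / norm z powr (real CARD('n) + \<alpha>)))"
    and "\<bar>LINT x|lborel. \<eta> x * (LINT z|lborel. second_diff f x z / norm z powr (real CARD('n) + \<alpha>))\<bar>
      \<le> (LINT x|lborel. \<bar>f x\<bar> * B x)"
proof -
  let ?q = "real CARD('n) + \<alpha>"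
  let ?k = "\<lambda>z :: real^'n. 1 / norm z powr ?q"
  note [measurable] = \<eta>(2)
  have [measurable]: "f \<in> borel_measurable borel"
    using Cb2_continuous[OF f] by (rule borel_measurable_continuous_onI)
  have [measurable]: "B \<in> borel_measurable borel" using B by auto
  obtain C where C: "C \<ge> 0" "\<And>x z. \<bar>second_diff f x z\<bar> \<le> C * (norm z)\<^sup>2" "\<And>x z. \<bar>second_diff f x z\<bar> \<le> C"
    using Cb2_second_diff_bound[OF f] by blast
  obtain U where U: "\<And>x. \<bar>f x\<bar> \<le> U" using f unfolding Cb2_def bounded_iff by auto
  define F where "F x z = \<eta> x * (second_diff f x z * ?k z)" for x z
  define H where "H x z = f x * (second_diff \<eta> x z * ?k z)" for x z
  have sdm[measurable]: "(\<lambda>p. second_diff f (fst p) (snd p)) \<in> borel_measurable (borel \<Otimes>\<^sub>M borel)"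
    "(\<lambda>p. second_diff \<eta> (fst p) (snd p)) \<in> borel_measurable (borel \<Otimes>\<^sub>M borel)"
    unfolding second_diff_def by measurable
  have F_meas[measurable]: "case_prod F \<in> borel_measurable (lborel \<Otimes>\<^sub>M lborel)"
    unfolding F_def split_beta by measurable
  have H_meas[measurable]: "case_prod H \<in> borel_measurable (lborel \<Otimes>\<^sub>M lborel)"
    unfolding H_def split_beta by measurable
  have Fle: "\<bar>F x z\<bar> \<le> \<bar>\<eta> x\<bar> * (C * kernel_majorant \<alpha> 1 0 z)" for x z
  proof -
    have m: "second_diff f x \<in> borel_measurable borel" unfolding second_diff_def[abs_def] by measurable
    have "\<bar>second_diff f x z / norm z powr (real DIM(real^'n) + \<alpha>)\<bar> \<le> max C C * kernel_majorant \<alpha> 1 0 z"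
      by (rule integrable_kernel_bound(2)[OF \<alpha> m]) (use C in auto)
    then show ?thesis unfolding F_def abs_mult by (intro mult_left_mono) (auto simp: abs_mult)
  qed
  have G: "integrable lborel (kernel_majorant \<alpha> 1 0 :: real^'n \<Rightarrow> real)"
    using \<alpha> by (intro integrable_kernel_majorant) auto
  have intF: "integrable (lborel \<Otimes>\<^sub>M lborel) (case_prod F)"
  proof (rule integrableI_bounded)
    have "(\<integral>\<^sup>+p. ennreal (norm (case_prod F p)) \<partial>(lborel \<Otimes>\<^sub>M lborel))
        = (\<integral>\<^sup>+x. \<integral>\<^sup>+z. ennreal \<bar>F x z\<bar> \<partial>lborel \<partial>lborel)"
      by (subst lborel.nn_integral_fst[symmetric]) auto
    also have "\<dots> \<le> (\<integral>\<^sup>+x. \<integral>\<^sup>+z. ennreal \<bar>\<eta> x\<bar> * ennreal (C * kernel_majorant \<alpha> 1 0 (z::real^'n)) \<partial>lborel \<partial>lborel)"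
      by (intro nn_integral_mono) (subst ennreal_mult[symmetric], auto simp: C kernel_majorant_nonneg intro!: ennreal_leI Fle)
    also have "\<dots> = (\<integral>\<^sup>+x. ennreal \<bar>\<eta> x\<bar> \<partial>lborel) * (\<integral>\<^sup>+z. ennreal (C * kernel_majorant \<alpha> 1 0 (z::real^'n)) \<partial>lborel)"
      by (simp add: nn_integral_cmult nn_integral_multc)
    also have "(\<integral>\<^sup>+x. ennreal \<bar>\<eta> x\<bar> \<partial>lborel) = ennreal (LINT x|lborel. \<bar>\<eta> x\<bar>)"
      using \<eta> by (intro nn_integral_eq_integral) auto
    also have "(\<integral>\<^sup>+z. ennreal (C * kernel_majorant \<alpha> 1 0 (z::real^'n)) \<partial>lborel) = ennreal (LINT z|lborel. C * kernel_majorant \<alpha> 1 0 (z::real^'n))"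
      using G C by (intro nn_integral_eq_integral) (auto simp: kernel_majorant_nonneg)
    finally show "(\<integral>\<^sup>+p. ennreal (norm (case_prod F p)) \<partial>(lborel \<Otimes>\<^sub>M lborel)) < \<infinity>"
      by (simp add: ennreal_mult_less_top order_le_less_trans)
  qed simp
  have Hx: "(\<integral>\<^sup>+z. ennreal \<bar>H x z\<bar> \<partial>lborel) \<le> ennreal (\<bar>f x\<bar> * B x)" for x
  proof -
    have "(\<integral>\<^sup>+z. ennreal \<bar>H x z\<bar> \<partial>lborel) = (\<integral>\<^sup>+z. ennreal \<bar>f x\<bar> * ennreal (\<bar>second_diff \<eta> x z\<bar> / norm z powr ?q) \<partial>lborel)"
      unfolding H_def abs_mult by (intro nn_integral_cong) (simp add: ennreal_mult[symmetric])
    also have "\<dots> = ennreal \<bar>f x\<bar> * (\<integral>\<^sup>+z. ennreal (\<bar>second_diff \<eta> x z\<bar> / norm z powr ?q) \<partial>lborel)"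
      by (rule nn_integral_cmult) (unfold second_diff_def, measurable)
    also have "\<dots> \<le> ennreal \<bar>f x\<bar> * ennreal (B x)" by (intro mult_left_mono nn) simp
    also have "\<dots> = ennreal (\<bar>f x\<bar> * B x)" by (intro ennreal_mult[symmetric] B0) simp
    finally show ?thesis .
  qed
  have ifB: "integrable lborel (\<lambda>x. \<bar>f x\<bar> * B x)"
  proof (rule Bochner_Integration.integrable_bound)
    show "integrable lborel (\<lambda>x. U * B x)" using B by simp
    show "AE x in lborel. norm (\<bar>f x\<bar> * B x) \<le> norm (U * B x)"
    proof (rule AE_I2)
      fix x show "norm (\<bar>f x\<bar> * B x) \<le> norm (U * B x)"
        using U[of x] B0[of x] mult_right_mono[of "\<bar>f x\<bar>" "\<bar>U\<bar>" "B x"] by (simp add: abs_mult)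
    qed
  qed simp
  have intH: "integrable (lborel \<Otimes>\<^sub>M lborel) (case_prod H)"
  proof (rule integrableI_bounded)
    have "(\<integral>\<^sup>+p. ennreal (norm (case_prod H p)) \<partial>(lborel \<Otimes>\<^sub>M lborel))
        = (\<integral>\<^sup>+x. \<integral>\<^sup>+z. ennreal \<bar>H x z\<bar> \<partial>lborel \<partial>lborel)"
      by (subst lborel.nn_integral_fst[symmetric]) auto
    also have "\<dots> \<le> (\<integral>\<^sup>+x. ennreal (\<bar>f x\<bar> * B x) \<partial>lborel)"
      by (intro nn_integral_mono Hx)
    also have "\<dots> = ennreal (LINT x|lborel. \<bar>f x\<bar> * B x)"
      using B0 by (intro nn_integral_eq_integral ifB) auto
    finally show "(\<integral>\<^sup>+p. ennreal (norm (case_prod H p)) \<partial>(lborel \<Otimes>\<^sub>M lborel)) < \<infinity>"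
      by (simp add: order_le_less_trans)
  qed simp
  have swap: "(LINT x|lborel. F x z) = (LINT x|lborel. H x z)" for z
  proof -
    have i0: "integrable lborel (\<lambda>x. \<eta> x * g x)" if [measurable]: "g \<in> borel_measurable borel" and "\<And>x. \<bar>g x\<bar> \<le> U" for g
    proof (rule Bochner_Integration.integrable_bound)
      show "integrable lborel (\<lambda>x. U * \<eta> x)" using \<eta> by simp
      show "AE x in lborel. norm (\<eta> x * g x) \<le> norm (U * \<eta> x)"
      proof (rule AE_I2)
        fix x show "norm (\<eta> x * g x) \<le> norm (U * \<eta> x)"
          using that(2)[of x] mult_right_mono[of "\<bar>g x\<bar>" "\<bar>U\<bar>" "\<bar>\<eta> x\<bar>"] by (simp add: abs_mult mult.commute)
      qed
    qed simp
    have shift: "(LINT x|lborel. \<eta> x * f (x + y)) = (LINT x|lborel. \<eta> (x - y) * f x)"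
      "integrable lborel (\<lambda>x. \<eta> (x - y) * f x)" for y
      using integral_lborel_translate[of "\<lambda>x. \<eta> (x - y) * f x" y] i0[of "\<lambda>x. f (x + y)"] U
      by (simp_all add: add.commute)
    have i: "integrable lborel (\<lambda>x. \<eta> x * f (x + y))" "integrable lborel (\<lambda>x. \<eta> x * f x)"
        for y using i0[of "\<lambda>x. f (x + y)"] i0[of f] U by simp_all
    have "(LINT x|lborel. \<eta> x * second_diff f x z)
        = (LINT x|lborel. \<eta> x * f (x + z) + \<eta> x * f (x + - z) - 2 * (\<eta> x * f x))"
      by (intro Bochner_Integration.integral_cong) (auto simp: second_diff_def algebra_simps)
    also have "\<dots> = (LINT x|lborel. \<eta> (x - z) * f x) + (LINT x|lborel. \<eta> (x - - z) * f x) - 2 * (LINT x|lborel. \<eta> x * f x)"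
      using i i(1)[of "- z"] shift(1)[of z] shift(1)[of "- z"] by simp
    also have "\<dots> = (LINT x|lborel. \<eta> (x - z) * f x + \<eta> (x - - z) * f x - 2 * (\<eta> x * f x))"
      using i shift(2)[of z] shift(2)[of "- z"] by simp
    also have "\<dots> = (LINT x|lborel. f x * second_diff \<eta> x z)"
      by (intro Bochner_Integration.integral_cong) (auto simp: second_diff_def algebra_simps)
    finally have "(LINT x|lborel. (\<eta> x * second_diff f x z) * ?k z) = (LINT x|lborel. (f x * second_diff \<eta> x z) * ?k z)"
      by (simp only: integral_mult_left_zero)
    then show ?thesis by (simp add: F_def H_def mult.assoc)
  qed
  have eqF: "\<eta> x * (LINT z|lborel. second_diff f x z / norm z powr ?q) = (LINT z|lborel. F x z)" for x
    unfolding F_def integral_mult_right_zero by simp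
  show "integrable lborel (\<lambda>x. \<eta> x * (LINT z|lborel. second_diff f x z / norm z powr ?q))"
    unfolding eqF using lborel_pair.integrable_fst[OF intF] by simp
  have "(LINT x|lborel. LINT z|lborel. F x z) = (LINT z|lborel. LINT x|lborel. F x z)"
    using lborel_pair.Fubini_integral[OF intF] by simp
  also have "\<dots> = (LINT z|lborel. LINT x|lborel. H x z)" by (simp only: swap)
  also have "\<dots> = (LINT x|lborel. LINT z|lborel. H x z)"
    using lborel_pair.Fubini_integral[OF intH] by simp
  finally have "\<bar>LINT x|lborel. \<eta> x * (LINT z|lborel. second_diff f x z / norm z powr ?q)\<bar>
      = \<bar>LINT x|lborel. LINT z|lborel. H x z\<bar>" unfolding eqF by simp
  also have "\<dots> \<le> (LINT x|lborel. \<bar>LINT z|lborel. H x z\<bar>)"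
    by (rule integral_abs_bound)
  also have "\<dots> \<le> (LINT x|lborel. \<bar>f x\<bar> * B x)"
  proof (rule integral_mono)
    show "integrable lborel (\<lambda>x. \<bar>LINT z|lborel. H x z\<bar>)"
      using lborel_pair.integrable_fst[OF intH] by simp
    fix x
    \<comment> \<open>If \<open>H x\<close> fails to be integrable its integral is 0 by convention,
      so the bound holds for every x.\<close>
    have "ennreal \<bar>LINT z|lborel. H x z\<bar> \<le> (\<integral>\<^sup>+z. ennreal \<bar>H x z\<bar> \<partial>lborel)"
      using integral_norm_bound_ennreal[of lborel "H x"]
      by (cases "integrable lborel (H x)") (auto simp: not_integrable_integral_eq)
    also have "\<dots> \<le> ennreal (\<bar>f x\<bar> * B x)" by (rule Hx)
    finally show "\<bar>LINT z|lborel. H x z\<bar> \<le> \<bar>f x\<bar> * B x"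
      using B0[of x] by (subst (asm) ennreal_le_iff) auto
  qed (rule ifB)
  finally show "\<bar>LINT x|lborel. \<eta> x * (LINT z|lborel. second_diff f x z / norm z powr ?q)\<bar>
      \<le> (LINT x|lborel. \<bar>f x\<bar> * B x)" .
qed

lemma integrable_rescaled_weight:
  assumes "q > real DIM('a)" "R > 0"
  shows "integrable lborel (\<lambda>x::'a::euclidean_space. weight q (x /\<^sub>R R))"
proof (rule integrableI_nonneg)
  have "(\<integral>\<^sup>+x. ennreal (weight q ((x::'a) /\<^sub>R R)) \<partial>lborel) = ennreal (\<bar>R\<bar> ^ DIM('a)) * (\<integral>\<^sup>+x. ennreal (weight q ((R *\<^sub>R (x::'a)) /\<^sub>R R)) \<partial>lborel)"
    using assms by (intro nn_integral_lborel_scaleR) auto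
  also have "\<dots> = ennreal (\<bar>R\<bar> ^ DIM('a)) * (\<integral>\<^sup>+x. ennreal (weight q (x::'a)) \<partial>lborel)"
    using assms by simp
  also have "\<dots> < \<infinity>"
    using integrable_weight[OF assms(1)] by (simp add: integrable_iff_bounded ennreal_mult_less_top less_imp_le[OF weight_pos])
  finally show "(\<integral>\<^sup>+x. ennreal (weight q ((x::'a) /\<^sub>R R)) \<partial>lborel) < \<infinity>" .
qed (auto simp: less_imp_le[OF weight_pos])

lemma integrable_cutoff:
  assumes "q > real DIM('a)" "R > 0" "\<epsilon> \<ge> 0"
  shows "integrable lborel (\<lambda>x::'a::euclidean_space. cutoff q \<epsilon> (x /\<^sub>R R))"
  by (rule Bochner_Integration.integrable_bound[OF integrable_rescaled_weight[OF assms(1,2)]])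
    (auto simp: cutoff_nonneg less_imp_le[OF weight_pos] cutoff_le_weight assms(3))

text \<open>C is fixed before f, R and \<epsilon>, so that \<epsilon> -> 0 and R -> \<infinity> can
  be taken afterwards.\<close>

lemma cutoff_pairing:
  assumes \<alpha>: "0 < \<alpha>" "\<alpha> < 2"
  defines "q \<equiv> real CARD('n::finite) + \<alpha>"
  obtains C where "C \<ge> 0" and
    "\<And>(f :: real^'n \<Rightarrow> real) R \<epsilon>. f \<in> Cb2 \<Longrightarrow> R > 0 \<Longrightarrow> 0 < \<epsilon> \<Longrightarrow> \<epsilon> \<le> 1 \<Longrightarrow>
       integrable lborel (\<lambda>x. cutoff q \<epsilon> (x /\<^sub>R R) * (LINT z|lborel. second_diff f x z / norm z powr q)) \<and>
       \<bar>LINT x|lborel. cutoff q \<epsilon> (x /\<^sub>R R) * (LINT z|lborel. second_diff f x z / norm z powr q)\<bar>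
         \<le> C * R powr (- \<alpha>) * (LINT x|lborel. \<bar>f x\<bar> * weight q (x /\<^sub>R R))"
proof -
  have q: "q > real DIM(real^'n)" "q \<ge> 0" using \<alpha> by (auto simp: q_def)
  have qD: "q = real DIM(real^'n) + \<alpha>" by (simp add: q_def)
  define A where "A = 2 * (2 * q\<^sup>2 + 20 * q + 40) * 3 powr (q/2)"
  have A: "A \<ge> 0" using q by (simp add: A_def)
  obtain C where C: "C \<ge> 0" and nn: "\<And>(f :: real^'n \<Rightarrow> real) x. f \<in> borel_measurable borel \<Longrightarrow> (\<And>x. 0 \<le> f x) \<Longrightarrow> (\<And>x. f x \<le> weight q x) \<Longrightarrow>
       (\<And>x z. norm z \<le> 1 \<Longrightarrow> \<bar>second_diff f x z\<bar> \<le> A * (norm z)\<^sup>2 * weight q x) \<Longrightarrow>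
       (\<integral>\<^sup>+z. ennreal (\<bar>second_diff f x z\<bar> / norm z powr q) \<partial>lborel) \<le> ennreal (C * weight q x)"
    using nn_integral_second_diff_le[OF \<alpha> A, where 'a="real^'n", folded qD] by blast
  show ?thesis
  proof (rule that[OF C])
    fix f :: "real^'n \<Rightarrow> real" and R \<epsilon> :: real
    assume f: "f \<in> Cb2" and R: "R > 0" and \<epsilon>: "0 < \<epsilon>" "\<epsilon> \<le> 1"
    let ?B = "\<lambda>x :: real^'n. C * R powr (- \<alpha>) * weight q (x /\<^sub>R R)"
    have bound: "(\<integral>\<^sup>+z. ennreal (\<bar>second_diff (\<lambda>x::real^'n. cutoff q \<epsilon> (x /\<^sub>R R)) x z\<bar> / norm z powr (real CARD('n) + \<alpha>)) \<partial>lborel) \<le> ennreal (?B x)" for x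
    proof -
      have "(\<integral>\<^sup>+z. ennreal (\<bar>second_diff (\<lambda>x::real^'n. cutoff q \<epsilon> (x /\<^sub>R R)) x z\<bar> / norm z powr (real DIM(real^'n) + \<alpha>)) \<partial>lborel)
          = ennreal (R powr (- \<alpha>)) * (\<integral>\<^sup>+z. ennreal (\<bar>second_diff (cutoff q \<epsilon>) (x /\<^sub>R R) z\<bar> / norm z powr (real DIM(real^'n) + \<alpha>)) \<partial>lborel)"
        by (rule nn_integral_second_diff_rescale[OF _ R]) measurable
      also have "\<dots> \<le> ennreal (R powr (- \<alpha>)) * ennreal (C * weight q (x /\<^sub>R R))"
      proof (intro mult_left_mono)
        have "(\<integral>\<^sup>+z. ennreal (\<bar>second_diff (cutoff q \<epsilon>) (x /\<^sub>R R) z\<bar> / norm z powr q) \<partial>lborel) \<le> ennreal (C * weight q (x /\<^sub>R R))"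
          by (intro nn cutoff_nonneg cutoff_le_weight)
            (use \<epsilon> q cutoff_second_diff_le[OF q(2) \<epsilon>] in \<open>auto simp: A_def\<close>)
        then show "(\<integral>\<^sup>+z. ennreal (\<bar>second_diff (cutoff q \<epsilon>) (x /\<^sub>R R) z\<bar> / norm z powr (real DIM(real^'n) + \<alpha>)) \<partial>lborel) \<le> ennreal (C * weight q (x /\<^sub>R R))"
          by (simp add: q_def)
      qed simp
      also have "\<dots> = ennreal (?B x)"
        using C by (subst ennreal_mult[symmetric]) (auto simp: less_imp_le[OF weight_pos] mult_ac)
      finally show ?thesis by simp
    qed
    have iB: "integrable lborel ?B" using integrable_rescaled_weight[OF q(1) R] by simp
    have B0: "0 \<le> ?B x" for x using C by (simp add: less_imp_le[OF weight_pos])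
    have m: "(\<lambda>x::real^'n. cutoff q \<epsilon> (x /\<^sub>R R)) \<in> borel_measurable borel" by measurable
    have i: "integrable lborel (\<lambda>x::real^'n. cutoff q \<epsilon> (x /\<^sub>R R))"
      using \<epsilon> by (intro integrable_cutoff[OF q(1) R]) auto
    note dual = nonlocal_duality[OF \<alpha> f i m iB bound B0]
    have "(LINT x|lborel. \<bar>f x\<bar> * ?B x) = (LINT x|lborel. C * R powr (- \<alpha>) * (\<bar>f x\<bar> * weight q (x /\<^sub>R R)))"
      by (intro Bochner_Integration.integral_cong) (auto simp: mult_ac)
    also have "\<dots> = C * R powr (- \<alpha>) * (LINT x|lborel. \<bar>f x\<bar> * weight q (x /\<^sub>R R))" by simp
    finally show "integrable lborel (\<lambda>x. cutoff q \<epsilon> (x /\<^sub>R R) * (LINT z|lborel. second_diff f x z / norm z powr q)) \<and>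
       \<bar>LINT x|lborel. cutoff q \<epsilon> (x /\<^sub>R R) * (LINT z|lborel. second_diff f x z / norm z powr q)\<bar>
         \<le> C * R powr (- \<alpha>) * (LINT x|lborel. \<bar>f x\<bar> * weight q (x /\<^sub>R R))"
      using dual unfolding q_def by auto
  qed
qed

section \<open>Bounded classical solutions\<close>

lemma Cb2_cmult:
  fixes f :: "real^'n \<Rightarrow> real"
  assumes "f \<in> Cb2"
  shows "(\<lambda>x. a * f x) \<in> Cb2"
proof -
  from assms obtain f' :: "real^'n \<Rightarrow> (real^'n) \<Rightarrow>\<^sub>L real"
    and f'' :: "real^'n \<Rightarrow> (real^'n) \<Rightarrow>\<^sub>L (real^'n) \<Rightarrow>\<^sub>L real"
    where b: "bounded (range f)" and f': "\<And>x. (f has_derivative blinfun_apply (f' x)) (at x)"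
      and f'': "\<And>x. (f' has_derivative blinfun_apply (f'' x)) (at x)"
      and c: "continuous_on UNIV f''" and b': "bounded (range f')" and b'': "bounded (range f'')"
    unfolding Cb2_def by auto
  have bdd: "bounded (range (\<lambda>x. a *\<^sub>R g x))" if "bounded (range g)" for g :: "real^'n \<Rightarrow> 'b::real_normed_vector"
    using bounded_scaling[OF that, of a] by (simp add: image_image)
  have 1: "((\<lambda>x. a * f x) has_derivative blinfun_apply (a *\<^sub>R f' x)) (at x)" for x
    using has_derivative_mult_right[OF f'[of x], of a] by (simp add: blinfun.scaleR_left[abs_def])
  have 2: "((\<lambda>x. a *\<^sub>R f' x) has_derivative blinfun_apply (a *\<^sub>R f'' x)) (at x)" for x
    using has_derivative_scaleR_right[OF f''[of x], of a] by (simp add: blinfun.scaleR_left[abs_def])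
  have "bounded (range (\<lambda>x. a * f x))" using bdd[OF b] by simp
  moreover have "continuous_on UNIV (\<lambda>x. a *\<^sub>R f'' x)" using c by (intro continuous_intros)
  ultimately show ?thesis
    unfolding Cb2_def mem_Collect_eq
    by (intro conjI exI[of _ "\<lambda>x. a *\<^sub>R f' x"] exI[of _ "\<lambda>x. a *\<^sub>R f'' x"] allI
        1 2 bdd[OF b'] bdd[OF b'']) assumption+
qed

lemma second_diff_cmult: "second_diff (\<lambda>x. a * f x) x z = a * second_diff f x z"
  by (simp add: second_diff_def algebra_simps)

lemma indefinite_integral_nonneg:
  fixes g :: "real \<Rightarrow> real"
  assumes "continuous_on {0..} g" "\<And>t. t \<ge> 0 \<Longrightarrow> g t \<ge> 0"
  defines "G \<equiv> \<lambda>t. integral {0..t} g"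
  shows "G 0 = 0" "continuous_on {0..} G" "\<And>s t. 0 \<le> s \<Longrightarrow> s \<le> t \<Longrightarrow> G s \<le> G t"
    "\<And>t. t > 0 \<Longrightarrow> (G has_real_derivative g t) (at t)"
proof -
  have cont: "continuous_on {0..T} g" for T by (rule continuous_on_subset[OF assms(1)]) auto
  show "G 0 = 0" by (simp add: G_def)
  show der: "(G has_real_derivative g t) (at t)" if "t > 0" for t
  proof -
    have "(G has_real_derivative g t) (at t within {0..t+1})"
      unfolding G_def by (rule integral_has_real_derivative[OF cont]) (use that in auto)
    then show ?thesis using that by (simp add: at_within_Icc_at)
  qed
  have contG: "continuous_on {0..T} G" for T
    unfolding G_def by (rule indefinite_integral_continuous_1) (rule integrable_continuous_real[OF cont])
  show "continuous_on {0..} G"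
    unfolding continuous_on_eq_continuous_within
  proof
    fix t :: real assume t: "t \<in> {0..}"
    show "continuous (at t within {0..}) G"
    proof (cases "t = 0")
      case True
      have "continuous (at 0 within {0..1}) G"
        by (rule bspec[OF contG[of 1, unfolded continuous_on_eq_continuous_within]]) simp
      moreover have "at 0 within {0..1} = at (0::real) within {0..}"
        by (rule at_within_nhd[of _ "{..<1}"]) auto
      ultimately show ?thesis using True by (simp only:)
    next
      case False
      then have "t > 0" using t by simp
      from DERIV_isCont[OF der[OF this]] show ?thesis by (rule continuous_at_imp_continuous_at_within)
    qed
  qed
  show "G s \<le> G t" if "0 \<le> s" "s \<le> t" for s t
  proof -
    have i: "g integrable_on {0..T}" for T by (rule integrable_continuous_real[OF cont])
    show ?thesis
      unfolding G_def by (rule integral_subset_le[OF _ i i]) (use that assms(2) in auto)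
  qed
qed

section \<open>The solution, its sign and its constants\<close>

locale nonneg_data =
  fixes \<alpha> \<beta> r :: real and h k :: "real \<Rightarrow> real" and u0 :: "real^'n \<Rightarrow> real" and u :: "real \<Rightarrow> real^'n \<Rightarrow> real"
  assumes alpha: "0 < \<alpha>" "\<alpha> < 2" and beta: "\<beta> > 1" and r: "r > 0"
    and h_cont: "continuous_on {0..} h" and h_nonneg: "\<And>t. t \<ge> 0 \<Longrightarrow> h t \<ge> 0"
    and k_cont: "continuous_on {0..} k" and k_nonneg: "\<And>t. t \<ge> 0 \<Longrightarrow> k t \<ge> 0"
    and u0_int: "integrable lborel u0" and u0_nonneg: "\<And>x. u0 x \<ge> 0"
    and mass_pos: "(LINT x|lborel. u0 x) > 0"
    and sol: "classical_solution r \<alpha> k h (\<lambda>y. \<bar>y\<bar> powr \<beta>) u0 u"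
begin

definition "q = real CARD('n) + \<alpha>"
text \<open>The factor 1/2 is the one produced by symmetrizing the operator into second
  differences.\<close>

definition "c0 = frac_const TYPE('n) \<alpha> / 2"
definition "lap t x = (LINT z|lborel. second_diff (u t) x z / norm z powr q)"
definition "m0 = (LINT x|lborel. u0 x)"
definition "K t = integral {0..t} k"

lemma m0_pos: "m0 > 0" using mass_pos by (simp add: m0_def)

lemma c0_pos: "c0 > 0"
  using frac_const_pos[OF alpha, where 'n='n] by (simp add: c0_def)

lemma q_gt: "q > real DIM(real^'n)" "q \<ge> 0"
  using alpha by (auto simp: q_def)

lemma K_props: "K 0 = 0" "continuous_on {0..} K" "0 \<le> s \<Longrightarrow> s \<le> t \<Longrightarrow> K s \<le> K t"
  "t > 0 \<Longrightarrow> (K has_real_derivative k t) (at t)"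
proof -
  note * = indefinite_integral_nonneg[OF k_cont k_nonneg, folded K_def]
  show "K 0 = 0" by (rule *(1))
  show "continuous_on {0..} K" by (rule *(2))
  show "0 \<le> s \<Longrightarrow> s \<le> t \<Longrightarrow> K s \<le> K t" by (rule *(3))
  show "t > 0 \<Longrightarrow> (K has_real_derivative k t) (at t)" by (rule *(4))
qed

lemma K_nonneg: "t \<ge> 0 \<Longrightarrow> K t \<ge> 0"
  using K_props(1) K_props(3)[of 0 t] by simp

lemma u_bounded: "\<exists>U>0. \<forall>t\<ge>0. \<forall>x. \<bar>u t x\<bar> \<le> U"
proof -
  have "bounded ((\<lambda>(t, x). u t x) ` ({0..} \<times> UNIV))"
    using sol unfolding classical_solution_def by blast
  then obtain B where B: "\<forall>y\<in>(\<lambda>(t, x). u t x) ` ({0..} \<times> UNIV). norm y \<le> B"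
    unfolding bounded_iff ..
  have "\<bar>u t x\<bar> \<le> \<bar>B\<bar> + 1" if "t \<ge> 0" for t x
  proof -
    have "(t, x) \<in> {0..} \<times> UNIV" using that by simp
    from bspec[OF B imageI[OF this]] show ?thesis by simp
  qed
  then show ?thesis by (intro exI[of _ "\<bar>B\<bar> + 1"]) simp
qed

definition "U = (SOME U. U > 0 \<and> (\<forall>t\<ge>0. \<forall>x. \<bar>u t x\<bar> \<le> U))"

lemma U: "U > 0" "t \<ge> 0 \<Longrightarrow> \<bar>u t x\<bar> \<le> U"
  using someI_ex[OF u_bounded] unfolding U_def by blast+

lemma u_cont: "continuous_on ({0..} \<times> UNIV) (\<lambda>(t, x). u t x)"
  and u_init: "u 0 = u0"
  and u_Cb2: "t > 0 \<Longrightarrow> u t \<in> Cb2"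
  and deriv_cont: "continuous_on ({0<..} \<times> UNIV) (\<lambda>(t, x). deriv (\<lambda>s. u s x) t)"
  using sol unfolding classical_solution_def by blast+

lemma deriv_eq: "t > 0 \<Longrightarrow> deriv (\<lambda>s. u s x) t = k t * c0 * lap t x - h t * \<bar>u t x\<bar> powr \<beta>"
proof -
  assume t: "t > 0"
  have "deriv (\<lambda>s. u s x) t = k t * frac_laplacian r \<alpha> (u t) x - h t * \<bar>u t x\<bar> powr \<beta>"
    using sol t unfolding classical_solution_def by blast
  also have "frac_laplacian r \<alpha> (u t) x = c0 * lap t x"
    using frac_laplacian_eq_second_diff[OF alpha r u_Cb2[OF t]] by (simp add: c0_def lap_def q_def)
  finally show ?thesis by simp
qed

lemma u_has_deriv: "t > 0 \<Longrightarrow> ((\<lambda>s. u s x) has_real_derivative deriv (\<lambda>s. u s x) t) (at t)"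
proof -
  assume t: "t > 0"
  have "(\<lambda>s. u s x) differentiable (at t)"
    using sol t unfolding classical_solution_def by blast
  then show ?thesis by (simp add: DERIV_deriv_iff_real_differentiable)
qed

lemma u_cont_x: assumes "t \<ge> 0" shows "continuous_on UNIV (u t)"
proof -
  have "continuous_on UNIV (\<lambda>x :: real^'n. (t, x))" by (intro continuous_intros)
  then show ?thesis using continuous_on_compose2[OF u_cont, of UNIV "\<lambda>x. (t, x)"] assms by auto
qed

lemma u_meas: "t \<ge> 0 \<Longrightarrow> u t \<in> borel_measurable borel"
  by (intro borel_measurable_continuous_onI u_cont_x)

lemma bounded_on_interval:
  assumes "continuous_on {0..} g"
  obtains B where "B \<ge> 0" "\<And>t::real. t \<in> {0..T} \<Longrightarrow> g t \<le> (B::real)"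
proof -
  have "compact (g ` {0..T})"
    by (intro compact_continuous_image continuous_on_subset[OF assms]) auto
  then have "bounded (g ` {0..T})" by (rule compact_imp_bounded)
  then obtain B where B0: "\<forall>y\<in>g ` {0..T}. norm y \<le> B" unfolding bounded_iff ..
  have B: "\<bar>g t\<bar> \<le> B" if "t \<in> {0..T}" for t using bspec[OF B0 imageI[OF that]] by simp
  show ?thesis
  proof (rule that[of "\<bar>B\<bar>"])
    show "g t \<le> \<bar>B\<bar>" if "t \<in> {0..T}" for t using B[OF that] by linarith
  qed simp
qed

text \<open>The reaction is nonpositive also where u < 0 and pushes u further down, so the sign is
  not immediate. As u is bounded, however, the reaction is at most L |u| in size, and the factor exp
  (-L s) compensates for it. At a penalized maximum of v = -exp (-L s) u the time derivative is then
  at most \<epsilon> k1 c0 C from diffusion alone, but at least \<epsilon> (k1 c0 C + 1).\<close>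

lemma u_nonneg: assumes "t \<ge> 0" shows "u t x \<ge> 0"
proof (rule ccontr)
  assume neg: "\<not> u t x \<ge> 0"
  obtain H where H: "H \<ge> 0" "\<And>s. s \<in> {0..t} \<Longrightarrow> h s \<le> H" using bounded_on_interval[OF h_cont] by blast
  obtain k1 where k1: "k1 \<ge> 0" "\<And>s. s \<in> {0..t} \<Longrightarrow> k s \<le> k1" using bounded_on_interval[OF k_cont] by blast
  obtain C where C: "C \<ge> 0" and
    Cmax: "\<And>(f :: real^'n \<Rightarrow> real) x0 \<epsilon> A a. f \<in> Cb2 \<Longrightarrow> \<epsilon> \<ge> 0 \<Longrightarrow>
       (\<And>x. f x - \<epsilon> * barrier x \<le> f x0 - \<epsilon> * barrier x0) \<Longrightarrow>
       A \<in> sets borel \<Longrightarrow> (\<And>z. z \<in> A \<Longrightarrow> 1 \<le> norm z \<and> f (x0 + z) \<le> f x0 - a) \<Longrightarrow> a \<ge> 0 \<Longrightarrow>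
       (LINT z|lborel. second_diff f x0 z / norm z powr (real CARD('n) + \<alpha>))
         \<le> \<epsilon> * C - a * (LINT z|lborel. indicator A z / norm z powr (real CARD('n) + \<alpha>)) \<and>
       integrable lborel (\<lambda>z. indicator A z / norm z powr (real CARD('n) + \<alpha>))"
    using second_diff_integral_at_max[OF alpha zero_less_one, where 'n='n] by blast
  define L where "L = H * U powr (\<beta> - 1)"
  have L: "L \<ge> 0" using H by (simp add: L_def)
  define v where "v s y = - exp (- L * s) * u s y" for s y
  have "continuous_on ({0..t} \<times> UNIV) (\<lambda>p. - exp (- L * fst p) * (case p of (s, y) \<Rightarrow> u s y))"
    by (intro continuous_intros continuous_on_subset[OF u_cont]) auto
  then have v_cont: "continuous_on ({0..t} \<times> UNIV) (\<lambda>(s, y). v s y)"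
    by (simp add: v_def split_beta)
  have v_le: "v s y \<le> U" if "s \<in> {0..t}" for s y
  proof -
    have "v s y \<le> exp (- L * s) * \<bar>u s y\<bar>" unfolding v_def by (simp add: abs_if)
    also have "\<dots> \<le> 1 * U" using that U L by (intro mult_mono) auto
    finally show ?thesis by simp
  qed
  have v0: "v 0 y \<le> 0" for y using u0_nonneg[of y] by (simp add: v_def u_init)
  have vp: "v t x > 0" using neg by (simp add: v_def mult_less_0_iff)
  have c: "k1 * c0 * C + 1 \<ge> 0" using k1 c0_pos C by (simp add: add_nonneg_nonneg)
  obtain \<epsilon> t0 x0 where e: "\<epsilon> > 0" "0 < t0" "t0 \<le> t" "v t0 x0 > 0"
    "\<And>y. v t0 y - \<epsilon> * barrier y \<le> v t0 x0 - \<epsilon> * barrier x0"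
    "\<And>D. ((\<lambda>s. v s x0) has_real_derivative D) (at t0) \<Longrightarrow> D \<ge> \<epsilon> * (k1 * c0 * C + 1)"
    using penalized_maximum[OF v_cont v_le v0 _ vp c] assms by auto
  define a where "a = - exp (- L * t0)"
  have fa: "v t0 = (\<lambda>y. a * u t0 y)" by (simp add: v_def a_def fun_eq_iff)
  have un: "u t0 x0 < 0" using e(4) by (simp add: v_def mult_less_0_iff)
  \<comment> \<open>With A empty and a = 0 the estimate at a maximum reduces to the plain maximum
    principle up to O(\<epsilon>).\<close>
  have "(LINT z|lborel. second_diff (v t0) x0 z / norm z powr (real CARD('n) + \<alpha>)) \<le> \<epsilon> * C"
    using Cmax[of "v t0" \<epsilon> x0 "{}" 0] e(1,5) Cb2_cmult[OF u_Cb2[OF e(2)], of a] by (simp add: fa)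
  moreover have "(LINT z|lborel. second_diff (v t0) x0 z / norm z powr (real CARD('n) + \<alpha>)) = a * lap t0 x0"
    unfolding fa second_diff_cmult lap_def q_def integral_mult_right_zero[symmetric] by simp
  ultimately have lapv: "a * lap t0 x0 \<le> \<epsilon> * C" by simp
  have D: "((\<lambda>s. v s x0) has_real_derivative
      (L * exp (- L * t0) * u t0 x0 + a * deriv (\<lambda>s. u s x0) t0)) (at t0)"
    unfolding v_def a_def using e(2) by (auto intro!: derivative_eq_intros u_has_deriv)
  have up: "\<bar>u t0 x0\<bar> powr \<beta> \<le> U powr (\<beta> - 1) * \<bar>u t0 x0\<bar>"
  proof -
    have "\<bar>u t0 x0\<bar> powr \<beta> = \<bar>u t0 x0\<bar> powr (\<beta> - 1) * \<bar>u t0 x0\<bar>"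
      using un powr_add[of "\<bar>u t0 x0\<bar>" "\<beta> - 1" 1] by simp
    also have "\<dots> \<le> U powr (\<beta> - 1) * \<bar>u t0 x0\<bar>"
      using U(2)[of t0 x0] e(2) beta by (intro mult_right_mono powr_mono2) auto
    finally show ?thesis .
  qed
  have "h t0 * \<bar>u t0 x0\<bar> powr \<beta> \<le> H * (U powr (\<beta> - 1) * \<bar>u t0 x0\<bar>)"
    using H e up h_nonneg by (intro mult_mono) auto
  then have hu: "h t0 * \<bar>u t0 x0\<bar> powr \<beta> \<le> - L * u t0 x0"
    using un by (simp add: L_def)
  have "L * exp (- L * t0) * u t0 x0 + a * deriv (\<lambda>s. u s x0) t0
      = k t0 * c0 * (a * lap t0 x0) + exp (- L * t0) * (L * u t0 x0 + h t0 * \<bar>u t0 x0\<bar> powr \<beta>)"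
    unfolding deriv_eq[OF e(2)] a_def by (simp add: algebra_simps)
  also have "\<dots> \<le> k t0 * c0 * (\<epsilon> * C) + exp (- L * t0) * 0"
    using lapv hu k_nonneg[of t0] c0_pos e(2) by (intro add_mono mult_left_mono mult_nonneg_nonneg) auto
  also have "\<dots> \<le> k1 * c0 * (\<epsilon> * C)"
    using k1 e c0_pos C by (auto intro!: mult_right_mono)
  finally have "L * exp (- L * t0) * u t0 x0 + a * deriv (\<lambda>s. u s x0) t0 \<le> \<epsilon> * (k1 * c0 * C)"
    by (simp add: mult_ac)
  with e(6)[OF D] e(1) show False by (simp add: algebra_simps)
qed

section \<open>Masses against rescaled weights\<close>

definition "test R \<epsilon> x = cutoff q \<epsilon> (x /\<^sub>R R)" for x :: "real^'n"
definition "wt R x = weight q (x /\<^sub>R R)" for x :: "real^'n"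

lemma test_meas [measurable]: "test R \<epsilon> \<in> borel_measurable borel"
  unfolding test_def[abs_def] by measurable

lemma wt_meas [measurable]: "wt R \<in> borel_measurable borel"
  unfolding wt_def[abs_def] by measurable

lemma test_bounds: "0 \<le> test R \<epsilon> x" "\<epsilon> \<ge> 0 \<Longrightarrow> test R \<epsilon> x \<le> wt R x" "0 \<le> wt R x" "wt R x \<le> 1"
  using q_gt by (auto simp: test_def wt_def cutoff_nonneg cutoff_le_weight weight_le_one less_imp_le[OF weight_pos])

lemma wt_int: "R > 0 \<Longrightarrow> integrable lborel (wt R)"
  unfolding wt_def[abs_def] by (intro integrable_rescaled_weight q_gt)

lemma integrable_mult_dominated:
  assumes "integrable lborel (w :: real^'n \<Rightarrow> real)" and [measurable]: "g \<in> borel_measurable borel" "\<eta> \<in> borel_measurable borel"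
    and "\<And>x. 0 \<le> \<eta> x" "\<And>x. \<eta> x \<le> w x" "\<And>x. \<bar>g x\<bar> \<le> B"
  shows "integrable lborel (\<lambda>x. g x * \<eta> x)"
proof (rule Bochner_Integration.integrable_bound)
  show "integrable lborel (\<lambda>x. B * w x)" using assms(1) by simp
  show "AE x in lborel. norm (g x * \<eta> x) \<le> norm (B * w x)"
  proof (rule AE_I2)
    fix x
    have "\<bar>g x\<bar> * \<eta> x \<le> B * w x"
      using assms(4-6) order.trans[OF abs_ge_zero assms(6)] by (intro mult_mono) auto
    then show "norm (g x * \<eta> x) \<le> norm (B * w x)" using assms(4)[of x] abs_ge_self[of "B * w x"]
      by (simp add: abs_mult)
  qed
qed simp

lemma u_wt_int: assumes "t \<ge> 0" "R > 0" shows "integrable lborel (\<lambda>x. u t x * wt R x)"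
proof -
  show ?thesis
    by (rule integrable_mult_dominated[OF wt_int[OF assms(2)] u_meas[OF assms(1)] wt_meas])
      (use U(2)[OF assms(1)] in \<open>auto simp: test_bounds\<close>)
qed

lemma u_test_int: assumes "t \<ge> 0" "R > 0" "\<epsilon> \<ge> 0" shows "integrable lborel (\<lambda>x. u t x * test R \<epsilon> x)"
proof -
  show ?thesis
    by (rule integrable_mult_dominated[OF wt_int[OF assms(2)] u_meas[OF assms(1)] test_meas])
      (use U(2)[OF assms(1)] assms(3) in \<open>auto simp: test_bounds\<close>)
qed

lemma powr_test_int: "t \<ge> 0 \<Longrightarrow> R > 0 \<Longrightarrow> \<epsilon> \<ge> 0 \<Longrightarrow> integrable lborel (\<lambda>x. \<bar>u t x\<bar> powr \<beta> * test R \<epsilon> x)"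
proof -
  assume t: "t \<ge> 0" and R: "R > 0" and \<epsilon>: "\<epsilon> \<ge> 0"
  note [measurable] = u_meas[OF t]
  show ?thesis
    by (rule integrable_mult_dominated[OF wt_int[OF R], where B = "U powr \<beta>"])
      (use U(2)[OF t] beta \<epsilon> in \<open>auto simp: test_bounds intro!: powr_mono2\<close>)
qed

lemma test_support: assumes "R > 0" "\<epsilon> > 0" obtains a b where "\<And>x. x \<notin> cbox a b \<Longrightarrow> test R \<epsilon> x = 0"
proof -
  have z: "test R \<epsilon> x = 0" if "norm x > R / sqrt \<epsilon>" for x
  proof -
    have "1 / sqrt \<epsilon> < norm (x /\<^sub>R R)" using that assms by (simp add: field_simps)
    then have "(1 / sqrt \<epsilon>)\<^sup>2 \<le> (norm (x /\<^sub>R R))\<^sup>2" using assms by (intro power_mono) auto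
    then have "1 \<le> \<epsilon> * (norm (x /\<^sub>R R))\<^sup>2" using assms by (simp add: power_divide field_simps)
    then have "1 - \<epsilon> * (1 + (norm (x /\<^sub>R R))\<^sup>2) \<le> 0" using assms by (simp add: algebra_simps)
    then show ?thesis unfolding test_def cutoff_def by simp
  qed
  obtain a where "cball 0 (R / sqrt \<epsilon>) \<subseteq> cbox (-a) (a::real^'n)"
    using bounded_subset_cbox_symmetric[of "cball (0::real^'n) (R / sqrt \<epsilon>)"] bounded_cball by blast
  then show ?thesis using z by (intro that[of "-a" a]) force
qed

lemma test_cont: "continuous_on S (test R \<epsilon>)"
  unfolding test_def[abs_def]
  by (rule continuous_on_compose2[OF continuous_on_cutoff]) (auto intro!: continuous_intros)

text \<open>Passing to a fixed box makes the rules for parameter integrals over compact sets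
  available: continuity and the Leibniz rule then ask for joint continuity instead of an integrable
  majorant.\<close>

lemma mass_eq_cbox:
  assumes "integrable lborel (\<lambda>x. g x * test R \<epsilon> x)" "\<And>x. x \<notin> cbox a b \<Longrightarrow> test R \<epsilon> x = 0"
  shows "(LINT x|lborel. g x * test R \<epsilon> x) = integral (cbox a b) (\<lambda>x. g x * test R \<epsilon> x)"
proof -
  have "(LINT x|lborel. g x * test R \<epsilon> x) = integral UNIV (\<lambda>x. g x * test R \<epsilon> x)"
    using integral_lborel[OF assms(1)] by simp
  also have "\<dots> = integral UNIV (\<lambda>x. if x \<in> cbox a b then g x * test R \<epsilon> x else 0)"
    using assms(2) by (intro Henstock_Kurzweil_Integration.integral_cong) auto
  also have "\<dots> = integral (cbox a b) (\<lambda>x. g x * test R \<epsilon> x)"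
    by (rule Henstock_Kurzweil_Integration.integral_restrict_UNIV)
  finally show ?thesis .
qed

definition "tmass R \<epsilon> t = (LINT x|lborel. u t x * test R \<epsilon> x)"

lemma tmass_cont: assumes "R > 0" "\<epsilon> > 0" shows "continuous_on {0..} (tmass R \<epsilon>)"
proof -
  obtain a b where ab: "\<And>x. x \<notin> cbox a b \<Longrightarrow> test R \<epsilon> x = 0" using test_support[OF assms] by blast
  have "continuous_on ({0..} \<times> cbox a b) (\<lambda>p. (case p of (t, x) \<Rightarrow> u t x) * test R \<epsilon> (snd p))"
    by (intro continuous_intros continuous_on_subset[OF u_cont] continuous_on_compose2[OF test_cont[of UNIV]]) auto
  then have "continuous_on {0..} (\<lambda>t. integral (cbox a b) (\<lambda>x. u t x * test R \<epsilon> x))"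
    by (intro integral_continuous_on_param) (simp add: split_beta)
  then show ?thesis
    by (rule continuous_on_eq) (use assms in \<open>auto simp: tmass_def mass_eq_cbox[OF u_test_int ab]\<close>)
qed

text \<open>Diffusion enters only through the error term on the right, by duality with the test
  function. The constant stands before the quantifiers over R, \<epsilon> and t so that a single
  choice of it can be fixed for the whole argument.\<close>

lemma tmass_deriv: "\<exists>C\<ge>0. \<forall>R>0. \<forall>\<epsilon>>0. \<forall>t>0. \<epsilon> \<le> 1 \<longrightarrow> (\<exists>D. (tmass R \<epsilon> has_real_derivative D) (at t) \<and>
     \<bar>D + h t * (LINT x|lborel. \<bar>u t x\<bar> powr \<beta> * test R \<epsilon> x)\<bar> \<le> k t * (C * R powr (- \<alpha>) * (LINT x|lborel. u t x * wt R x)))"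
proof -
  obtain C where C: "C \<ge> 0" and
    pair: "\<And>(f :: real^'n \<Rightarrow> real) R \<epsilon>. f \<in> Cb2 \<Longrightarrow> R > 0 \<Longrightarrow> 0 < \<epsilon> \<Longrightarrow> \<epsilon> \<le> 1 \<Longrightarrow>
       integrable lborel (\<lambda>x. test R \<epsilon> x * (LINT z|lborel. second_diff f x z / norm z powr q)) \<and>
       \<bar>LINT x|lborel. test R \<epsilon> x * (LINT z|lborel. second_diff f x z / norm z powr q)\<bar>
         \<le> C * R powr (- \<alpha>) * (LINT x|lborel. \<bar>f x\<bar> * wt R x)"
    using cutoff_pairing[OF alpha, where 'n='n] unfolding q_def[symmetric] test_def wt_def by blast
  show ?thesis
  proof (rule exI[of _ "c0 * C"], intro conjI allI impI)
    show "c0 * C \<ge> 0" using c0_pos C by simp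
    fix R \<epsilon> t :: real
    assume R: "0 < R" and "0 < \<epsilon>" and t: "0 < t" and "\<epsilon> \<le> 1"
    then have \<epsilon>: "0 < \<epsilon>" "\<epsilon> \<le> 1" by auto
    obtain a b where ab: "\<And>x. x \<notin> cbox a b \<Longrightarrow> test R \<epsilon> x = 0" using test_support[OF R \<epsilon>(1)] by blast
    let ?L = "LINT x|lborel. test R \<epsilon> x * lap t x"
    let ?P = "LINT x|lborel. \<bar>u t x\<bar> powr \<beta> * test R \<epsilon> x"
    have Li: "integrable lborel (\<lambda>x. test R \<epsilon> x * lap t x)"
      and Lb: "\<bar>?L\<bar> \<le> C * R powr (- \<alpha>) * (LINT x|lborel. u t x * wt R x)"
      using pair[OF u_Cb2[OF t] R \<epsilon>] u_nonneg t by (auto simp: lap_def)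
    have Pi: "integrable lborel (\<lambda>x. \<bar>u t x\<bar> powr \<beta> * test R \<epsilon> x)" using t R \<epsilon> by (intro powr_test_int) auto
    have eq: "deriv (\<lambda>s. u s x) t * test R \<epsilon> x = k t * c0 * (test R \<epsilon> x * lap t x) - h t * (\<bar>u t x\<bar> powr \<beta> * test R \<epsilon> x)" for x
      unfolding deriv_eq[OF t] by (simp add: algebra_simps)
    have Di: "integrable lborel (\<lambda>x. deriv (\<lambda>s. u s x) t * test R \<epsilon> x)"
      unfolding eq using Li Pi by (intro Bochner_Integration.integrable_diff integrable_mult_right)
    have "((\<lambda>s. integral (cbox a b) (\<lambda>x. u s x * test R \<epsilon> x)) has_real_derivative
        integral (cbox a b) (\<lambda>x. deriv (\<lambda>s. u s x) t * test R \<epsilon> x)) (at t within {0<..})"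
    proof (rule leibniz_rule_field_derivative)
      show "((\<lambda>s. u s x * test R \<epsilon> x) has_real_derivative deriv (\<lambda>s. u s x) s * test R \<epsilon> x) (at s within {0<..})"
        if "s \<in> {0<..}" for s x
        using that by (intro DERIV_cmult_right has_field_derivative_at_within[OF u_has_deriv]) auto
      show "(\<lambda>x. u s x * test R \<epsilon> x) integrable_on cbox a b" if "s \<in> {0<..}" for s
        using that by (intro integrable_continuous continuous_intros test_cont continuous_on_subset[OF u_cont_x]) auto
      have "continuous_on ({0<..} \<times> cbox a b) (\<lambda>p. (case p of (t, x) \<Rightarrow> deriv (\<lambda>s. u s x) t) * test R \<epsilon> (snd p))"
        by (intro continuous_intros continuous_on_subset[OF deriv_cont] continuous_on_compose2[OF test_cont[of UNIV]]) auto
      then show "continuous_on ({0<..} \<times> cbox a b) (\<lambda>(s, x). deriv (\<lambda>s. u s x) s * test R \<epsilon> x)"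
        by (simp add: split_beta)
    qed (use t in auto)
    then have d: "((\<lambda>s. integral (cbox a b) (\<lambda>x. u s x * test R \<epsilon> x)) has_real_derivative
        (LINT x|lborel. deriv (\<lambda>s. u s x) t * test R \<epsilon> x)) (at t)"
      using t by (simp add: mass_eq_cbox[OF Di ab] at_within_open[of t "{0<..}"])
    have "(tmass R \<epsilon> has_real_derivative (LINT x|lborel. deriv (\<lambda>s. u s x) t * test R \<epsilon> x)) (at t)"
      by (rule has_field_derivative_transform_within_open[OF d, where S = "{0<..}"])
        (use t R \<epsilon> in \<open>auto simp: tmass_def mass_eq_cbox[OF u_test_int ab]\<close>)
    moreover have "(LINT x|lborel. deriv (\<lambda>s. u s x) t * test R \<epsilon> x) = k t * c0 * ?L - h t * ?P"
      unfolding eq using Li Pi by simp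
    moreover have "\<bar>k t * c0 * ?L\<bar> \<le> k t * (c0 * C * R powr (- \<alpha>) * (LINT x|lborel. u t x * wt R x))"
    proof -
      have "\<bar>k t * c0 * ?L\<bar> = k t * c0 * \<bar>?L\<bar>" using k_nonneg[of t] t c0_pos by (simp add: abs_mult)
      also have "\<dots> \<le> k t * c0 * (C * R powr (- \<alpha>) * (LINT x|lborel. u t x * wt R x))"
        using k_nonneg[of t] t c0_pos by (intro mult_left_mono Lb) auto
      finally show ?thesis by (simp add: mult_ac)
    qed
    ultimately show "\<exists>D. (tmass R \<epsilon> has_real_derivative D) (at t) \<and>
     \<bar>D + h t * ?P\<bar> \<le> k t * (c0 * C * R powr (- \<alpha>) * (LINT x|lborel. u t x * wt R x))"
      by (intro exI[of _ "k t * c0 * ?L - h t * ?P"]) simp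
  qed
qed

definition "Cw = (SOME C. C \<ge> 0 \<and> (\<forall>R>0. \<forall>\<epsilon>>0. \<forall>t>0. \<epsilon> \<le> 1 \<longrightarrow> (\<exists>D. (tmass R \<epsilon> has_real_derivative D) (at t) \<and>
     \<bar>D + h t * (LINT x|lborel. \<bar>u t x\<bar> powr \<beta> * test R \<epsilon> x)\<bar> \<le> k t * (C * R powr (- \<alpha>) * (LINT x|lborel. u t x * wt R x)))))"

lemmas Cw_props = someI_ex[OF tmass_deriv, folded Cw_def]

lemma Cw_nonneg: "Cw \<ge> 0"
  by (rule conjunct1[OF Cw_props])

lemma tmass_rate:
  "R > 0 \<Longrightarrow> \<epsilon> > 0 \<Longrightarrow> \<epsilon> \<le> 1 \<Longrightarrow> t > 0 \<Longrightarrow> \<exists>D. (tmass R \<epsilon> has_real_derivative D) (at t) \<and>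
     \<bar>D + h t * (LINT x|lborel. \<bar>u t x\<bar> powr \<beta> * test R \<epsilon> x)\<bar> \<le> k t * (Cw * R powr (- \<alpha>) * (LINT x|lborel. u t x * wt R x))"
  using conjunct2[OF Cw_props, rule_format, of R \<epsilon> t] .

lemma powr_test_nonneg: "0 \<le> (LINT x|lborel. \<bar>u t x\<bar> powr \<beta> * test R \<epsilon> x)"
  by (intro integral_nonneg_AE AE_I2 mult_nonneg_nonneg test_bounds) simp

text \<open>The reaction only lowers the mass, and the diffusion error k(t) const B is the
  derivative of const B K(t); subtracting the latter leaves a nonincreasing function.\<close>

lemma tmass_upper:
  assumes R: "R > 0" and \<epsilon>: "0 < \<epsilon>" "\<epsilon> \<le> 1" and st: "0 \<le> s" "s \<le> t"
    and B: "\<And>\<tau>. s < \<tau> \<Longrightarrow> \<tau> < t \<Longrightarrow> (LINT x|lborel. u \<tau> x * wt R x) \<le> B"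
  shows "tmass R \<epsilon> t \<le> tmass R \<epsilon> s + Cw * R powr (- \<alpha>) * B * (K t - K s)"
proof -
  let ?c = "Cw * R powr (- \<alpha>)"
  let ?f = "\<lambda>t. tmass R \<epsilon> t - ?c * B * K t"
  have "?f s \<ge> ?f t"
  proof (rule DERIV_nonpos_imp_decreasing_open[OF st(2)])
    show "continuous_on {s..t} ?f"
      using st by (intro continuous_intros continuous_on_subset[OF tmass_cont[OF R \<epsilon>(1)]] continuous_on_subset[OF K_props(2)]) auto
    fix \<tau> assume \<tau>: "s < \<tau>" "\<tau> < t"
    then have \<tau>0: "\<tau> > 0" using st by simp
    let ?W = "LINT x|lborel. u \<tau> x * wt R x"
    obtain D where D: "(tmass R \<epsilon> has_real_derivative D) (at \<tau>)"
      "\<bar>D + h \<tau> * (LINT x|lborel. \<bar>u \<tau> x\<bar> powr \<beta> * test R \<epsilon> x)\<bar> \<le> k \<tau> * (?c * ?W)"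
      using tmass_rate[OF R \<epsilon> \<tau>0] by blast
    have "h \<tau> * (LINT x|lborel. \<bar>u \<tau> x\<bar> powr \<beta> * test R \<epsilon> x) \<ge> 0"
      using h_nonneg[of \<tau>] \<tau>0 powr_test_nonneg by simp
    then have "D \<le> k \<tau> * (?c * ?W)" using D(2) by linarith
    also have "\<dots> \<le> k \<tau> * (?c * B)"
      using k_nonneg[of \<tau>] \<tau>0 Cw_nonneg B[OF \<tau>] by (intro mult_left_mono) auto
    finally have "D - ?c * B * k \<tau> \<le> 0" by (simp add: mult_ac)
    moreover have "(?f has_real_derivative D - ?c * B * k \<tau>) (at \<tau>)"
      by (intro DERIV_diff D(1) DERIV_cmult K_props(4) \<tau>0)
    ultimately show "\<exists>y. (?f has_real_derivative y) (at \<tau>) \<and> y \<le> 0" by blast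
  qed
  then show ?thesis by (simp add: algebra_simps)
qed

text \<open>As in \<open>tmass_upper\<close>, with \<Phi> a primitive of a bound for the reaction
  term.\<close>

lemma tmass_lower:
  assumes R: "R > 0" and \<epsilon>: "0 < \<epsilon>" "\<epsilon> \<le> 1" and st: "0 \<le> s" "s \<le> t"
    and B: "\<And>\<tau>. s < \<tau> \<Longrightarrow> \<tau> < t \<Longrightarrow> (LINT x|lborel. u \<tau> x * wt R x) \<le> B"
    and \<Phi>: "continuous_on {0..} \<Phi>" "\<And>\<tau>. \<tau> > 0 \<Longrightarrow> (\<Phi> has_real_derivative \<phi> \<tau>) (at \<tau>)"
    and h\<phi>: "\<And>\<tau>. s < \<tau> \<Longrightarrow> \<tau> < t \<Longrightarrow> h \<tau> * (LINT x|lborel. \<bar>u \<tau> x\<bar> powr \<beta> * test R \<epsilon> x) \<le> \<phi> \<tau>"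
  shows "tmass R \<epsilon> t \<ge> tmass R \<epsilon> s - Cw * R powr (- \<alpha>) * B * (K t - K s) - (\<Phi> t - \<Phi> s)"
proof -
  let ?c = "Cw * R powr (- \<alpha>)"
  let ?f = "\<lambda>t. - tmass R \<epsilon> t - ?c * B * K t - \<Phi> t"
  have "?f s \<ge> ?f t"
  proof (rule DERIV_nonpos_imp_decreasing_open[OF st(2)])
    show "continuous_on {s..t} ?f"
      using st by (intro continuous_intros continuous_on_subset[OF tmass_cont[OF R \<epsilon>(1)]]
        continuous_on_subset[OF K_props(2)] continuous_on_subset[OF \<Phi>(1)]) auto
    fix \<tau> assume \<tau>: "s < \<tau>" "\<tau> < t"
    then have \<tau>0: "\<tau> > 0" using st by simp
    let ?W = "LINT x|lborel. u \<tau> x * wt R x"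
    obtain D where D: "(tmass R \<epsilon> has_real_derivative D) (at \<tau>)"
      "\<bar>D + h \<tau> * (LINT x|lborel. \<bar>u \<tau> x\<bar> powr \<beta> * test R \<epsilon> x)\<bar> \<le> k \<tau> * (?c * ?W)"
      using tmass_rate[OF R \<epsilon> \<tau>0] by blast
    have "- D - \<phi> \<tau> \<le> k \<tau> * (?c * ?W)" using D(2) h\<phi>[OF \<tau>] by linarith
    also have "\<dots> \<le> k \<tau> * (?c * B)"
      using k_nonneg[of \<tau>] \<tau>0 Cw_nonneg B[OF \<tau>] by (intro mult_left_mono) auto
    finally have "- D - ?c * B * k \<tau> - \<phi> \<tau> \<le> 0" by (simp add: mult_ac)
    moreover have "(?f has_real_derivative - D - ?c * B * k \<tau> - \<phi> \<tau>) (at \<tau>)"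
      by (intro DERIV_diff DERIV_minus D(1) DERIV_cmult K_props(4) \<Phi>(2) \<tau>0)
    ultimately show "\<exists>y. (?f has_real_derivative y) (at \<tau>) \<and> y \<le> 0" by blast
  qed
  then show ?thesis by (simp add: algebra_simps)
qed

section \<open>Removing the truncation and the weight\<close>

definition "\<epsilon>n n = inverse (real (Suc n))"

lemma \<epsilon>n: "0 < \<epsilon>n n" "\<epsilon>n n \<le> 1" "\<epsilon>n \<longlonglongrightarrow> 0"
  unfolding \<epsilon>n_def[abs_def] using LIMSEQ_inverse_real_of_nat by (auto simp: field_simps)

lemma test_tendsto_wt: "(\<lambda>n. test R (\<epsilon>n n) x) \<longlonglongrightarrow> wt R x"
proof -
  have "(\<lambda>n. weight q (x /\<^sub>R R) * (max 0 (1 - \<epsilon>n n * (1 + (norm (x /\<^sub>R R))\<^sup>2))) ^ 3) \<longlonglongrightarrow>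
      weight q (x /\<^sub>R R) * (max 0 (1 - 0 * (1 + (norm (x /\<^sub>R R))\<^sup>2))) ^ 3"
    by (intro tendsto_intros \<epsilon>n)
  then show ?thesis by (simp add: test_def cutoff_def wt_def)
qed

lemma tendsto_rescale: "(\<lambda>n. x /\<^sub>R real (Suc n)) \<longlonglongrightarrow> (0::real^'n)"
  using tendsto_scaleR[OF LIMSEQ_inverse_real_of_nat tendsto_const[of x]] by simp

lemma wt_tendsto: "(\<lambda>n. wt (real (Suc n)) x) \<longlonglongrightarrow> 1"
proof -
  have "(\<lambda>n. weight q (x /\<^sub>R real (Suc n))) \<longlonglongrightarrow> weight q (0::real^'n)"
    using continuous_on_weight[of q] tendsto_rescale[of x]
    by (intro continuous_on_tendsto_compose[of UNIV "weight q"]) auto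
  then show ?thesis by (simp add: wt_def weight_def)
qed

lemma test_tendsto_one: "(\<lambda>n. test (real (Suc n)) (\<epsilon>n n) x) \<longlonglongrightarrow> 1"
proof -
  have "(\<lambda>n. wt (real (Suc n)) x * (max 0 (1 - \<epsilon>n n * (1 + (norm (x /\<^sub>R real (Suc n)))\<^sup>2))) ^ 3) \<longlonglongrightarrow>
      1 * (max 0 (1 - 0 * (1 + (norm (0::real^'n))\<^sup>2))) ^ 3"
    by (intro tendsto_intros \<epsilon>n wt_tendsto tendsto_rescale)
  then show ?thesis by (simp add: test_def cutoff_def wt_def)
qed

lemma tmass_tendsto_wt:
  assumes t: "t \<ge> 0" and R: "R > 0"
  shows "(\<lambda>n. tmass R (\<epsilon>n n) t) \<longlonglongrightarrow> (LINT x|lborel. u t x * wt R x)"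
  unfolding tmass_def
proof (rule integral_dominated_convergence[where w = "\<lambda>x. u t x * wt R x"])
  note [measurable] = u_meas[OF t]
  show "(\<lambda>x. u t x * wt R x) \<in> borel_measurable lborel" by measurable
  show "(\<lambda>x. u t x * test R (\<epsilon>n n) x) \<in> borel_measurable lborel" for n by measurable
  show "integrable lborel (\<lambda>x. u t x * wt R x)" by (rule u_wt_int[OF t R])
  show "AE x in lborel. (\<lambda>n. u t x * test R (\<epsilon>n n) x) \<longlonglongrightarrow> u t x * wt R x"
    by (intro AE_I2 tendsto_mult tendsto_const test_tendsto_wt)
  show "AE x in lborel. norm (u t x * test R (\<epsilon>n n) x) \<le> u t x * wt R x" for n
    using u_nonneg[OF t] \<epsilon>n(1)[of n] by (intro AE_I2) (auto simp: abs_mult test_bounds intro!: mult_left_mono)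
qed

text \<open>The weighted mass occurs on both sides of its own estimate: its supremum S over [0, T]
  satisfies S <= m0 + \<theta> S with \<theta> of order R^(-\<alpha>) K(T), and for \<theta> < 1 the
  last term is absorbed.\<close>

lemma wt_mass_le:
  assumes T: "T \<ge> 0" and R: "R > 0" and small: "Cw * R powr (- \<alpha>) * K T < 1"
  shows "(LINT x|lborel. u T x * wt R x) \<le> m0 / (1 - Cw * R powr (- \<alpha>) * K T)"
proof -
  define W where "W t = (LINT x|lborel. u t x * wt R x)" for t
  define S where "S = (SUP t\<in>{0..T}. W t)"
  \<comment> \<open>This crude bound depends on R; it guarantees that S is finite, without which the
    absorption would be meaningless.\<close>
  have W_le: "W t \<le> (LINT x|lborel. U * wt R x)" if "t \<in> {0..T}" for t
    unfolding W_def using that R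
    by (intro integral_mono u_wt_int integrable_mult_right wt_int mult_right_mono test_bounds order.trans[OF abs_ge_self U(2)]) auto
  have bdd: "bdd_above (W ` {0..T})" by (rule bdd_aboveI2[OF W_le])
  have WS: "W t \<le> S" if "t \<in> {0..T}" for t unfolding S_def by (rule cSUP_upper[OF that bdd])
  have W0: "0 \<le> W t" if "t \<ge> 0" for t
    unfolding W_def by (intro integral_nonneg_AE AE_I2 mult_nonneg_nonneg u_nonneg[OF that] test_bounds)
  have S0: "0 \<le> S" using W0[of 0] WS[of 0] T by simp
  have init: "tmass R \<epsilon> 0 \<le> m0" if "\<epsilon> > 0" for \<epsilon>
  proof -
    have "u 0 x * test R \<epsilon> x \<le> u 0 x * 1" for x
      using test_bounds(2)[of \<epsilon> R x] test_bounds(4)[of R x] that u_nonneg[of 0 x] by (intro mult_left_mono) auto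
    then show ?thesis unfolding tmass_def m0_def
      using u_test_int[of 0 R \<epsilon>] R that u0_int by (intro integral_mono) (auto simp: u_init)
  qed
  let ?\<theta> = "Cw * R powr (- \<alpha>) * K T"
  have Wt: "W t \<le> m0 + ?\<theta> * S" if t: "t \<in> {0..T}" for t
  proof (rule LIMSEQ_le_const2)
    show "(\<lambda>n. tmass R (\<epsilon>n n) t) \<longlonglongrightarrow> W t"
      unfolding W_def using t R by (intro tmass_tendsto_wt) auto
    have "tmass R (\<epsilon>n n) t \<le> m0 + ?\<theta> * S" for n
    proof -
      have "tmass R (\<epsilon>n n) t \<le> tmass R (\<epsilon>n n) 0 + Cw * R powr (- \<alpha>) * S * (K t - K 0)"
        by (rule tmass_upper[OF R \<epsilon>n(1,2)]) (use t WS in \<open>auto simp: W_def\<close>)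
      also have "\<dots> \<le> m0 + Cw * R powr (- \<alpha>) * S * K T"
        using Cw_nonneg S0 t K_props(3)[of t T] by (intro add_mono init \<epsilon>n mult_left_mono) (auto simp: K_props(1))
      finally show ?thesis by (simp add: mult_ac)
    qed
    then show "\<exists>N. \<forall>n\<ge>N. tmass R (\<epsilon>n n) t \<le> m0 + ?\<theta> * S" by blast
  qed
  have "S \<le> m0 + ?\<theta> * S"
    unfolding S_def using Wt T by (intro cSUP_least) (auto simp: S_def)
  then have "S \<le> m0 / (1 - ?\<theta>)" using small by (simp add: field_simps)
  then show ?thesis using WS[of T] T by (simp add: W_def)
qed

text \<open>Fatou's lemma along R = n + 1: the weights tend to 1 and the bounds
  \<open>m0 / (1 - ?\<theta> n)\<close> tend to m0.\<close>

lemma u_L1: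
  assumes T: "T \<ge> 0"
  shows "integrable lborel (u T)" and "(LINT x|lborel. u T x) \<le> m0"
proof -
  note [measurable] = u_meas[OF T]
  let ?R = "\<lambda>n. real (Suc n)"
  let ?\<theta> = "\<lambda>n. Cw * ?R n powr (- \<alpha>) * K T"
  have \<theta>: "?\<theta> \<longlonglongrightarrow> 0"
  proof -
    have "filterlim ?R at_top sequentially"
      by (rule filterlim_compose[OF filterlim_real_sequentially filterlim_Suc])
    then have "(\<lambda>n. ?R n powr (- \<alpha>)) \<longlonglongrightarrow> 0"
      using alpha by (intro tendsto_neg_powr) auto
    from tendsto_mult[OF tendsto_mult[OF tendsto_const[of Cw] this] tendsto_const[of "K T"]] show ?thesis by simp
  qed
  have "(\<integral>\<^sup>+x. ennreal (u T x) \<partial>lborel) = (\<integral>\<^sup>+x. liminf (\<lambda>n. ennreal (u T x * wt (?R n) x)) \<partial>lborel)"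
  proof (rule nn_integral_cong)
    fix x
    have "(\<lambda>n. ennreal (u T x * wt (?R n) x)) \<longlonglongrightarrow> ennreal (u T x * 1)"
      by (intro tendsto_ennrealI tendsto_mult tendsto_const wt_tendsto)
    then show "ennreal (u T x) = liminf (\<lambda>n. ennreal (u T x * wt (?R n) x))"
      by (simp add: lim_imp_Liminf)
  qed
  also have "\<dots> \<le> liminf (\<lambda>n. \<integral>\<^sup>+x. ennreal (u T x * wt (?R n) x) \<partial>lborel)"
    by (rule nn_integral_liminf) measurable
  also have "\<dots> \<le> liminf (\<lambda>n. ennreal (m0 / (1 - ?\<theta> n)))"
  proof (rule Liminf_mono)
    \<comment> \<open>For small n the absorption condition may fail, so the bound on the weighted
      mass holds only eventually.\<close>
    have "eventually (\<lambda>n. ?\<theta> n < 1) sequentially" using \<theta> by (rule order_tendstoD) simp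
    then show "\<forall>\<^sub>F n in sequentially. (\<integral>\<^sup>+x. ennreal (u T x * wt (?R n) x) \<partial>lborel) \<le> ennreal (m0 / (1 - ?\<theta> n))"
    proof eventually_elim
      case (elim n)
      have "(\<integral>\<^sup>+x. ennreal (u T x * wt (?R n) x) \<partial>lborel) = ennreal (LINT x|lborel. u T x * wt (?R n) x)"
        by (intro nn_integral_eq_integral u_wt_int T) (auto intro!: mult_nonneg_nonneg u_nonneg T test_bounds)
      also have "\<dots> \<le> ennreal (m0 / (1 - ?\<theta> n))"
        by (intro ennreal_leI wt_mass_le T elim) simp
      finally show ?case .
    qed
  qed
  also have "\<dots> = ennreal m0"
  proof (rule lim_imp_Liminf)
    have "(\<lambda>n. ennreal (m0 / (1 - ?\<theta> n))) \<longlonglongrightarrow> ennreal (m0 / (1 - 0))"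
      by (intro tendsto_ennrealI tendsto_divide tendsto_diff tendsto_const \<theta>) simp
    then show "(\<lambda>n. ennreal (m0 / (1 - ?\<theta> n))) \<longlonglongrightarrow> ennreal m0" by simp
  qed simp
  finally have le: "(\<integral>\<^sup>+x. ennreal (u T x) \<partial>lborel) \<le> ennreal m0" .
  then have "(\<integral>\<^sup>+x. ennreal (u T x) \<partial>lborel) < \<infinity>" by (simp add: order_le_less_trans)
  then show i: "integrable lborel (u T)"
    by (intro integrableI_nonneg) (auto simp: u_nonneg T)
  have "ennreal (LINT x|lborel. u T x) \<le> ennreal m0"
    using le nn_integral_eq_integral[OF i] u_nonneg[OF T] by simp
  then show "(LINT x|lborel. u T x) \<le> m0" using m0_pos by (subst (asm) ennreal_le_iff) auto
qed

section \<open>Monotonicity and lower bounds for the mass\<close>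

definition "mass t = (LINT x|lborel. u t x)"

lemma mass_0: "mass 0 = m0" by (simp add: mass_def m0_def u_init)

lemma mass_nonneg: "t \<ge> 0 \<Longrightarrow> mass t \<ge> 0"
  unfolding mass_def by (intro integral_nonneg_AE AE_I2 u_nonneg)

lemma wt_mass_le_m0: assumes "t \<ge> 0" "R > 0" shows "(LINT x|lborel. u t x * wt R x) \<le> m0"
proof -
  have "(LINT x|lborel. u t x * wt R x) \<le> (LINT x|lborel. u t x)"
    using assms mult_left_mono[OF test_bounds(4) u_nonneg[OF assms(1)]]
    by (intro integral_mono u_wt_int u_L1) auto
  then show ?thesis using u_L1(2)[OF assms(1)] by simp
qed

lemma tmass_le_mass: assumes "t \<ge> 0" "R > 0" "\<epsilon> \<ge> 0" shows "tmass R \<epsilon> t \<le> mass t"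
proof -
  have "u t x * test R \<epsilon> x \<le> u t x" for x
    using test_bounds(2)[OF assms(3), of R x] test_bounds(4)[of R x] mult_left_mono[of "test R \<epsilon> x" 1 "u t x"] u_nonneg[OF assms(1), of x] by simp
  then show ?thesis unfolding tmass_def mass_def
    using assms by (intro integral_mono u_test_int u_L1) auto
qed

text \<open>Once u(t) is integrable it dominates all tested integrands, so R -> \<infinity> and
  \<epsilon> -> 0 can be taken along one sequence.\<close>

lemma tmass_tendsto_mass:
  assumes t: "t \<ge> 0"
  shows "(\<lambda>n. tmass (real (Suc n)) (\<epsilon>n n) t) \<longlonglongrightarrow> mass t"
  unfolding tmass_def mass_def
proof (rule integral_dominated_convergence[where w = "u t"])
  note [measurable] = u_meas[OF t]
  show "u t \<in> borel_measurable lborel" by measurable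
  show "(\<lambda>x. u t x * test (real (Suc n)) (\<epsilon>n n) x) \<in> borel_measurable lborel" for n by measurable
  show "integrable lborel (u t)" by (rule u_L1[OF t])
  have "(\<lambda>n. u t x * test (real (Suc n)) (\<epsilon>n n) x) \<longlonglongrightarrow> u t x * 1" for x
    by (intro tendsto_mult tendsto_const test_tendsto_one)
  then show "AE x in lborel. (\<lambda>n. u t x * test (real (Suc n)) (\<epsilon>n n) x) \<longlonglongrightarrow> u t x"
    by simp
  show "AE x in lborel. norm (u t x * test (real (Suc n)) (\<epsilon>n n) x) \<le> u t x" for n
  proof (rule AE_I2)
    fix x
    have "test (real (Suc n)) (\<epsilon>n n) x \<le> 1"
      using test_bounds(2)[of "\<epsilon>n n" "real (Suc n)" x] test_bounds(4)[of "real (Suc n)" x] \<epsilon>n(1)[of n] by simp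
    then show "norm (u t x * test (real (Suc n)) (\<epsilon>n n) x) \<le> u t x"
      using u_nonneg[OF t, of x] test_bounds(1)[of "real (Suc n)" "\<epsilon>n n" x]
        mult_left_mono[of "test (real (Suc n)) (\<epsilon>n n) x" 1 "u t x"] by (simp add: abs_mult)
  qed
qed

lemma rate_tendsto: "(\<lambda>n. Cw * real (Suc n) powr (- \<alpha>) * m0 * (K t - K s)) \<longlonglongrightarrow> 0"
proof -
  have "filterlim (\<lambda>n. real (Suc n)) at_top sequentially"
    by (rule filterlim_compose[OF filterlim_real_sequentially filterlim_Suc])
  then have "(\<lambda>n. real (Suc n) powr (- \<alpha>)) \<longlonglongrightarrow> 0"
    using alpha by (intro tendsto_neg_powr) auto
  from tendsto_mult[OF tendsto_mult[OF tendsto_const[of Cw] this] tendsto_const[of "m0 * (K t - K s)"]]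
  show ?thesis by (simp add: mult.assoc)
qed

lemma mass_antimono:
  assumes st: "0 \<le> s" "s \<le> t" shows "mass t \<le> mass s"
proof (rule LIMSEQ_le)
  show "(\<lambda>n. tmass (real (Suc n)) (\<epsilon>n n) t) \<longlonglongrightarrow> mass t"
    using st by (intro tmass_tendsto_mass) auto
  have "(\<lambda>n. tmass (real (Suc n)) (\<epsilon>n n) s + Cw * real (Suc n) powr (- \<alpha>) * m0 * (K t - K s)) \<longlonglongrightarrow> mass s + 0"
    by (intro tendsto_add rate_tendsto tmass_tendsto_mass st)
  then show "(\<lambda>n. tmass (real (Suc n)) (\<epsilon>n n) s + Cw * real (Suc n) powr (- \<alpha>) * m0 * (K t - K s)) \<longlonglongrightarrow> mass s"
    by simp
  have "tmass (real (Suc n)) (\<epsilon>n n) t \<le> tmass (real (Suc n)) (\<epsilon>n n) s + Cw * real (Suc n) powr (- \<alpha>) * m0 * (K t - K s)" for n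
    by (rule tmass_upper[OF _ \<epsilon>n(1,2) st]) (use st wt_mass_le_m0 in auto)
  then show "\<exists>N. \<forall>n\<ge>N. tmass (real (Suc n)) (\<epsilon>n n) t \<le> tmass (real (Suc n)) (\<epsilon>n n) s + Cw * real (Suc n) powr (- \<alpha>) * m0 * (K t - K s)"
    by blast
qed

text \<open>The loss rate is at most h g times the current mass, which monotonicity bounds by
  \<open>mass s\<close>. Freezing it there gives a linear factor in place of an exponential one; it
  is informative while F has grown by less than 1, and is iterated later.\<close>

lemma mass_lower:
  assumes st: "0 \<le> s" "s \<le> t" and g: "continuous_on {0..} g" "\<And>\<tau>. \<tau> \<ge> 0 \<Longrightarrow> g \<tau> \<ge> 0"
    and ug: "\<And>\<tau> x. \<tau> > 0 \<Longrightarrow> u \<tau> x powr \<beta> \<le> g \<tau> * u \<tau> x"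
  defines "F \<equiv> \<lambda>t. integral {0..t} (\<lambda>\<tau>. h \<tau> * g \<tau>)"
  shows "mass s * (1 - (F t - F s)) \<le> mass t"
proof (rule LIMSEQ_le)
  note F = indefinite_integral_nonneg[of "\<lambda>\<tau>. h \<tau> * g \<tau>", folded F_def, OF continuous_on_mult[OF h_cont g(1)] mult_nonneg_nonneg[OF h_nonneg g(2)]]
  let ?L = "\<lambda>n. tmass (real (Suc n)) (\<epsilon>n n) s - Cw * real (Suc n) powr (- \<alpha>) * m0 * (K t - K s) - (mass s * F t - mass s * F s)"
  show "(\<lambda>n. tmass (real (Suc n)) (\<epsilon>n n) t) \<longlonglongrightarrow> mass t"
    using st by (intro tmass_tendsto_mass) auto
  have "?L \<longlonglongrightarrow> mass s - 0 - (mass s * F t - mass s * F s)"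
    by (intro tendsto_diff rate_tendsto tmass_tendsto_mass st tendsto_const)
  then show "?L \<longlonglongrightarrow> mass s * (1 - (F t - F s))" by (simp add: algebra_simps)
  have "tmass (real (Suc n)) (\<epsilon>n n) t \<ge> ?L n" for n
  proof (rule tmass_lower[OF _ \<epsilon>n(1,2) st])
    show "continuous_on {0..} (\<lambda>t. mass s * F t)" by (intro continuous_intros F(2))
    show "((\<lambda>t. mass s * F t) has_real_derivative mass s * (h \<tau> * g \<tau>)) (at \<tau>)" if "\<tau> > 0" for \<tau>
      by (intro DERIV_cmult F(4) that)
    fix \<tau> assume \<tau>: "s < \<tau>" "\<tau> < t"
    then have \<tau>0: "\<tau> > 0" "\<tau> \<ge> 0" using st by auto
    show "(LINT x|lborel. u \<tau> x * wt (real (Suc n)) x) \<le> m0" using \<tau>0 by (intro wt_mass_le_m0) auto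
    let ?t = "test (real (Suc n)) (\<epsilon>n n)"
    have "(LINT x|lborel. \<bar>u \<tau> x\<bar> powr \<beta> * ?t x) \<le> (LINT x|lborel. g \<tau> * (u \<tau> x * ?t x))"
    proof (rule integral_mono)
      show "integrable lborel (\<lambda>x. \<bar>u \<tau> x\<bar> powr \<beta> * ?t x)"
        using \<tau>0 \<epsilon>n(1)[of n] by (intro powr_test_int) auto
      show "integrable lborel (\<lambda>x. g \<tau> * (u \<tau> x * ?t x))"
        using \<tau>0 \<epsilon>n(1)[of n] by (intro integrable_mult_right u_test_int) auto
      show "\<bar>u \<tau> x\<bar> powr \<beta> * ?t x \<le> g \<tau> * (u \<tau> x * ?t x)" for x
        using mult_right_mono[OF ug[OF \<tau>0(1), of x] test_bounds(1)[of "real (Suc n)" "\<epsilon>n n" x]] u_nonneg[OF \<tau>0(2), of x]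
        by (simp add: mult.assoc)
    qed
    also have "\<dots> = g \<tau> * tmass (real (Suc n)) (\<epsilon>n n) \<tau>" by (simp add: tmass_def)
    also have "\<dots> \<le> g \<tau> * mass s"
      using \<tau> \<tau>0 \<epsilon>n(1)[of n] st
      by (intro mult_left_mono g order.trans[OF tmass_le_mass mass_antimono]) auto
    finally show "h \<tau> * (LINT x|lborel. \<bar>u \<tau> x\<bar> powr \<beta> * ?t x) \<le> mass s * (h \<tau> * g \<tau>)"
      using h_nonneg[OF \<tau>0(2)] mult_left_mono by (fastforce simp: mult_ac)
  qed simp
  then show "\<exists>N. \<forall>n\<ge>N. ?L n \<le> tmass (real (Suc n)) (\<epsilon>n n) t" by blast
qed

section \<open>Decay of the supremum\<close>

text \<open>The comparison function is the explicit solution of y' = -\<gamma> c0 k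
  y^(1+\<alpha>/d), y(0) = U. At a penalized maximum of u - y the diffusion pulls u down at least as
  fast as y up to O(\<epsilon>), and the reaction can only help.\<close>

lemma u_decay:
  obtains A B where "A > 0" "B > 0"
    "\<And>t x. t \<ge> 0 \<Longrightarrow> u t x \<le> (A + B * K t) powr (- (real CARD('n) / \<alpha>))"
proof -
  let ?d = "real CARD('n)"
  obtain C \<gamma> where C: "C \<ge> 0" and \<gamma>: "\<gamma> > 0" and
    mx: "\<And>(f :: real^'n \<Rightarrow> real) x0 \<epsilon>. f \<in> Cb2 \<Longrightarrow> \<epsilon> \<ge> 0 \<Longrightarrow>
       (\<And>x. f x - \<epsilon> * barrier x \<le> f x0 - \<epsilon> * barrier x0) \<Longrightarrow>
       (\<And>x. 0 \<le> f x) \<Longrightarrow> integrable lborel f \<Longrightarrow> (LINT x|lborel. f x) \<le> m0 \<Longrightarrow> 0 < f x0 \<Longrightarrow> f x0 \<le> U \<Longrightarrow>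
       (LINT z|lborel. second_diff f x0 z / norm z powr (real CARD('n) + \<alpha>))
         \<le> \<epsilon> * C - \<gamma> * f x0 powr (1 + \<alpha> / real CARD('n))"
    using second_diff_integral_at_max_mass[OF alpha m0_pos U(1), where 'n='n] by blast
  define e where "e = ?d / \<alpha>"
  have e: "e > 0" using alpha by (simp add: e_def)
  \<comment> \<open>A is fixed by y(0) = U and B by e B = \<gamma> c0, the coefficient of the
    differential equation.\<close>
  define A where "A = U powr (- (1 / e))"
  define B where "B = \<gamma> * c0 / e"
  have A: "A > 0" using U(1) by (simp add: A_def)
  have B: "B > 0" using \<gamma> c0_pos e by (simp add: B_def)
  define y where "y t = (A + B * K t) powr (- e)" for t
  have base: "A + B * K t > 0" if "t \<ge> 0" for t using A B K_nonneg[OF that] by (simp add: add_pos_nonneg)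
  have y_pos: "y t > 0" if "t \<ge> 0" for t using base[OF that] by (simp add: y_def)
  have y0: "y 0 = U" using U(1) e by (simp add: y_def K_props(1) A_def powr_powr)
  have y_cont: "continuous_on {0..} y"
    unfolding y_def using base by (intro continuous_intros K_props(2)) (auto simp: less_imp_neq[symmetric])
  have dy: "(y has_real_derivative - (\<gamma> * c0 * k t * y t powr (1 + \<alpha> / ?d))) (at t)" if t: "t > 0" for t
  proof -
    have 1: "((\<lambda>t. A + B * K t) has_real_derivative B * k t) (at t)"
      using DERIV_add[OF DERIV_const DERIV_cmult[OF K_props(4)[OF t]]] by simp
    have b: "A + B * K t > 0" using base t by simp
    have "(y has_real_derivative (- e * (A + B * K t) powr (- e - 1)) * (B * k t)) (at t)"
      unfolding y_def[abs_def] by (rule DERIV_chain2[OF has_real_derivative_powr[OF b] 1])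
    moreover have "y t powr (1 + \<alpha> / ?d) = (A + B * K t) powr (- e - 1)"
    proof -
      have "- e * (1 + \<alpha> / ?d) = - e - 1" using alpha by (simp add: e_def field_simps)
      then show ?thesis by (simp only: y_def powr_powr)
    qed
    moreover have "e * B = \<gamma> * c0" using e by (simp add: B_def)
    ultimately show ?thesis by (simp add: mult_ac) (metis (no_types) mult.assoc mult.commute)
  qed
  have "u t x \<le> y t" if t: "t \<ge> 0" for t x
  proof (rule ccontr)
    assume neg: "\<not> u t x \<le> y t"
    obtain k1 where k1: "k1 \<ge> 0" "\<And>s. s \<in> {0..t} \<Longrightarrow> k s \<le> k1" using bounded_on_interval[OF k_cont] by blast
    define v where "v s z = u s z - y s" for s z
    have "continuous_on ({0..t} \<times> UNIV) (\<lambda>p. (case p of (s, z) \<Rightarrow> u s z) - y (fst p))"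
      by (intro continuous_intros continuous_on_subset[OF u_cont] continuous_on_compose2[OF y_cont]) auto
    then have v_cont: "continuous_on ({0..t} \<times> UNIV) (\<lambda>(s, z). v s z)"
      by (simp add: v_def split_beta)
    have v_le: "v s z \<le> U" if "s \<in> {0..t}" for s z
      using U(2)[of s z] y_pos[of s] that by (simp add: v_def)
    have v0: "v 0 z \<le> 0" for z using U(2)[of 0 z] by (simp add: v_def y0)
    have vp: "v t x > 0" using neg by (simp add: v_def)
    have c: "k1 * c0 * C + 1 \<ge> 0" using k1 c0_pos C by (simp add: add_nonneg_nonneg)
    obtain \<epsilon> t0 x0 where e: "\<epsilon> > 0" "0 < t0" "t0 \<le> t" "v t0 x0 > 0"
      "\<And>z. v t0 z - \<epsilon> * barrier z \<le> v t0 x0 - \<epsilon> * barrier x0"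
      "\<And>D. ((\<lambda>s. v s x0) has_real_derivative D) (at t0) \<Longrightarrow> D \<ge> \<epsilon> * (k1 * c0 * C + 1)"
      using penalized_maximum[OF v_cont v_le v0 _ vp c] t by auto
    have t0: "t0 \<ge> 0" using e(2) by simp
    have uy: "u t0 x0 > y t0" using e(4) by (simp add: v_def)
    \<comment> \<open>y(t0) is constant in x, so a maximum of u - y - \<epsilon> barrier at time t0
      is one of u - \<epsilon> barrier; the mass bound m0 and the height bound U hold for all times,
      hence \<gamma> is the same at every t0.\<close>
    have "lap t0 x0 \<le> \<epsilon> * C - \<gamma> * u t0 x0 powr (1 + \<alpha> / ?d)"
      unfolding lap_def q_def
      by (rule mx) (use e u_Cb2 u_nonneg[OF t0] u_L1[OF t0] uy y_pos[OF t0] U(2)[OF t0, of x0] in \<open>auto simp: v_def\<close>)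
    also have "\<dots> \<le> \<epsilon> * C - \<gamma> * y t0 powr (1 + \<alpha> / ?d)"
      using \<gamma> uy y_pos[OF t0] alpha by (intro diff_left_mono mult_left_mono powr_mono2) auto
    finally have lp: "lap t0 x0 \<le> \<epsilon> * C - \<gamma> * y t0 powr (1 + \<alpha> / ?d)" .
    let ?D = "deriv (\<lambda>s. u s x0) t0 - - (\<gamma> * c0 * k t0 * y t0 powr (1 + \<alpha> / ?d))"
    have D: "((\<lambda>s. v s x0) has_real_derivative ?D) (at t0)"
      unfolding v_def by (intro DERIV_diff u_has_deriv dy e)
    have "?D \<le> k t0 * c0 * lap t0 x0 + \<gamma> * c0 * k t0 * y t0 powr (1 + \<alpha> / ?d)"
      unfolding deriv_eq[OF e(2)] using h_nonneg[OF t0] by simp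
    also have "\<dots> \<le> k t0 * c0 * (\<epsilon> * C - \<gamma> * y t0 powr (1 + \<alpha> / ?d)) + \<gamma> * c0 * k t0 * y t0 powr (1 + \<alpha> / ?d)"
      using lp k_nonneg[OF t0] c0_pos by (intro add_right_mono mult_left_mono) auto
    also have "\<dots> = k t0 * (c0 * \<epsilon> * C)" by (simp add: algebra_simps)
    also have "\<dots> \<le> k1 * (c0 * \<epsilon> * C)"
      using k1(2)[of t0] e c0_pos C by (intro mult_right_mono) auto
    finally have "?D \<le> \<epsilon> * (k1 * c0 * C)" by (simp add: mult_ac)
    with e(6)[OF D] e(1) show False by (simp add: algebra_simps)
  qed
  then show ?thesis using A B by (intro that[of A B]) (auto simp: y_def e_def)
qed

section \<open>Convergence of the mass to a positive limit\<close>

theorem mass_limit: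
  assumes h_pos: "\<And>t. t > 0 \<Longrightarrow> h t > 0"
    and hK: "(\<integral>\<^sup>+s\<in>{1..}. ennreal (h s) * neg_powr (K s) (real CARD('n) / \<alpha> * (\<beta> - 1)) \<partial>lborel) < \<infinity>"
  shows "\<exists>Minf>0. (mass \<longlongrightarrow> Minf) at_top"
proof -
  obtain A B where A: "A > 0" and B: "B > 0"
    and decay: "\<And>t x. t \<ge> 0 \<Longrightarrow> u t x \<le> (A + B * K t) powr (- (real CARD('n) / \<alpha>))"
    using u_decay by blast
  define e where "e = real CARD('n) / \<alpha> * (\<beta> - 1)"
  have e: "e > 0" using alpha beta by (simp add: e_def)
  \<comment> \<open>The decay estimate raised to the power \<beta> - 1, so that u^\<beta> <= g u.
    Keeping A avoids the singularity of K^(-e) where K vanishes.\<close>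
  define g where "g t = (A + B * K t) powr (- e)" for t
  have base: "A + B * K t > 0" if "t \<ge> 0" for t using A B K_nonneg[OF that] by (simp add: add_pos_nonneg)
  have g_nonneg: "g t \<ge> 0" for t by (simp add: g_def)
  have g_cont: "continuous_on {0..} g"
    unfolding g_def using base by (intro continuous_intros K_props(2)) (auto simp: less_imp_neq[symmetric])
  have ug: "u t x powr \<beta> \<le> g t * u t x" if t: "t > 0" for t x
  proof -
    have u0: "u t x \<ge> 0" using u_nonneg t by simp
    have "u t x powr \<beta> = u t x powr (\<beta> - 1) * u t x"
      using u0 powr_add[of "u t x" "\<beta> - 1" 1] by (cases "u t x = 0") auto
    also have "\<dots> \<le> ((A + B * K t) powr (- (real CARD('n) / \<alpha>))) powr (\<beta> - 1) * u t x"
      using u0 decay[of t x] t beta by (intro mult_right_mono powr_mono2) auto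
    also have "((A + B * K t) powr (- (real CARD('n) / \<alpha>))) powr (\<beta> - 1) = g t"
      by (simp add: g_def e_def powr_powr)
    finally show ?thesis .
  qed
  let ?hg = "\<lambda>\<tau>. h \<tau> * g \<tau>"
  have hg_cont: "continuous_on {0..} ?hg" by (intro continuous_on_mult h_cont g_cont)
  have hg_nonneg: "?hg \<tau> \<ge> 0" if "\<tau> \<ge> 0" for \<tau> using h_nonneg[OF that] g_nonneg by simp
  define F where "F t = integral {0..t} ?hg" for t
  note F = indefinite_integral_nonneg[OF hg_cont hg_nonneg, folded F_def]
  have low: "mass s * (1 - (F t - F s)) \<le> mass t" if "0 \<le> s" "s \<le> t" for s t
    unfolding F_def by (rule mass_lower[OF that g_cont g_nonneg ug])
  define I where "I = ennreal (B powr (- e)) * (\<integral>\<^sup>+s\<in>{1..}. ennreal (h s) * neg_powr (K s) e \<partial>lborel)"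
  have I: "I < \<infinity>" using hK by (simp add: I_def e_def ennreal_mult_less_top)
  have Fb: "F t \<le> F 1 + enn2real I" if t: "t \<ge> 1" for t
  proof -
    have cont: "continuous_on {a..b} ?hg" if "a \<ge> 0" for a b
      by (rule continuous_on_subset[OF hg_cont]) (use that in auto)
    have hgi: "?hg integrable_on {0..t}" by (intro integrable_continuous_real cont) simp
    have Fd: "F t = F 1 + integral {1..t} ?hg"
      unfolding F_def using t by (intro Henstock_Kurzweil_Integration.integral_combine[symmetric] hgi) auto
    have "set_integrable lborel {1..t} ?hg"
      unfolding set_integrable_def by (rule borel_integrable_atLeastAtMost'[OF cont, unfolded set_integrable_def]) simp
    note si = this set_borel_integral_eq_integral(2)[OF this]
    have "ennreal (integral {1..t} ?hg) = ennreal (LINT s|lborel. indicator {1..t} s *\<^sub>R ?hg s)"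
      using si(2) by (simp add: set_lebesgue_integral_def)
    also have "\<dots> = (\<integral>\<^sup>+s. ennreal (indicator {1..t} s *\<^sub>R ?hg s) \<partial>lborel)"
      using si(1) hg_nonneg unfolding set_integrable_def
      by (intro nn_integral_eq_integral[symmetric]) (auto simp: indicator_def)
    also have "\<dots> \<le> (\<integral>\<^sup>+s. ennreal (B powr (- e)) * (ennreal (h s) * neg_powr (K s) e * indicator {1..} s) \<partial>lborel)"
    proof (rule nn_integral_mono)
      fix s
      show "ennreal (indicator {1..t} s *\<^sub>R ?hg s) \<le> ennreal (B powr (- e)) * (ennreal (h s) * neg_powr (K s) e * indicator {1..} s)"
      proof (cases "s \<in> {1..t}")
        case True
        then have s: "s \<ge> 1" "s \<ge> 0" by auto
        show ?thesis
        \<comment> \<open>If K vanishes at s, \<open>neg_powr\<close> is infinite there and h s > 0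
          keeps the product infinite, since 0 times \<infinity> is 0 in
          \<open>ennreal\<close>.\<close>
        proof (cases "K s = 0")
          case True
          then show ?thesis using h_pos[of s] s B by (simp add: neg_powr_def ennreal_mult_top ennreal_top_mult)
        next
          case False
          then have Ks: "K s > 0" using K_nonneg[OF s(2)] by simp
          have "g s \<le> (B * K s) powr (- e)"
            unfolding g_def using A B Ks e by (intro powr_mono2') auto
          also have "\<dots> = B powr (- e) * K s powr (- e)" using B Ks by (simp add: powr_mult)
          finally have "?hg s \<le> B powr (- e) * (h s * K s powr (- e))"
            using mult_left_mono[OF _ h_nonneg[OF s(2)]] by (fastforce simp: mult_ac)
          moreover have "neg_powr (K s) e = ennreal (K s powr (- e))"
            using Ks by (simp add: neg_powr_def inverse_ennreal powr_minus)
          ultimately show ?thesis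
            using True s h_nonneg[OF s(2)] by (simp add: ennreal_mult[symmetric] ennreal_leI)
        qed
      qed simp
    qed
    also have "\<dots> \<le> I"
    proof -
      have [measurable]: "(\<lambda>s. indicator {1..} s *\<^sub>R h s) \<in> borel_measurable borel"
        "(\<lambda>s. indicator {1..} s *\<^sub>R K s) \<in> borel_measurable borel"
        by (intro borel_measurable_continuous_on_indicator continuous_on_subset[OF h_cont]
            continuous_on_subset[OF K_props(2)]; auto)+
      \<comment> \<open>h and K are continuous on the half line only, so measurability is obtained
        after multiplying by the indicator. Outside it the right-hand side is 0 times \<infinity>,
        again 0.\<close>
      have "(\<lambda>s. ennreal (h s) * neg_powr (K s) e * indicator {1..} s)
          = (\<lambda>s. ennreal (indicator {1..} s *\<^sub>R h s) * neg_powr (indicator {1..} s *\<^sub>R K s) e)"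
        by (auto simp: indicator_def fun_eq_iff)
      also have "\<dots> \<in> borel_measurable lborel" unfolding neg_powr_def by measurable
      finally show ?thesis unfolding I_def by (subst nn_integral_cmult) auto
    qed
    finally have "ennreal (integral {1..t} ?hg) \<le> I" .
    then have "integral {1..t} ?hg \<le> enn2real I"
      using I by (metis ennreal_enn2real ennreal_le_iff enn2real_nonneg infinity_ennreal_def less_top)
    then show ?thesis using Fd by simp
  qed
  have Fbound: "F t \<le> F 1 + enn2real I" if "t \<ge> 0" for t
    using Fb[of t] F(3)[of t 1] that enn2real_nonneg[of I] by (cases "t \<ge> 1") (simp, linarith)
  \<comment> \<open>Each growth of F by 1/2 halves the mass at worst, by \<open>low\<close>. The
    intermediate value theorem supplies the time at which F reaches n/2, and the boundedness of F
    limits the number of halvings by a fixed N.\<close>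
  have step: "mass t \<ge> m0 / 2 ^ n" if "t \<ge> 0" "F t \<le> real n / 2" for n t
    using that
  proof (induction n arbitrary: t)
    case 0
    then have "F t = 0" using F(3)[of 0 t] F(1) by simp
    then show ?case using low[of 0 t] 0 F(1) by (simp add: mass_0)
  next
    case (Suc n)
    show ?case
    proof (cases "F t \<le> real n / 2")
      case True
      have "m0 / 2 ^ Suc n \<le> m0 / 2 ^ n" using m0_pos by (simp add: field_simps)
      then show ?thesis using Suc.IH[OF Suc.prems(1) True] by simp
    next
      case False
      have "\<exists>s. 0 \<le> s \<and> s \<le> t \<and> F s = real n / 2"
        using False F(1) Suc.prems by (intro IVT' continuous_on_subset[OF F(2)]) auto
      then obtain s where s: "0 \<le> s" "s \<le> t" "F s = real n / 2" by blast
      have "m0 / 2 ^ Suc n = m0 / 2 ^ n * (1/2)" by simp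
      also have "\<dots> \<le> mass s * (1/2)" using Suc.IH[of s] s by (intro mult_right_mono) auto
      also have "\<dots> \<le> mass s * (1 - (F t - F s))"
        using s Suc.prems mass_nonneg[OF s(1)] by (intro mult_left_mono) (auto simp: field_simps)
      also have "\<dots> \<le> mass t" using s by (intro low)
      finally show ?thesis .
    qed
  qed
  obtain N :: nat where N: "2 * (F 1 + enn2real I) \<le> real N" using real_arch_simple by blast
  have lower: "m0 / 2 ^ N \<le> mass t" if "t \<ge> 0" for t
    using step[OF that, of N] Fbound[OF that] N by simp
  define Minf where "Minf = (INF t\<in>{0..}. mass t)"
  have bdd: "bdd_below (mass ` {0..})" by (rule bdd_belowI2[of _ 0]) (auto intro: mass_nonneg)
  have "Minf \<ge> m0 / 2 ^ N" unfolding Minf_def by (rule cINF_greatest) (auto simp: lower)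
  moreover have "m0 / 2 ^ N > 0" using m0_pos by simp
  ultimately have "Minf > 0" by linarith
  moreover have "(mass \<longlongrightarrow> Minf) at_top"
  proof (rule order_tendstoI)
    fix a assume "a < Minf"
    then have "a < mass t" if "t \<ge> 0" for t
      using cINF_lower[OF bdd, of t] that unfolding Minf_def by force
    then show "eventually (\<lambda>t. a < mass t) at_top"
      by (auto intro: eventually_at_top_linorderI[of 0])
  next
    fix a assume "Minf < a"
    then obtain t0 where t0: "t0 \<ge> 0" "mass t0 < a"
      unfolding Minf_def using cINF_less_iff[OF _ bdd, of a] by auto
    have "mass t < a" if "t \<ge> t0" for t using mass_antimono[OF t0(1) that] t0(2) by simp
    then show "eventually (\<lambda>t. mass t < a) at_top" by (rule eventually_at_top_linorderI)
  qed
  ultimately show ?thesis by blast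
qed

end

theorem theorem4:
  fixes \<alpha> \<beta> r :: real
    and h k K M :: "real \<Rightarrow> real"
    and u0 :: "real^'n \<Rightarrow> real"
    and u :: "real \<Rightarrow> real^'n \<Rightarrow> real"
  assumes alpha: "0 < \<alpha>" "\<alpha> < 2"
    and beta: "\<beta> > 1"
    and r: "r > 0"
    and h: "continuous_on {0..} h" "\<And>t. t \<ge> 0 \<Longrightarrow> h t \<ge> 0" "\<And>t. t \<ge> 0 \<Longrightarrow> t \<noteq> 0 \<Longrightarrow> h t > 0"
    and k: "continuous_on {0..} k" "\<And>t. t \<ge> 0 \<Longrightarrow> k t \<ge> 0"
    and kernel: "\<And>T. T > 0 \<Longrightarrow>
          (SUP t\<in>{0..T}. \<integral>\<^sup>+s\<in>{0..t}. neg_powr (LINT \<rho>:{s..t}|lborel. k \<rho>) (1 / \<alpha>) \<partial>lborel) < \<infinity>"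
    and u0: "u0 \<in> bcontfun" "integrable lborel u0"
    and u0_nonneg: "\<And>x. u0 x \<ge> 0"
    and u0_pos: "(LINT x|lborel. \<bar>u0 x\<bar>) > 0"
    and u: "classical_solution r \<alpha> k h (\<lambda>y. \<bar>y\<bar> powr \<beta>) u0 u"
    and K: "\<And>t. t \<ge> 0 \<Longrightarrow> K t = (LINT s:{0..t}|lborel. k s)"
    and M: "\<And>t. t \<ge> 0 \<Longrightarrow> M t = (LINT x|lborel. u t x)"
    and hK: "(\<integral>\<^sup>+s\<in>{1..}. ennreal (h s) * neg_powr (K s) (real CARD('n) / \<alpha> * (\<beta> - 1)) \<partial>lborel) < \<infinity>"
  shows "\<exists>Minf. Minf > 0 \<and> (M \<longlongrightarrow> Minf) at_top"
proof -
  have mass_pos: "(LINT x|lborel. u0 x) > 0"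
    using u0_pos u0_nonneg by simp
  interpret S: nonneg_data \<alpha> \<beta> r h k u0 u
    by unfold_locales (fact alpha beta r h k u0 u0_nonneg mass_pos u)+
  \<comment> \<open>The statement uses the Lebesgue integral, the locale the gauge integral; they
    agree for the continuous k. K and M are prescribed for nonnegative times, which covers the range
    {1..} and the limit at infinity.\<close>
  have K_eq: "K t = S.K t" if "t \<ge> 0" for t
  proof -
    have "set_integrable lborel {0..t} k"
      unfolding set_integrable_def
      by (rule borel_integrable_atLeastAtMost'[OF continuous_on_subset[OF k(1)], unfolded set_integrable_def]) auto
    then show ?thesis
      unfolding K[OF that] S.K_def by (rule set_borel_integral_eq_integral(2))
  qed
  have "(\<integral>\<^sup>+s\<in>{1..}. ennreal (h s) * neg_powr (S.K s) (real CARD('n) / \<alpha> * (\<beta> - 1)) \<partial>lborel)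
      = (\<integral>\<^sup>+s\<in>{1..}. ennreal (h s) * neg_powr (K s) (real CARD('n) / \<alpha> * (\<beta> - 1)) \<partial>lborel)"
    by (rule nn_integral_cong) (auto simp: indicator_def K_eq)
  also have "\<dots> < \<infinity>" by (rule hK)
  finally obtain Minf where Minf: "Minf > 0" "(S.mass \<longlongrightarrow> Minf) at_top"
    using S.mass_limit h(3) by fastforce
  have "eventually (\<lambda>t. S.mass t = M t) at_top"
    by (rule eventually_at_top_linorderI[of 0]) (simp add: M S.mass_def)
  then have "(M \<longlongrightarrow> Minf) at_top"
    using Lim_transform_eventually[OF Minf(2)] by blast
  then show ?thesis using Minf(1) by blast
qed

end
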